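(* Let $M$ be a Möbius structure on the circle $X=S^1$ which is ptolemaic (Axiom (P)), satisfies Axiom (M($\alpha$)) for some $0<\alpha<1$, and whose $M$-topology is the topology of $S^1$ (Axiom (T)). Then: (1) the zig-zag distance $\delta$ on $\mathrm{Hm}$ is nondegenerate: for $q,q'\in\mathrm{Hm}$, $\delta(q,q')\neq 0$ if and only if $q\neq q'$; (2) the $\delta$-metric topology on $\mathrm{Hm}$ coincides with the topology induced from $X^4$; (3) the metric space $(\mathrm{Hm},\delta)$ is complete. In particular, $(\mathrm{Hm},\delta)$ is a proper (closed balls are compact) geodesic metric space.
   Context: **Möbius structures.** A semi-metric on a set $X$ is a symmetric function $d:X^2\to\mathbb{R}\cup\{\infty\}$, positive off the diagonal and zero on the diagonal, having at most one infinitely remote point $\omega\in X$, i.e. a point with $d(x,\omega)=\infty$ for some $x\ne\omega$; it is required that then $d(x,\omega)=\infty$ for all $x\neq\omega$. Two semi-metrics are Möbius equivalent if they have the same cross-ratios on every 4-tuple of pairwise distinct points $(x,y,z,u)$, i.e. the same ratios between the three products $|xy||zu|$, $|xz||yu|$, $|xu||yz|$ (if one of the points is infinitely remote, the infinite factors, one in each product, are cancelled). A Möbius structure $M$ on $X$ is a class of all semi-metrics Möbius equivalent to a given one. For each $\omega\in X$ there is a semi-metric $|\cdot\,\cdot|_\omega=d_\omega\in M$ with infinitely remote point $\omega$, unique up to homothety; it is obtained from any $d\in M$ for which $\omega$ is not infinitely remote by metric inversion $d_\omega(x,y)=\frac{d(x,y)}{d(x,\omega)d(y,\omega)}$. Write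 $X_\omega=X\setminus\{\omega\}$. The $M$-topology on $X$ has as subbase all open balls centered at finite points of all semi-metrics in $M$ having infinitely remote points. **Axioms** for a Möbius structure $M$ on the circle $X=S^1$ (if one of the four points is infinitely remote, the infinite factors, one in each of the products $|xy||zu|$, $|xz||yu|$, $|xu||yz|$, are cancelled; each inequality holds for one semi-metric of $M$ iff it holds for all): (T) the $M$-topology on $X$ is that of $S^1$. (M($\alpha$)) ($0<\alpha<1$ fixed) for every 4-tuple $(x,y,z,u)\in X^4$ such that the pairs $(x,y)$, $(z,u)$ separate each other on the circle, $|xy||zu|\ge\max\{|xz||yu|+\alpha|xu||yz|,\ \alpha|xz||yu|+|xu||yz|\}$. (P) for every 4-tuple $(x,y,z,u)\in X^4$, $|xy||zu|\le|xz||yu|+|xu||yz|$. **Harmonic pairs.** $\mathrm{aY}$ is the set of unordered pairs of distinct points of $X$. A pair $(a,b)\in\mathrm{aY}\times\mathrm{aY}$, $a=(x,y)$, $b=(z,u)$, is harmonic if $|xz||yu|=|xu||yz|$ for some (hence any) semi-metric of $M$ (the four points are then pairwise distinct). $\mathrm{Hm}$ is the set of unordered harmonic pairs $q=(a,b)\sim(b,a)$; $a,b$ are called the axes of $q$. The topology on $\mathrm{Hm}$ induced from $X^4$ is the quotient of the subspace topology on the harmonic 4-tuples $(x,y,z,u)\in X^4$ by the identifications $x\leftrightarrow y$, $z\leftrightarrow u$, $(x,y)\leftrightarrow(z,u)$. **Lines, segments, distance.** For $a\in\mathrm{aY}$ the line $\mathrm{h}_a\subset\mathrm{Hm}$ with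 axis $a$ is the set of all harmonic pairs $(a,b)\in\mathrm{Hm}$ having $a$ as an axis (for each $x\in X\setminus a$ there is a unique $y$ with $(a,(x,y))$ harmonic). For $q=(a,b)$, $q'=(a,b')\in\mathrm{h}_a$ the segment $qq'\subset\mathrm{h}_a$ consists of $q,q'$ and all $(a,b'')\in\mathrm{h}_a$ such that $b$ and $b'$ lie on different open arcs of $X$ determined by $b''$. Its length is $$|qq'|=\left|\ln\frac{|xz'||yz|}{|xz||yz'|}\right|,\qquad a=(x,y),\ b=(z,u),\ b'=(z',u'),$$ computed in any semi-metric of $M$. **Zig-zag paths and $\delta$.** A zz-path $S\subset\mathrm{Hm}$ is a finite (maybe empty) sequence of segments $\sigma_i$ on lines in $\mathrm{Hm}$ (the sides), where consecutive segments $\sigma_i,\sigma_{i+1}$ have a common end $q$ whose two axes are the axes of the lines containing $\sigma_i$ and $\sigma_{i+1}$ respectively. Its length is $|S|=\sum_i|\sigma_i|$. Set $\delta(q,q')=\inf_S|S|$ over all zz-paths $S$ from $q$ to $q'$. It is known that any two points of $\mathrm{Hm}$ are connected by a zz-path (with at most five sides) and that $\delta$ is a finite pseudometric. *)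

theory Defs
  imports "HOL-Analysis.Analysis"
begin

section \<open>Moebius structures\<close>

definition infinitely_remote :: "'a set \<Rightarrow> ('a \<Rightarrow> 'a \<Rightarrow> ennreal) \<Rightarrow> 'a \<Rightarrow> bool" where
  "infinitely_remote X d \<omega> \<longleftrightarrow> \<omega> \<in> X \<and> (\<forall>x\<in>X. x \<noteq> \<omega> \<longrightarrow> d x \<omega> = \<infinity>)"

text \<open>Values outside the carrier \<open>X\<close> are irrelevant. The last clause says that infinite values occur
  only through a single point, which is then at infinite distance from every other point.\<close>

definition semimetric :: "'a set \<Rightarrow> ('a \<Rightarrow> 'a \<Rightarrow> ennreal) \<Rightarrow> bool" where
  "semimetric X d \<longleftrightarrow>
     (\<forall>x\<in>X. \<forall>y\<in>X. d x y = d y x) \<and>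
     (\<forall>x\<in>X. d x x = 0) \<and>
     (\<forall>x\<in>X. \<forall>y\<in>X. x \<noteq> y \<longrightarrow> 0 < d x y) \<and>
     ((\<forall>x\<in>X. \<forall>y\<in>X. d x y \<noteq> \<infinity>) \<or>
      (\<exists>\<omega>. infinitely_remote X d \<omega> \<and> (\<forall>x\<in>X - {\<omega>}. \<forall>y\<in>X - {\<omega>}. d x y \<noteq> \<infinity>)))"

text \<open>The distance as a real factor of a product. Infinite factors are replaced by 1: if one of the
  points of a tuple is infinitely remote, there is exactly one infinite factor in each of the
  products that are compared, so this is the cancellation of these factors. (In tuples with
  coinciding points, the formulas below also give the intended result: harmonic tuples never have
  coinciding points, and the Ptolemaic inequality is trivially true for tuples that have them.)\<close>

definition factor :: "('a \<Rightarrow> 'a \<Rightarrow> ennreal) \<Rightarrow> 'a \<Rightarrow> 'a \<Rightarrow> real" where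
  "factor d x y = (if d x y = \<infinity> then 1 else enn2real (d x y))"

definition moebius_equivalent ::
    "'a set \<Rightarrow> ('a \<Rightarrow> 'a \<Rightarrow> ennreal) \<Rightarrow> ('a \<Rightarrow> 'a \<Rightarrow> ennreal) \<Rightarrow> bool" where
  "moebius_equivalent X d d' \<longleftrightarrow>
     (\<forall>x\<in>X. \<forall>y\<in>X. \<forall>z\<in>X. \<forall>u\<in>X. distinct [x, y, z, u] \<longrightarrow>
        (let p1 = factor d x y * factor d z u;  p1' = factor d' x y * factor d' z u;
             p2 = factor d x z * factor d y u;  p2' = factor d' x z * factor d' y u;
             p3 = factor d x u * factor d y z;  p3' = factor d' x u * factor d' y z
         in p1 / p2 = p1' / p2' \<and> p1 / p3 = p1' / p3' \<and> p2 / p3 = p2' / p3'))"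

definition moebius_structure :: "'a set \<Rightarrow> ('a \<Rightarrow> 'a \<Rightarrow> ennreal) set \<Rightarrow> bool" where
  "moebius_structure X M \<longleftrightarrow>
     (\<exists>d. semimetric X d \<and> M = {d'. semimetric X d' \<and> moebius_equivalent X d d'})"

definition moebius_topology :: "'a set \<Rightarrow> ('a \<Rightarrow> 'a \<Rightarrow> ennreal) set \<Rightarrow> 'a topology" where
  "moebius_topology X M = topology_generated_by
     {{y \<in> X. d x y < ennreal r} | d x r \<omega>.
        d \<in> M \<and> infinitely_remote X d \<omega> \<and> x \<in> X \<and> x \<noteq> \<omega> \<and> 0 < r}"


section \<open>The axioms\<close>

definition axiom_T :: "'a::topological_space set \<Rightarrow> ('a \<Rightarrow> 'a \<Rightarrow> ennreal) set \<Rightarrow> bool" where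
  "axiom_T X M \<longleftrightarrow> moebius_topology X M = top_of_set X"

text \<open>On a circle \<open>X\<close>: \<open>z\<close> and \<open>u\<close> lie on different open arcs determined by \<open>x\<close> and \<open>y\<close>.\<close>

definition separate :: "'a::topological_space set \<Rightarrow> 'a \<Rightarrow> 'a \<Rightarrow> 'a \<Rightarrow> 'a \<Rightarrow> bool" where
  "separate X x y z u \<longleftrightarrow>
     x \<in> X \<and> y \<in> X \<and> z \<in> X - {x, y} \<and> u \<in> X - {x, y} \<and>
     \<not> connected_component (X - {x, y}) z u"

definition axiom_M ::
    "real \<Rightarrow> 'a::topological_space set \<Rightarrow> ('a \<Rightarrow> 'a \<Rightarrow> ennreal) set \<Rightarrow> bool" where
  "axiom_M \<alpha> X M \<longleftrightarrow>
     (\<forall>d\<in>M. \<forall>x\<in>X. \<forall>y\<in>X. \<forall>z\<in>X. \<forall>u\<in>X. separate X x y z u \<longrightarrow>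
        factor d x y * factor d z u \<ge>
          max (factor d x z * factor d y u + \<alpha> * (factor d x u * factor d y z))
              (\<alpha> * (factor d x z * factor d y u) + factor d x u * factor d y z))"

definition axiom_P :: "'a set \<Rightarrow> ('a \<Rightarrow> 'a \<Rightarrow> ennreal) set \<Rightarrow> bool" where
  "axiom_P X M \<longleftrightarrow>
     (\<forall>d\<in>M. \<forall>x\<in>X. \<forall>y\<in>X. \<forall>z\<in>X. \<forall>u\<in>X.
        factor d x y * factor d z u \<le>
          factor d x z * factor d y u + factor d x u * factor d y z)"


section \<open>Harmonic pairs\<close>

definition harmonic_tuples ::
    "'a set \<Rightarrow> ('a \<Rightarrow> 'a \<Rightarrow> ennreal) set \<Rightarrow> ('a \<times> 'a \<times> 'a \<times> 'a) set" where
  "harmonic_tuples X M =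
     {(x, y, z, u). x \<in> X \<and> y \<in> X \<and> z \<in> X \<and> u \<in> X \<and> x \<noteq> y \<and> z \<noteq> u \<and>
        (\<exists>d\<in>M. factor d x z * factor d y u = factor d x u * factor d y z)}"

text \<open>Unordered pairs of distinct objects are two-element sets. On tuples of pairwise distinct points,
  two tuples have the same image here iff they are related by the identifications
  \<open>x \<leftrightarrow> y\<close>, \<open>z \<leftrightarrow> u\<close>, \<open>(x, y) \<leftrightarrow> (z, u)\<close>.\<close>

definition unordered :: "'a \<times> 'a \<times> 'a \<times> 'a \<Rightarrow> 'a set set" where
  "unordered = (\<lambda>(x, y, z, u). {{x, y}, {z, u}})"

definition Hm :: "'a set \<Rightarrow> ('a \<Rightarrow> 'a \<Rightarrow> ennreal) set \<Rightarrow> 'a set set set" where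
  "Hm X M = unordered ` harmonic_tuples X M"

definition Hm_topology ::
    "'a::topological_space set \<Rightarrow> ('a \<Rightarrow> 'a \<Rightarrow> ennreal) set \<Rightarrow> 'a set set topology" where
  "Hm_topology X M = topology (\<lambda>U. U \<subseteq> Hm X M \<and>
     openin (top_of_set (harmonic_tuples X M)) {t \<in> harmonic_tuples X M. unordered t \<in> U})"

lemma istopology_Hm:
  "istopology (\<lambda>U. U \<subseteq> Hm X M \<and>
     openin (top_of_set (harmonic_tuples X M)) {t \<in> harmonic_tuples X M. unordered t \<in> U})"
  (is "istopology (\<lambda>U. U \<subseteq> Hm X M \<and> openin ?T (?pre U))")
proof -
  have "S \<inter> T \<subseteq> Hm X M \<and> openin ?T (?pre (S \<inter> T))"
    if S: "S \<subseteq> Hm X M \<and> openin ?T (?pre S)" and T: "T \<subseteq> Hm X M \<and> openin ?T (?pre T)" for S T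
  proof
    show "S \<inter> T \<subseteq> Hm X M" using S by blast
    have "?pre (S \<inter> T) = ?pre S \<inter> ?pre T" by blast
    then show "openin ?T (?pre (S \<inter> T))"
      by (simp only:) (rule openin_Int[OF conjunct2[OF S] conjunct2[OF T]])
  qed
  moreover have "\<Union>\<K> \<subseteq> Hm X M \<and> openin ?T (?pre (\<Union>\<K>))"
    if K: "\<forall>K\<in>\<K>. K \<subseteq> Hm X M \<and> openin ?T (?pre K)" for \<K>
  proof
    show "\<Union>\<K> \<subseteq> Hm X M" using K by blast
    have eq: "?pre (\<Union>\<K>) = \<Union> (?pre ` \<K>)" by blast
    show "openin ?T (?pre (\<Union>\<K>))"
      unfolding eq by (rule openin_Union) (use K in \<open>elim imageE, simp only:\<close>)
  qed
  ultimately show ?thesis unfolding istopology_def by (intro conjI allI impI) presburger+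
qed

lemma openin_Hm_topology:
  "openin (Hm_topology X M) U \<longleftrightarrow> U \<subseteq> Hm X M \<and>
     openin (top_of_set (harmonic_tuples X M)) {t \<in> harmonic_tuples X M. unordered t \<in> U}"
  unfolding Hm_topology_def by (simp only: topology_inverse'[OF istopology_Hm])


section \<open>Zig-zag paths\<close>

definition line :: "'a set \<Rightarrow> ('a \<Rightarrow> 'a \<Rightarrow> ennreal) set \<Rightarrow> 'a set \<Rightarrow> 'a set set set" where
  "line X M a = {q \<in> Hm X M. a \<in> q}"

text \<open>The length of the segment of the line with axis \<open>a\<close> that has the ends \<open>q\<close> and \<open>q'\<close>. For harmonic
  pairs of a Moebius structure, it depends neither on the semi-metric \<open>d\<close> nor on the choice of
  the representatives \<open>x\<close>, \<open>y\<close>, \<open>z\<close>, \<open>z'\<close>.\<close>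

definition segment_length ::
    "('a \<Rightarrow> 'a \<Rightarrow> ennreal) set \<Rightarrow> 'a set \<Rightarrow> 'a set set \<Rightarrow> 'a set set \<Rightarrow> real" where
  "segment_length M a q q' =
     (THE l. \<exists>d\<in>M. \<exists>x y z u z' u'. a = {x, y} \<and> q = {a, {z, u}} \<and> q' = {a, {z', u'}} \<and>
        l = \<bar>ln ((factor d x z' * factor d y z) / (factor d x z * factor d y z'))\<bar>)"

text \<open>A side \<open>(a, p, p')\<close> stands for the segment with ends \<open>p\<close> and \<open>p'\<close> of the line with axis \<open>a\<close>,
  traversed from \<open>p\<close> to \<open>p'\<close>. A segment is determined by its axis and its ends, and nothing else
  enters the distance, so the points between the ends are not recorded.\<close>

type_synonym 'a side = "'a set \<times> 'a set set \<times> 'a set set"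

fun zz_path ::
    "'a set \<Rightarrow> ('a \<Rightarrow> 'a \<Rightarrow> ennreal) set \<Rightarrow> 'a set set \<Rightarrow> 'a side list \<Rightarrow> 'a set set \<Rightarrow> bool"
where
  "zz_path X M q [] q' \<longleftrightarrow> q \<in> Hm X M \<and> q = q'"
| "zz_path X M q ((a, p, p') # S) q' \<longleftrightarrow>
     p = q \<and> p \<in> line X M a \<and> p' \<in> line X M a \<and>
     (S \<noteq> [] \<longrightarrow> p' = {a, fst (hd S)}) \<and>
     zz_path X M p' S q'"

definition zz_length :: "('a \<Rightarrow> 'a \<Rightarrow> ennreal) set \<Rightarrow> 'a side list \<Rightarrow> real" where
  "zz_length M S = (\<Sum>(a, p, p')\<leftarrow>S. segment_length M a p p')"

text \<open>The value 0 outside \<open>Hm\<close> is a dummy: the locale \<open>Metric_space\<close> asks for symmetry and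
  nonnegativity on the whole type.\<close>

definition zz_dist ::
    "'a set \<Rightarrow> ('a \<Rightarrow> 'a \<Rightarrow> ennreal) set \<Rightarrow> 'a set set \<Rightarrow> 'a set set \<Rightarrow> real" where
  "zz_dist X M q q' =
     (if q \<in> Hm X M \<and> q' \<in> Hm X M then INF S \<in> {S. zz_path X M q S q'}. zz_length M S else 0)"


section \<open>Proper and geodesic metric spaces\<close>

definition proper_metric :: "'b set \<Rightarrow> ('b \<Rightarrow> 'b \<Rightarrow> real) \<Rightarrow> bool" where
  "proper_metric S \<delta> \<longleftrightarrow>
     (\<forall>p\<in>S. \<forall>r. compactin (Metric_space.mtopology S \<delta>) (Metric_space.mcball S \<delta> p r))"

definition geodesic_metric :: "'b set \<Rightarrow> ('b \<Rightarrow> 'b \<Rightarrow> real) \<Rightarrow> bool" where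
  "geodesic_metric S \<delta> \<longleftrightarrow>
     (\<forall>p\<in>S. \<forall>p'\<in>S. \<exists>\<gamma>. \<gamma> ` {0..\<delta> p p'} \<subseteq> S \<and> \<gamma> 0 = p \<and> \<gamma> (\<delta> p p') = p' \<and>
        (\<forall>s\<in>{0..\<delta> p p'}. \<forall>t\<in>{0..\<delta> p p'}. \<delta> (\<gamma> s) (\<gamma> t) = \<bar>s - t\<bar>))"

end

theory Submission
  imports Defs
begin

text \<open>
  Weighting a semi-metric of \<open>M\<close> by \<open>f x a + f x b\<close>, for two fixed points \<open>a\<close>, \<open>b\<close>, gives a bounded
  metric \<open>D\<close> on the circle that belongs to \<open>M\<close>, so all cross-ratios can be computed in \<open>D\<close>.

  The height \<open>1 / D x y + 1 / D z u\<close> of a harmonic tuple measures how degenerate it is. Axiom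
  \<open>M(\<alpha>)\<close> implies that a move of length \<open>l\<close> along a line multiplies the height by at most \<open>exp (C l)\<close> and
  displaces the four points by at most a multiple of \<open>(exp l - 1) exp (C l)\<close> times the height. Both bounds
  add up along zig-zag paths. Hence \<open>\<delta>\<close> is nondegenerate, its topology is finer than that of \<open>Hm\<close>,
  and closed \<open>\<delta>\<close>-balls lie in compact sets.

  Conversely, \<open>M(\<alpha>)\<close> makes the Hilbert metric of an arc strictly monotone in the arc. Therefore two
  disjoint unlinked axes have only one common perpendicular, which then depends continuously on the
  axes. If \<open>(a', b')\<close> is close to \<open>(a, b)\<close>, shift \<open>a\<close> a little along \<open>b\<close> to \<open>a1\<close>: the common
  perpendicular of \<open>a1\<close> and \<open>a'\<close> is close to \<open>b\<close>, and going through it yields a short path. So the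
  two topologies agree, and geodesics come from properness and the splitting of almost shortest paths.
\<close>

section \<open>The circle\<close>

text \<open>Paths may have any number of sides, so a bound for one side helps only if it depends on
  the starting tuple through a quantity that is itself controlled along the path.
  \<open>M(\<alpha>)\<close> bounds the displacement from \<open>z\<close> to \<open>z'\<close> by
  either of the mixed products \<open>D x z * D y z'\<close> and \<open>D x z' * D y z\<close>,
  divided by \<open>D x y\<close>. Multiplying the two bounds regroups the factors by tuple, and for
  a harmonic tuple \<open>D x z * D y z \<le> 4 * (D z u * (D z u + D x y))\<close>. After taking
  roots exactly the height \<open>H\<close> appears, and its change obeys
  \<open>H' - H \<le> K * (exp l - 1) * sqrt (H * H')\<close> with \<open>K = 8 / \<alpha>\<close>,
  a discrete Gronwall inequality for \<open>sqrt H\<close>. Squaring its solution gives the rate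
  \<open>16 / \<alpha>\<close>.

  The preliminary shift of \<open>a\<close> along \<open>b\<close> is forced: close axes
  \<open>a\<close> and \<open>a'\<close> may cross or share an end, where
  \<open>common_perpendicular_ex\<close> does not apply, while the shifted axis is disjoint and
  unlinked from \<open>a\<close> and from every axis close enough to \<open>a\<close>.\<close>

lemma cis_eq_imp_eq:
  assumes "cis a = cis b" "\<bar>a - b\<bar> < 2 * pi"
  shows "a = b"
proof -
  have "cis (a - b) = 1" using assms(1) by (simp flip: cis_divide)
  then have "cos (a - b) = 1" by (metis cis.simps(1) one_complex.simps(1))
  then obtain n :: int where n: "a - b = of_int n * 2 * pi" by (auto simp: cos_one_2pi_int)
  have "\<bar>of_int n\<bar> * (2 * pi) < 1 * (2 * pi)" using assms(2) n by (simp add: abs_mult)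
  then have "\<bar>real_of_int n\<bar> < 1" by (simp del: mult_1)
  then have "n = 0" by linarith
  with n show ?thesis by simp
qed

lemma sphere_eq_cis:
  assumes "x \<in> sphere (0::complex) 1"
  obtains t where "s \<le> t" "t < s + 2 * pi" "x = cis t"
proof -
  have "norm (x * cis (- s)) = 1" using assms by (simp add: norm_mult)
  then have "x * cis (- s) = cis (Arg2pi (x * cis (- s)))"
    using Arg2pi_eq[of "x * cis (- s)"] by (simp add: cis_conv_exp)
  then have "x * cis (- s) * cis s = cis (Arg2pi (x * cis (- s)) + s)" by (simp flip: cis_mult)
  then have "x = cis (Arg2pi (x * cis (- s)) + s)" by (simp add: mult.assoc cis_mult)
  with that[of "Arg2pi (x * cis (- s)) + s"] Arg2pi[of "x * cis (- s)"] show ?thesis by simp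
qed

text \<open>The two arcs lie on different sides of the chord through \<open>cis t1\<close> and \<open>cis t3\<close>.\<close>

lemma separate_cis:
  assumes "t1 < t2" "t2 < t3" "t3 < t4" "t4 < t1 + 2 * pi"
  shows "separate (sphere 0 1) (cis t1) (cis t3) (cis t2) (cis t4)"
proof -
  define m h where "m = (t1 + t3) / 2" and "h = (t3 - t1) / 2"
  define f where "f = (\<lambda>w. Re (w * cis (- m)) - cos h)"
  have f: "f (cis t) = cos (t - m) - cos h" for t by (simp add: f_def cis_mult cos_diff)
  have h: "0 < h" "h < pi" "t1 = m - h" "t3 = m + h" using assms by (auto simp: h_def m_def field_simps)
  have pos: "0 < f (cis t)" if "\<bar>t - m\<bar> < h" for t
    using cos_monotone_0_pi[of "\<bar>t - m\<bar>" h] that h by (simp add: f)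
  have neg: "f (cis t) < 0" if "m + h < t" "t < m - h + 2 * pi" for t
  proof (cases "t - m \<le> pi")
    case True
    then show ?thesis using cos_monotone_0_pi[of h "t - m"] that h by (simp add: f)
  next
    case False
    then have "cos (2 * pi - (t - m)) < cos h" using that h by (intro cos_monotone_0_pi) auto
    then show ?thesis by (simp add: f)
  qed
  have zero: "w = cis t1 \<or> w = cis t3" if "norm w = 1" "f w = 0" for w
  proof -
    have "w \<in> sphere 0 1" using that by simp
    then obtain t where t: "t1 \<le> t" "t < t1 + 2 * pi" "w = cis t" by (rule sphere_eq_cis)
    have "\<not> \<bar>t - m\<bar> < h" "\<not> t3 < t" using pos[of t] neg[of t] that t h by auto
    then have "t = t1 \<or> t = t3" using t h by linarith
    with t show ?thesis by auto
  qed
  have "\<not> connected_component (sphere 0 1 - {cis t1, cis t3}) (cis t2) (cis t4)"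
  proof
    assume "connected_component (sphere 0 1 - {cis t1, cis t3}) (cis t2) (cis t4)"
    then obtain T where T: "connected T" "T \<subseteq> sphere 0 1 - {cis t1, cis t3}" "cis t2 \<in> T" "cis t4 \<in> T"
      by (auto simp: connected_component_def)
    have "connected (f ` T)" using T(1) by (intro connected_continuous_image) (auto simp: f_def intro!: continuous_intros)
    moreover have "f (cis t4) < 0" "0 < f (cis t2)" using assms pos[of t2] neg[of t4] h by auto
    ultimately have "0 \<in> f ` T" using T(3,4) connectedD_interval[of "f ` T" "f (cis t4)" "f (cis t2)" 0] by auto
    with zero T(2) show False by force
  qed
  moreover have "cis t2 \<noteq> cis t1" "cis t2 \<noteq> cis t3" "cis t4 \<noteq> cis t1" "cis t4 \<noteq> cis t3"
    using assms by (auto dest!: cis_eq_imp_eq)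
  ultimately show ?thesis by (simp add: separate_def)
qed

lemma cis_add_2pi [simp]: "cis (a + 2 * pi) = cis a" "cis (a + pi * 2) = cis a"
  by (simp_all add: complex_eq_iff mult.commute[of pi])

text \<open>The principal \<open>Arg\<close> is continuous at 1 but jumps on the negative axis.
  Rotating by \<open>cis (- s)\<close> moves the limit to 1, so the angles measured from
  \<open>s\<close> converge.\<close>

lemma tendsto_cis_lift:
  assumes x: "x \<longlonglongrightarrow> cis s" "\<And>n. x n \<in> sphere 0 1"
  obtains t where "t \<longlonglongrightarrow> s" "\<And>n. x n = cis (t n)"
proof
  define t where "t = (\<lambda>n. s + Arg (x n * cis (- s)))"
  have "(\<lambda>n. x n * cis (- s)) \<longlonglongrightarrow> cis s * cis (- s)" by (intro tendsto_intros x)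
  then have "(\<lambda>n. x n * cis (- s)) \<longlonglongrightarrow> 1" by (simp add: cis_mult)
  moreover have "isCont Arg 1" by (intro continuous_at_Arg) (simp add: complex_nonpos_Reals_iff)
  ultimately have "(\<lambda>n. Arg (x n * cis (- s))) \<longlonglongrightarrow> Arg 1" using isCont_tendsto_compose by blast
  then have "t \<longlonglongrightarrow> s + Arg 1" unfolding t_def by (intro tendsto_add tendsto_const)
  then show "t \<longlonglongrightarrow> s" by (simp add: Arg_zero)
  show "x n = cis (t n)" for n
  proof -
    have "norm (x n * cis (- s)) = 1" using x(2)[of n] by (simp add: norm_mult)
    then have "cis (Arg (x n * cis (- s))) = x n * cis (- s)"
      by (subst cis_Arg) (auto simp: sgn_eq)
    then have "cis s * cis (Arg (x n * cis (- s))) = cis s * (x n * cis (- s))" by simp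
    also have "\<dots> = x n * (cis s * cis (- s))" by simp
    finally show ?thesis by (simp add: t_def cis_mult)
  qed
qed

text \<open>Convexity of \<open>exp\<close> between 0 and \<open>K * l\<close> with weights
  \<open>1 - 1 / K\<close> and \<open>1 / K\<close>. It turns the growth factor of one side into an
  exponential, and exponentials multiply along a path.\<close>

lemma one_plus_mult_expm1_le:
  fixes K l :: real
  assumes "1 \<le> K"
  shows "1 + K * (exp l - 1) \<le> exp (K * l)"
proof -
  have "exp ((1 - 1 / K) *\<^sub>R 0 + (1 / K) *\<^sub>R (K * l)) \<le> (1 - 1 / K) * exp 0 + (1 / K) * exp (K * l)"
    by (rule convex_onD[OF exp_convex]) (use assms in \<open>auto simp: field_simps\<close>)
  then have "exp l \<le> 1 - 1 / K + exp (K * l) / K" using assms by simp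
  then have "K * exp l \<le> K * (1 - 1 / K + exp (K * l) / K)" using assms by (intro mult_left_mono) auto
  also have "\<dots> = K - 1 + exp (K * l)" using assms by (simp add: algebra_simps)
  finally show ?thesis by (simp add: algebra_simps)
qed

text \<open>Two unordered pairs, each with one point on each of two arcs, can be listed so that
  corresponding points share an arc.\<close>

lemma pair_matching:
  assumes "(z, u) = (a, b) \<or> (z, u) = (b, a)" "(z', u') = (a', b') \<or> (z', u') = (b', a')"
  shows "\<exists>v w. ((v, w) = (z', u') \<or> (v, w) = (u', z')) \<and>
    ((z, u, v, w) = (a, b, a', b') \<or> (z, u, v, w) = (b, a, b', a'))"
  using assms by auto

abbreviation quad :: "'a \<Rightarrow> 'a \<Rightarrow> 'a \<Rightarrow> 'a \<Rightarrow> 'a set set" where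
  "quad x y z u \<equiv> {{x, y}, {z, u}}"

lemma quad_eqD: "{A, B} = {C, E} \<Longrightarrow> (C = A \<and> E = B) \<or> (C = B \<and> E = A)"
  by (auto simp: doubleton_eq_iff)

lemma dist_quadruple_le:
  "dist (x, y, z, u) (x', y', z', u') \<le> dist x x' + (dist y y' + (dist z z' + dist u u'))"
  unfolding dist_Pair_Pair
  by (intro order_trans[OF sqrt_sum_squares_le_sum] add_mono order_refl zero_le_dist) auto

section \<open>Semi-metrics of a ptolemaic Moebius structure\<close>

lemma factor_self: "semimetric X d \<Longrightarrow> x \<in> X \<Longrightarrow> factor d x x = 0"
  by (simp add: semimetric_def factor_def)

lemma factor_sym: "semimetric X d \<Longrightarrow> x \<in> X \<Longrightarrow> y \<in> X \<Longrightarrow> factor d x y = factor d y x"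
  by (simp add: semimetric_def factor_def)

lemma factor_pos:
  assumes "semimetric X d" "x \<in> X" "y \<in> X" "x \<noteq> y"
  shows "0 < factor d x y"
proof -
  have "0 < d x y" using assms by (auto simp: semimetric_def)
  then show ?thesis by (auto simp: factor_def enn2real_positive_iff top.not_eq_extremum)
qed

lemma factor_ennreal: "0 \<le> D x y \<Longrightarrow> factor (\<lambda>x y. ennreal (D x y)) x y = D x y"
  by (simp add: factor_def)

lemma semimetric_ennreal:
  assumes "\<And>x y. x \<in> X \<Longrightarrow> y \<in> X \<Longrightarrow> D x y = D y x" "\<And>x. x \<in> X \<Longrightarrow> D x x = 0"
    "\<And>x y. x \<in> X \<Longrightarrow> y \<in> X \<Longrightarrow> x \<noteq> y \<Longrightarrow> (0::real) < D x y"
  shows "semimetric X (\<lambda>x y. ennreal (D x y))"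
  using assms by (auto simp: semimetric_def)

lemma semimetric_inversion:
  assumes "\<omega> \<in> X" "\<And>x y. x \<in> X \<Longrightarrow> y \<in> X \<Longrightarrow> D x y = D y x" "\<And>x. x \<in> X \<Longrightarrow> D x x = 0"
    "\<And>x y. x \<in> X \<Longrightarrow> y \<in> X \<Longrightarrow> x \<noteq> y \<Longrightarrow> (0::real) < D x y"
  shows "semimetric X (\<lambda>x y. if x = y then 0 else if x = \<omega> \<or> y = \<omega> then \<infinity> else ennreal (D x y / (D x \<omega> * D y \<omega>)))"
    "infinitely_remote X (\<lambda>x y. if x = y then 0 else if x = \<omega> \<or> y = \<omega> then \<infinity> else ennreal (D x y / (D x \<omega> * D y \<omega>))) \<omega>"
  using assms by (auto simp: semimetric_def infinitely_remote_def mult.commute)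

text \<open>Every point occurs exactly once in each of the three products, so all three acquire the
  same factor \<open>k\<close>. Both the bounded metric and its inversions arise in this
  way.\<close>

lemma moebius_equivalent_weight:
  assumes f: "\<And>x y. x \<in> X \<Longrightarrow> y \<in> X \<Longrightarrow> x \<noteq> y \<Longrightarrow> factor d' x y = c * factor d x y / (w x * w y)"
    and "0 < c" "\<And>x. x \<in> X \<Longrightarrow> 0 < w x"
    and "semimetric X d"
  shows "moebius_equivalent X d d'"
  unfolding moebius_equivalent_def
proof (intro ballI impI)
  fix x y z u assume X: "x \<in> X" "y \<in> X" "z \<in> X" "u \<in> X" and "distinct [x, y, z, u]"
  then have ne: "x \<noteq> y" "x \<noteq> z" "x \<noteq> u" "y \<noteq> z" "y \<noteq> u" "z \<noteq> u" by auto
  have w: "0 < w x" "0 < w y" "0 < w z" "0 < w u" using assms(3) X by auto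
  define k where "k = c * c / (w x * w y * w z * w u)"
  have k: "k \<noteq> 0" using w \<open>0 < c\<close> by (simp add: k_def)
  have "factor d' x y * factor d' z u = k * (factor d x y * factor d z u)"
    "factor d' x z * factor d' y u = k * (factor d x z * factor d y u)"
    "factor d' x u * factor d' y z = k * (factor d x u * factor d y z)"
    using X ne by (simp_all add: f k_def mult_ac)
  with k show "let p1 = factor d x y * factor d z u;  p1' = factor d' x y * factor d' z u;
             p2 = factor d x z * factor d y u;  p2' = factor d' x z * factor d' y u;
             p3 = factor d x u * factor d y z;  p3' = factor d' x u * factor d' y z
         in p1 / p2 = p1' / p2' \<and> p1 / p3 = p1' / p3' \<and> p2 / p3 = p2' / p3'"
    by (simp add: Let_def)
qed

lemma moebius_equivalent_trans:
  "moebius_equivalent X d d' \<Longrightarrow> moebius_equivalent X d' d'' \<Longrightarrow> moebius_equivalent X d d''"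
  unfolding moebius_equivalent_def Let_def by simp

lemma moebius_equivalent_sym:
  "moebius_equivalent X d d' \<Longrightarrow> moebius_equivalent X d' d"
  unfolding moebius_equivalent_def Let_def by simp

text \<open>Moebius equivalence speaks of distinct tuples only, but a coincidence such as
  \<open>x = z\<close> would annihilate one side of \<open>eq\<close> and not the other. Hence the
  existential over \<open>M\<close> in \<open>harmonic_tuples\<close> can be evaluated in a single
  metric.\<close>

lemma harmonic_iff_of_equivalent:
  assumes "moebius_equivalent X d d'" "semimetric X d" "semimetric X d'"
    and X: "x \<in> X" "y \<in> X" "z \<in> X" "u \<in> X" and ne: "x \<noteq> y" "z \<noteq> u"
    and eq: "factor d x z * factor d y u = factor d x u * factor d y z"
  shows "factor d' x z * factor d' y u = factor d' x u * factor d' y z"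
proof -
  have pos: "factor d a b = 0 \<longleftrightarrow> a = b" if "a \<in> X" "b \<in> X" for a b
    using that assms(2) factor_pos[of X d a b] factor_self[of X d a] by (cases "a = b") auto
  have dist: "x \<noteq> z" "x \<noteq> u" "y \<noteq> z" "y \<noteq> u"
    using eq X ne by (auto simp: pos factor_self[OF assms(2)])
  then have "factor d x z * factor d y u / (factor d x u * factor d y z)
    = factor d' x z * factor d' y u / (factor d' x u * factor d' y z)"
    using assms(1) X ne unfolding moebius_equivalent_def Let_def by auto
  moreover have "factor d x z * factor d y u / (factor d x u * factor d y z) = 1"
    unfolding eq by (rule divide_self) (use dist X factor_pos[OF assms(2)] in \<open>auto simp: less_imp_neq[symmetric]\<close>)
  ultimately show ?thesis by (metis divide_eq_1_iff)
qed

text \<open>With the weight \<open>w x = f x a + f x b\<close>, the Ptolemaic inequalities for \<open>(x, y, z, a)\<close> and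
  \<open>(x, y, z, b)\<close> add up to the triangle inequality, and the one for \<open>(x, y, a, b)\<close> bounds the metric.
  Off \<open>X\<close> the metric is discrete, so that its laws need no carrier conditions.\<close>

lemma ptolemaic_bounded_metric:
  fixes M :: "('a \<Rightarrow> 'a \<Rightarrow> ennreal) set"
  assumes M: "moebius_structure X M" and P: "axiom_P X M" and two: "a \<in> X" "b \<in> X" "a \<noteq> b"
  shows "\<exists>D :: 'a \<Rightarrow> 'a \<Rightarrow> real. (\<forall>x y. D x y = D y x) \<and> (\<forall>x y. D x y = 0 \<longleftrightarrow> x = y) \<and>
    (\<forall>x y z. D x z \<le> D x y + D y z) \<and> (\<forall>x y. D x y \<le> 1) \<and> (\<lambda>x y. ennreal (D x y)) \<in> M"
proof -
  obtain d where d: "semimetric X d" "M = {d'. semimetric X d' \<and> moebius_equivalent X d d'}"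
    using M by (auto simp: moebius_structure_def)
  define f where "f = factor d"
  have "d \<in> M" using d by (auto simp: moebius_equivalent_def Let_def)
  then have ptol: "f x y * f z u \<le> f x z * f y u + f x u * f y z"
    if "x \<in> X" "y \<in> X" "z \<in> X" "u \<in> X" for x y z u
    using P that by (simp add: axiom_P_def f_def)
  have sym: "f x y = f y x" if "x \<in> X" "y \<in> X" for x y using factor_sym[OF d(1) that] by (simp add: f_def)
  have self: "f x x = 0" if "x \<in> X" for x using factor_self[OF d(1) that] by (simp add: f_def)
  have pos: "0 < f x y" if "x \<in> X" "y \<in> X" "x \<noteq> y" for x y using factor_pos[OF d(1) that] by (simp add: f_def)
  have nonneg: "0 \<le> f x y" if "x \<in> X" "y \<in> X" for x y using pos[OF that] self that by (cases "x = y") auto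
  define w where "w = (\<lambda>x. f x a + f x b)"
  have w: "0 < w x" if "x \<in> X" for x
    using that two pos[of x a] pos[of x b] nonneg[of x a] nonneg[of x b] by (cases "x = a") (auto simp: w_def)
  define g where "g = (\<lambda>x y. f a b * f x y / (w x * w y))"
  define D where "D = (\<lambda>x y. if x \<in> X \<and> y \<in> X then g x y else if x = y then 0 else 1)"
  have gpos: "0 < g x y" if "x \<in> X" "y \<in> X" "x \<noteq> y" for x y
    using that pos w two by (simp add: g_def)
  have gself: "g x x = 0" if "x \<in> X" for x using self that by (simp add: g_def)
  have gnonneg: "0 \<le> g x y" if "x \<in> X" "y \<in> X" for x y using gpos gself that by (cases "x = y") (auto intro: less_imp_le)
  have gsym: "g x y = g y x" if "x \<in> X" "y \<in> X" for x y using sym that by (simp add: g_def mult.commute)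
  have gle: "g x y \<le> 1" if "x \<in> X" "y \<in> X" for x y
  proof -
    have "f x y * f a b \<le> f x a * f y b + f x b * f y a" using ptol that two by simp
    also have "\<dots> \<le> w x * w y" using nonneg that two by (simp add: w_def algebra_simps)
    finally show ?thesis using w that by (simp add: g_def mult.commute)
  qed
  have gtri: "g x z \<le> g x y + g y z" if X: "x \<in> X" "y \<in> X" "z \<in> X" for x y z
  proof -
    have *: "f x z * f y c \<le> f x y * f z c + f y z * f x c" if "c \<in> X" for c
      using ptol[of x z y c] X that sym[of z y] by (simp add: mult.commute)
    have "f x z * w y \<le> f x y * w z + f y z * w x"
      using *[OF two(1)] *[OF two(2)] by (simp add: w_def algebra_simps)
    then have "f a b * (f x z * w y) \<le> f a b * (f x y * w z + f y z * w x)"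
      using nonneg two by (intro mult_left_mono) auto
    then have "f a b * (f x z * w y) / (w x * w y * w z) \<le> f a b * (f x y * w z + f y z * w x) / (w x * w y * w z)"
      using w[OF X(1)] w[OF X(2)] w[OF X(3)] by (intro divide_right_mono) auto
    moreover have "f a b * (f x z * w y) / (w x * w y * w z) = g x z"
      "f a b * (f x y * w z + f y z * w x) / (w x * w y * w z) = g x y + g y z"
      using w[OF X(1)] w[OF X(2)] w[OF X(3)] by (simp_all add: g_def field_simps)
    ultimately show ?thesis by simp
  qed
  have DM: "(\<lambda>x y. ennreal (D x y)) \<in> M"
  proof -
    have "semimetric X (\<lambda>x y. ennreal (D x y))"
      using gsym gself gpos by (intro semimetric_ennreal) (auto simp: D_def)
    moreover have "moebius_equivalent X d (\<lambda>x y. ennreal (D x y))"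
    proof (rule moebius_equivalent_weight[where w = w and c = "f a b"])
      fix x y assume "x \<in> X" "y \<in> X" "x \<noteq> y"
      then show "factor (\<lambda>x y. ennreal (D x y)) x y = f a b * factor d x y / (w x * w y)"
        using gnonneg[of x y] by (simp add: factor_ennreal D_def g_def f_def)
    qed (use pos two w d in auto)
    ultimately show ?thesis using d(2) by simp
  qed
  have D1: "D x y = D y x" "D x y = 0 \<longleftrightarrow> x = y" "D x y \<le> 1" for x y
    using gsym[of x y] gself[of x] gpos[of x y] gle[of x y] by (auto simp: D_def)
  have D2: "D x z \<le> D x y + D y z" for x y z
    using gtri[of x y z] gle[of x z] gnonneg[of x y] gnonneg[of y z] by (auto simp: D_def)
  show ?thesis by (intro exI[of _ D] conjI allI D1 D2 DM)
qed

text \<open>The \<open>M\<close>-topology is generated by balls of semi-metrics with an infinitely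
  remote point, and \<open>D\<close> is finite. Its inversion \<open>d'\<close> at
  \<open>\<omega>\<close> has such a point, and \<open>D \<le> 1\<close> makes \<open>d'\<close> at
  least as large as \<open>D\<close>, so a \<open>d'\<close>-ball lies in the \<open>D\<close>-ball
  of the same radius.\<close>

lemma axiom_T_ball_nhd:
  fixes X :: "'a::metric_space set"
  assumes M: "moebius_structure X M" and T: "axiom_T X M"
    and D: "(\<lambda>x y. ennreal (D x y)) \<in> M" "\<And>x y. D x y = D y x" "\<And>x y. D x y = 0 \<longleftrightarrow> x = y"
      "\<And>x y. 0 \<le> D x y" "\<And>x y. D x y \<le> 1"
    and x: "x \<in> X" and w: "\<omega> \<in> X" "\<omega> \<noteq> x" and e: "0 < e"
  shows "\<exists>r>0. \<forall>y\<in>X. dist x y < r \<longrightarrow> D x y < e"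
proof -
  define d' where "d' = (\<lambda>x y. if x = y then 0 else if x = \<omega> \<or> y = \<omega> then \<infinity> else ennreal (D x y / (D x \<omega> * D y \<omega>)))"
  have pos: "0 < D x y" if "x \<noteq> y" for x y using D(3)[of x y] D(4)[of x y] that by linarith
  obtain d where d: "semimetric X d" "M = {d'. semimetric X d' \<and> moebius_equivalent X d d'}"
    using M by (auto simp: moebius_structure_def)
  have sm: "semimetric X d'" "infinitely_remote X d' \<omega>"
    unfolding d'_def by (rule semimetric_inversion; use w D pos in auto)+
  \<comment> \<open>Weight 1 at \<open>\<omega>\<close> makes the quotient equal to 1 for pairs
    containing \<open>\<omega>\<close>, the value that \<open>factor\<close> gives to an infinite
    distance.\<close>
  have "moebius_equivalent X (\<lambda>x y. ennreal (D x y)) d'"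
  proof (rule moebius_equivalent_weight[where w = "\<lambda>x. if x = \<omega> then 1 else D x \<omega>" and c = 1])
    fix x y assume "x \<in> X" "y \<in> X" "x \<noteq> y"
    then show "factor d' x y = 1 * factor (\<lambda>x y. ennreal (D x y)) x y /
         ((if x = \<omega> then 1 else D x \<omega>) * (if y = \<omega> then 1 else D y \<omega>))"
      using pos[of x y] pos[of x \<omega>] pos[of y \<omega>] D(2)[of x \<omega>] D(2)[of y \<omega>] D(4)
      by (auto simp: d'_def factor_def)
  qed (use pos d D in auto)
  then have "d' \<in> M" using sm(1) D(1) d(2) moebius_equivalent_trans by blast
  define B where "B = {y \<in> X. d' x y < ennreal e}"
  have "openin (moebius_topology X M) B"
    unfolding moebius_topology_def openin_topology_generated_by_iff
    by (rule generate_topology_on.Basis) (use \<open>d' \<in> M\<close> sm x w e in \<open>auto simp: B_def\<close>)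
  then have "openin (top_of_set X) B" using T by (simp add: axiom_T_def)
  moreover have "x \<in> B" using x e by (simp add: B_def d'_def)
  ultimately obtain r where r: "0 < r" "\<And>y. y \<in> X \<Longrightarrow> dist y x < r \<Longrightarrow> y \<in> B"
    unfolding openin_euclidean_subtopology_iff by meson
  have "D x y < e" if "y \<in> B" for y
  proof (cases "x = y")
    case False
    then have "y \<noteq> \<omega>" using that by (auto simp: B_def d'_def)
    moreover from this have "ennreal (D x y / (D x \<omega> * D y \<omega>)) < ennreal e"
      using that False w(2) by (auto simp: B_def d'_def)
    then have "D x y / (D x \<omega> * D y \<omega>) < e" by (subst (asm) ennreal_less_iff) (use D(4) in auto)
    ultimately have y: "y \<noteq> \<omega>" "D x y / (D x \<omega> * D y \<omega>) < e" by auto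
    have m: "0 < D x \<omega> * D y \<omega>" "D x \<omega> * D y \<omega> \<le> 1" using pos y(1) w D(4,5) by (auto intro: mult_le_one)
    have "D x y = D x y / (D x \<omega> * D y \<omega>) * (D x \<omega> * D y \<omega>)"
      using less_imp_neq[OF m(1)] by (metis nonzero_eq_divide_eq)
    also have "\<dots> \<le> D x y / (D x \<omega> * D y \<omega>) * 1" using m D(4) by (intro mult_left_mono) auto
    finally show ?thesis using y by simp
  qed (use e D(3)[of x y] in simp)
  with r show ?thesis by (intro exI[of _ r]) (auto simp: dist_commute)
qed

text \<open>Moebius equivalence does not cover \<open>z = z'\<close>, where both quotients are 1.
  The result makes segment lengths independent of the semi-metric.\<close>

lemma factor_cross_ratio_eq:
  assumes "semimetric X d" "semimetric X d'" "moebius_equivalent X d d'"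
    and X: "x \<in> X" "y \<in> X" "z \<in> X" "z' \<in> X" and ne: "x \<noteq> y" "x \<noteq> z" "x \<noteq> z'" "y \<noteq> z" "y \<noteq> z'"
  shows "factor d x z' * factor d y z / (factor d x z * factor d y z')
    = factor d' x z' * factor d' y z / (factor d' x z * factor d' y z')"
proof (cases "z = z'")
  case True
  then show ?thesis
    using factor_pos[OF assms(1), of x z] factor_pos[OF assms(1), of y z]
      factor_pos[OF assms(2), of x z] factor_pos[OF assms(2), of y z] X ne by simp
next
  case False
  then have "factor d x z' * factor d y z / (factor d x z * factor d z' y)
    = factor d' x z' * factor d' y z / (factor d' x z * factor d' z' y)"
    using assms(3) X ne unfolding moebius_equivalent_def Let_def by auto
  then show ?thesis
    using factor_sym[OF assms(1), of z' y] factor_sym[OF assms(2), of z' y] X by simp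
qed

section \<open>Proper and geodesic metric spaces\<close>

context Metric_space begin

lemma proper_metric_imp_mcomplete:
  assumes "proper_metric M d"
  shows mcomplete
  unfolding mcomplete_def
proof (intro allI impI)
  fix \<sigma> assume c: "MCauchy \<sigma>"
  then have "mbounded (range \<sigma>)" by (rule MCauchy_imp_mbounded)
  then obtain x r where xr: "range \<sigma> \<subseteq> mcball x r" by (auto simp: mbounded_def)
  then have "x \<in> M" by (auto simp: mcball_def)
  then have "compactin mtopology (mcball x r)" using assms by (simp add: proper_metric_def)
  with xr obtain l \<phi> where "strict_mono \<phi>" "limitin mtopology (\<sigma> \<circ> \<phi>) l sequentially"
    unfolding compactin_sequentially by blast
  with MCauchy_convergent_subsequence[OF c] show "\<exists>x. limitin mtopology \<sigma> x sequentially" by blast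
qed

text \<open>Approximate intermediate points accumulate in the compact ball of radius
  \<open>t\<close> about \<open>p\<close>. The limit satisfies both upper bounds, and the triangle
  inequality turns them into equalities.\<close>

lemma proper_metric_intermediate_point:
  assumes "proper_metric M d" and pq: "p \<in> M" "q \<in> M" and t: "0 \<le> t" "t \<le> d p q"
    and approx: "\<And>e. 0 < e \<Longrightarrow> \<exists>m\<in>M. d p m \<le> t \<and> d m q \<le> d p q - t + e"
  obtains m where "m \<in> M" "d p m = t" "d m q = d p q - t"
proof -
  have "\<exists>m\<in>M. d p m \<le> t \<and> d m q \<le> d p q - t + 1 / real (Suc n)" for n
    by (rule approx) simp
  then obtain m where m: "\<And>n. m n \<in> M" "\<And>n. d p (m n) \<le> t" "\<And>n. d (m n) q \<le> d p q - t + 1 / real (Suc n)"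
    by metis
  have "compactin mtopology (mcball p t)" using assms(1) pq by (simp add: proper_metric_def)
  moreover have "range m \<subseteq> mcball p t" using m pq by (auto simp: mcball_def)
  ultimately obtain l \<phi> where l: "l \<in> mcball p t" "strict_mono \<phi>" "limitin mtopology (m \<circ> \<phi>) l sequentially"
    unfolding compactin_sequentially by blast
  have lM: "l \<in> M" using l by (auto simp: mcball_def)
  have "d l q \<le> d p q - t + e" if e: "0 < e" for e
  proof -
    obtain N where N: "\<And>n. n \<ge> N \<Longrightarrow> d (m (\<phi> n)) l < e / 2"
      using l(3) half_gt_zero[OF e] unfolding limit_metric_sequentially o_def by blast
    obtain K where K: "1 / real (Suc K) < e / 2" using nat_approx_posE[of "e / 2"] e by auto
    define n where "n = max N K"
    have "K \<le> \<phi> n" using seq_suble[OF l(2), of n] by (auto simp: n_def)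
    then have "1 / real (Suc (\<phi> n)) \<le> 1 / real (Suc K)" by (intro divide_left_mono) auto
    moreover have "d (m (\<phi> n)) l < e / 2" using N by (simp add: n_def)
    ultimately show ?thesis
      using m(3)[of "\<phi> n"] K triangle[of l "m (\<phi> n)" q] commute[of l "m (\<phi> n)"] m(1) lM pq by simp
  qed
  then have "d l q \<le> d p q - t" by (rule field_le_epsilon)
  moreover have "d p l \<le> t" using l(1) by (simp add: mcball_def)
  ultimately show ?thesis using that[OF lM] triangle[OF pq(1) lM pq(2)] by simp
qed

text \<open>A maximal partial isometry from \<open>{0..d p q}\<close> has a closed domain by completeness and no gaps
  because intermediate points fill them.\<close>

lemma complete_intermediate_imp_geodesic:
  assumes comp: mcomplete
    and inter: "\<And>p q t. \<lbrakk>p \<in> M; q \<in> M; 0 \<le> t; t \<le> d p q\<rbrakk> \<Longrightarrow> \<exists>m\<in>M. d p m = t \<and> d m q = d p q - t"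
  shows "geodesic_metric M d"
  unfolding geodesic_metric_def
proof (intro ballI)
  fix p q assume pq: "p \<in> M" "q \<in> M"
  define L where "L = d p q"
  \<comment> \<open>Partial isometries are relations: distance 0 at equal parameters makes them
    single-valued. Keeping both ends in every member gives the maximal one the right ends.\<close>
  define \<I> where "\<I> = {A. A \<subseteq> {0..L} \<times> M \<and> (0, p) \<in> A \<and> (L, q) \<in> A \<and>
    (\<forall>(s, a)\<in>A. \<forall>(t, b)\<in>A. d a b = \<bar>s - t\<bar>)}"
  have isom: "d a b = \<bar>s - t\<bar>" if "A \<in> \<I>" "(s, a) \<in> A" "(t, b) \<in> A" for A s a t b
    using that by (auto simp: \<I>_def)
  have "L \<ge> 0" by (simp add: L_def)
  then have "{(0, p), (L, q)} \<in> \<I>" using pq by (auto simp: \<I>_def L_def commute)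
  then have "\<I> \<noteq> {}" by blast
  moreover have "\<Union>\<C> \<in> \<I>" if C: "\<C> \<noteq> {}" "subset.chain \<I> \<C>" for \<C>
  proof -
    have sub: "\<C> \<subseteq> \<I>" using C by (simp add: subset_chain_def)
    have "d a b = \<bar>s - t\<bar>" if "(s, a) \<in> \<Union>\<C>" "(t, b) \<in> \<Union>\<C>" for s a t b
    proof -
      from that obtain A B where AB: "A \<in> \<C>" "B \<in> \<C>" "(s, a) \<in> A" "(t, b) \<in> B" by blast
      then have "A \<subseteq> B \<or> B \<subseteq> A" using C by (auto simp: subset_chain_def)
      with AB sub isom show ?thesis by (meson subsetD)
    qed
    moreover have "\<Union>\<C> \<subseteq> {0..L} \<times> M" using sub by (auto simp: \<I>_def)
    moreover have "(0, p) \<in> \<Union>\<C>" "(L, q) \<in> \<Union>\<C>" using sub C(1) by (auto simp: \<I>_def)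
    ultimately show ?thesis by (simp add: \<I>_def Ball_def split_paired_All del: Union_iff)
  qed
  ultimately obtain A where A: "A \<in> \<I>" and max: "\<And>B. B \<in> \<I> \<Longrightarrow> A \<subseteq> B \<Longrightarrow> B = A"
    by (metis subset_Zorn_nonempty)
  have AM: "0 \<le> s \<and> s \<le> L \<and> a \<in> M" if "(s, a) \<in> A" for s a using A that by (auto simp: \<I>_def)
  have ends: "(0, p) \<in> A" "(L, q) \<in> A" using A by (auto simp: \<I>_def)
  have extend: "(\<tau>, m) \<in> A" if "0 \<le> \<tau>" "\<tau> \<le> L" "m \<in> M" "\<And>s a. (s, a) \<in> A \<Longrightarrow> d a m = \<bar>s - \<tau>\<bar>" for \<tau> m
  proof -
    have sym: "d m a = \<bar>\<tau> - s\<bar>" if "(s, a) \<in> A" for s a using \<open>\<And>s a. (s, a) \<in> A \<Longrightarrow> d a m = \<bar>s - \<tau>\<bar>\<close>[OF that]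
      by (simp add: commute[of m a] abs_minus_commute)
    have "insert (\<tau>, m) A \<in> \<I>" using A that sym by (auto simp: \<I>_def)
    with max show ?thesis by blast
  qed
  define T where "T = fst ` A"
  have "closed T"
    unfolding closed_sequential_limits
  proof (intro allI impI, elim conjE)
    fix x l assume x: "\<forall>n. x n \<in> T" "x \<longlonglongrightarrow> l"
    then have "\<forall>n. \<exists>m. (x n, m) \<in> A" by (force simp: T_def)
    then obtain m where m: "\<And>n. (x n, m n) \<in> A" by metis
    have mM: "m n \<in> M" for n using AM[OF m] by blast
    have dm: "d (m i) (m j) = \<bar>x i - x j\<bar>" for i j using isom[OF A m m] .
    have "MCauchy m"
      unfolding MCauchy_def dm
    proof (intro conjI allI impI)
      fix e :: real assume "0 < e"
      then show "\<exists>N. \<forall>n n'. N \<le> n \<longrightarrow> N \<le> n' \<longrightarrow> \<bar>x n - x n'\<bar> < e"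
        using LIMSEQ_imp_Cauchy[OF x(2)] by (simp add: Cauchy_def dist_real_def)
    qed (use mM in auto)
    then obtain y where y: "limitin mtopology m y sequentially" using comp by (auto simp: mcomplete_def)
    then have yM: "y \<in> M" by (rule limitin_mspace)
    have ylim: "(\<lambda>n. d (m n) y) \<longlonglongrightarrow> 0"
    proof (rule LIMSEQ_I)
      fix e :: real assume "0 < e"
      then obtain N where "\<And>n. n \<ge> N \<Longrightarrow> d (m n) y < e" using y unfolding limit_metric_sequentially by blast
      then show "\<exists>N. \<forall>n\<ge>N. norm (d (m n) y - 0) < e" by (intro exI[of _ N]) auto
    qed
    have "d a y = \<bar>s - l\<bar>" if "(s, a) \<in> A" for s a
    proof (rule LIMSEQ_unique)
      show "(\<lambda>n. d a (m n)) \<longlonglongrightarrow> \<bar>s - l\<bar>"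
        unfolding isom[OF A that m] by (intro tendsto_intros x)
      have "(\<lambda>n. d a (m n) - d a y) \<longlonglongrightarrow> 0"
      proof (rule Lim_null_comparison[OF _ ylim])
        have "norm (d a (m n) - d a y) \<le> d (m n) y" for n
          using triangle[of a "m n" y] triangle[of a y "m n"] AM[OF that] mM yM commute[of y "m n"] by auto
        then show "\<forall>\<^sub>F n in sequentially. norm (d a (m n) - d a y) \<le> d (m n) y" by simp
      qed
      then show "(\<lambda>n. d a (m n)) \<longlonglongrightarrow> d a y" by (simp add: LIM_zero_iff)
    qed
    moreover have "0 \<le> l" "l \<le> L"
      using LIMSEQ_le_const[OF x(2)] LIMSEQ_le_const2[OF x(2)] AM[OF m] by blast+
    ultimately have "(l, y) \<in> A" using extend yM by blast
    then show "l \<in> T" by (force simp: T_def)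
  qed
  have "\<tau> \<in> T" if \<tau>: "0 \<le> \<tau>" "\<tau> \<le> L" for \<tau>
  proof (rule ccontr)
    assume nT: "\<tau> \<notin> T"
    define s t where "s = Sup (T \<inter> {..\<tau>})" and "t = Inf (T \<inter> {\<tau>..})"
    have ne: "0 \<in> T \<inter> {..\<tau>}" "L \<in> T \<inter> {\<tau>..}" using ends \<tau> by (force simp: T_def)+
    have sT: "s \<in> T \<inter> {..\<tau>}" unfolding s_def
      by (rule closed_contains_Sup) (use ne \<open>closed T\<close> in \<open>auto intro: bdd_aboveI[of _ \<tau>]\<close>)
    have tT: "t \<in> T \<inter> {\<tau>..}" unfolding t_def
      by (rule closed_contains_Inf) (use ne \<open>closed T\<close> in \<open>auto intro: bdd_belowI[of _ \<tau>]\<close>)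
    from sT tT obtain a b where ab: "(s, a) \<in> A" "(t, b) \<in> A" by (auto simp: T_def)
    have st: "s < \<tau>" "\<tau> < t" using sT tT nT by (auto simp: order.strict_iff_order)
    have gap: "r \<le> s \<or> t \<le> r" if "r \<in> T" for r
    proof (cases "r \<le> \<tau>")
      case True
      then have "r \<le> s" unfolding s_def using that by (intro cSup_upper) (auto intro: bdd_aboveI[of _ \<tau>])
      then show ?thesis ..
    next
      case False
      then have "t \<le> r" unfolding t_def using that by (intro cInf_lower) (auto intro: bdd_belowI[of _ \<tau>])
      then show ?thesis ..
    qed
    have dab: "d a b = t - s" using isom[OF A ab] st by simp
    then obtain m where m: "m \<in> M" "d a m = \<tau> - s" "d m b = t - \<tau>"
      using inter[of a b "\<tau> - s"] AM[OF ab(1)] AM[OF ab(2)] st by auto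
    \<comment> \<open>A parameter outside the gap has one end of the gap between itself and
      \<open>\<tau>\<close>. Passing through that end bounds the distance above, and the other end
      bounds it below.\<close>
    have "d c m = \<bar>r - \<tau>\<bar>" if rc: "(r, c) \<in> A" for r c
    proof -
      have M: "a \<in> M" "b \<in> M" "c \<in> M" using AM rc ab by auto
      have "r \<le> s \<or> t \<le> r" using gap rc by (force simp: T_def)
      then show ?thesis
        using isom[OF A rc ab(1)] isom[OF A rc ab(2)] triangle[OF M(3,1) m(1)] triangle[OF M(3) m(1) M(2)]
          triangle[OF M(3,2) m(1)] triangle[OF M(3) m(1) M(1)] m(2,3) st commute[of b m] commute[of m a] by auto
    qed
    then have "(\<tau>, m) \<in> A" using extend m(1) \<tau> by blast
    with nT show False by (force simp: T_def)
  qed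
  then have "\<forall>\<tau>\<in>{0..L}. \<exists>m. (\<tau>, m) \<in> A" by (force simp: T_def)
  then obtain \<gamma> where \<gamma>: "\<And>\<tau>. \<tau> \<in> {0..L} \<Longrightarrow> (\<tau>, \<gamma> \<tau>) \<in> A" by metis
  have in0: "(0, \<gamma> 0) \<in> A" and inL: "(L, \<gamma> L) \<in> A" using \<gamma> \<open>0 \<le> L\<close> by auto
  have "d (\<gamma> 0) p = 0" "d (\<gamma> L) q = 0" using isom[OF A in0 ends(1)] isom[OF A inL ends(2)] by auto
  moreover have "\<gamma> 0 \<in> M" "\<gamma> L \<in> M" using AM[OF in0] AM[OF inL] by auto
  ultimately have \<gamma>_ends: "\<gamma> 0 = p" "\<gamma> L = q" using zero pq by blast+
  have \<gamma>_in: "\<gamma> s \<in> M" if "s \<in> {0..L}" for s using AM[OF \<gamma>[OF that]] by simp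
  then show "\<exists>\<gamma>. \<gamma> ` {0..d p q} \<subseteq> M \<and> \<gamma> 0 = p \<and> \<gamma> (d p q) = q \<and>
      (\<forall>s\<in>{0..d p q}. \<forall>t\<in>{0..d p q}. d (\<gamma> s) (\<gamma> t) = \<bar>s - t\<bar>)"
    unfolding L_def[symmetric]
  proof (intro exI[of _ \<gamma>] conjI ballI)
    show "d (\<gamma> s) (\<gamma> t) = \<bar>s - t\<bar>" if "s \<in> {0..L}" "t \<in> {0..L}" for s t
      by (rule isom[OF A \<gamma>[OF that(1)] \<gamma>[OF that(2)]])
  qed (use \<gamma>_ends \<gamma>_in in auto)
qed

end

section \<open>Harmonic pairs on a metric circle\<close>

text \<open>Rotating \<open>(t1, t2, t3, t4)\<close> by one place in \<open>D_separate\<close>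
  exchanges the two summands, so this one inequality contains both halves of the maximum in
  \<open>axiom_M\<close>.\<close>

locale moebius_circle =
  fixes D :: "complex \<Rightarrow> complex \<Rightarrow> real" and \<alpha> :: real
  assumes D_sym: "D x y = D y x"
    and D_eq_0 [simp]: "D x y = 0 \<longleftrightarrow> x = y"
    and D_triangle: "D x z \<le> D x y + D y z"
    and D_le_1: "D x y \<le> 1"
    and \<alpha>_pos: "0 < \<alpha>" and \<alpha>_less_1: "\<alpha> < 1"
    and D_separate: "\<lbrakk>t1 < t2; t2 < t3; t3 < t4; t4 < t1 + 2 * pi\<rbrakk> \<Longrightarrow>
      D (cis t1) (cis t2) * D (cis t3) (cis t4) + \<alpha> * (D (cis t1) (cis t4) * D (cis t2) (cis t3))
        \<le> D (cis t1) (cis t3) * D (cis t2) (cis t4)"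
    and D_nbhd: "\<lbrakk>x \<in> sphere 0 1; 0 < e\<rbrakk> \<Longrightarrow> \<exists>r>0. \<forall>y\<in>sphere 0 1. dist x y < r \<longrightarrow> D x y < e"
begin

abbreviation X :: "complex set" where "X \<equiv> sphere 0 1"

lemma D_self [simp]: "D x x = 0"
  by simp

lemma D_nonneg [simp]: "0 \<le> D x y"
  using D_triangle[of x x y] D_sym[of x y] D_self[of x] by linarith

lemma D_pos [simp]: "0 < D x y \<longleftrightarrow> x \<noteq> y"
  using D_nonneg[of x y] by (auto simp: less_le)

section \<open>Continuity of \<open>D\<close> and comparison with the Euclidean topology\<close>

lemma D_diff_le: "\<bar>D x y - D x' y'\<bar> \<le> D x x' + D y y'"
  using D_triangle[of x y x'] D_triangle[of x' y y'] D_triangle[of x' y' x] D_triangle[of x y' y]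
    D_sym[of x x'] D_sym[of y y'] by linarith

lemma tendsto_D:
  assumes f: "(f \<longlongrightarrow> x) F" and g: "(g \<longlongrightarrow> y) F"
    and "\<forall>\<^sub>F i in F. f i \<in> X" "\<forall>\<^sub>F i in F. g i \<in> X" "x \<in> X" "y \<in> X"
  shows "((\<lambda>i. D (f i) (g i)) \<longlongrightarrow> D x y) F"
proof (rule tendstoI)
  fix e :: real assume "0 < e"
  have *: "\<forall>\<^sub>F i in F. D x (f i) < e / 2" if "(f \<longlongrightarrow> x) F" "\<forall>\<^sub>F i in F. f i \<in> X" "x \<in> X" for f x
  proof -
    from D_nbhd[of x "e / 2"] \<open>0 < e\<close> that obtain r where r: "r > 0" "\<forall>y\<in>X. dist x y < r \<longrightarrow> D x y < e / 2"
      by auto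
    from tendstoD[OF that(1) r(1)] that(2) show ?thesis
      by eventually_elim (use r in \<open>auto simp: dist_commute\<close>)
  qed
  from *[of f x] *[of g y] assms have "\<forall>\<^sub>F i in F. D x (f i) < e / 2" "\<forall>\<^sub>F i in F. D y (g i) < e / 2" by auto
  then show "\<forall>\<^sub>F i in F. dist (D (f i) (g i)) (D x y) < e"
  proof eventually_elim
    case (elim i)
    then show ?case using D_diff_le[of "f i" "g i" x y] D_sym[of x "f i"] D_sym[of y "g i"]
      by (simp add: dist_real_def)
  qed
qed

lemma continuous_on_D:
  assumes "continuous_on A f" "continuous_on A g" "f ` A \<subseteq> X" "g ` A \<subseteq> X"
  shows "continuous_on A (\<lambda>t. D (f t) (g t))"
  unfolding continuous_on_def
proof
  fix t assume t: "t \<in> A"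
  have "\<forall>\<^sub>F s in at t within A. s \<in> A" by (simp add: eventually_at_filter)
  then have "\<forall>\<^sub>F s in at t within A. f s \<in> X" "\<forall>\<^sub>F s in at t within A. g s \<in> X"
    using assms(3,4) by (auto elim!: eventually_mono)
  then show "((\<lambda>t. D (f t) (g t)) \<longlongrightarrow> D (f t) (g t)) (at t within A)"
    using assms t by (intro tendsto_D) (auto simp: continuous_on_def)
qed

lemma continuous_on_D_cis [continuous_intros]:
  "continuous_on A f \<Longrightarrow> continuous_on A g \<Longrightarrow> continuous_on A (\<lambda>t. D (cis (f t)) (cis (g t)))"
  by (intro continuous_on_D continuous_intros) auto

text \<open>The part of the circle outside the Euclidean ball is compact, so \<open>D x\<close>
  attains a positive minimum there. Together with \<open>D_nbhd\<close>, both metrics induce the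
  same topology on \<open>X\<close>.\<close>

lemma D_near:
  assumes x: "x \<in> X" and e: "0 < e"
  obtains r where "0 < r" "\<And>y. y \<in> X \<Longrightarrow> D x y < r \<Longrightarrow> dist x y < e"
proof -
  define K where "K = {y \<in> X. e \<le> dist x y}"
  have "closed {y. e \<le> dist x y}" by (intro closed_Collect_le continuous_intros)
  moreover have "K = X \<inter> {y. e \<le> dist x y}" by (auto simp: K_def)
  ultimately have "compact K" by (auto intro: compact_Int_closed)
  have "continuous_on K (D x)" using x by (intro continuous_on_D continuous_intros) (auto simp: K_def)
  show ?thesis
  proof (cases "K = {}")
    case True
    then show ?thesis using that[of 1] by (force simp: K_def)
  next
    case False
    from continuous_attains_inf[OF \<open>compact K\<close> False \<open>continuous_on K (D x)\<close>]
    obtain y where y: "y \<in> K" "\<forall>y'\<in>K. D x y \<le> D x y'" by blast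
    have "x \<noteq> y" using y e by (auto simp: K_def)
    then show ?thesis using that[of "D x y"] y by (force simp: K_def)
  qed
qed

section \<open>Strict cross-ratio inequalities and linked harmonic axes\<close>

lemma D_cis_pos: "a < b \<Longrightarrow> b < a + 2 * pi \<Longrightarrow> 0 < D (cis a) (cis b)"
  using cis_eq_imp_eq[of a b] by auto

text \<open>The dropped \<open>\<alpha>\<close>-term is strictly positive. The strict monotonicity
  and the uniqueness of common perpendiculars rest on this.\<close>

lemma cross_less:
  assumes "t1 < t2" "t2 < t3" "t3 < t4" "t4 < t1 + 2 * pi"
  shows "D (cis t1) (cis t2) * D (cis t3) (cis t4) < D (cis t1) (cis t3) * D (cis t2) (cis t4)"
proof -
  have "0 < \<alpha> * (D (cis t1) (cis t4) * D (cis t2) (cis t3))"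
    using assms by (intro mult_pos_pos \<alpha>_pos D_cis_pos) auto
  with D_separate[OF assms] show ?thesis by linarith
qed

lemma cross_less':
  assumes "t1 < t2" "t2 < t3" "t3 < t4" "t4 < t1 + 2 * pi"
  shows "D (cis t1) (cis t4) * D (cis t2) (cis t3) < D (cis t1) (cis t3) * D (cis t2) (cis t4)"
  using cross_less[of t2 t3 t4 "t1 + 2 * pi"] assms
  by (simp add: D_sym[of _ "cis t1"] mult.commute)

lemma two_points:
  assumes "x \<in> X" "y \<in> X" "x \<noteq> y"
  obtains s t where "s < t" "t < s + 2 * pi" "x = cis s" "y = cis t"
proof -
  obtain s where s: "x = cis s" using sphere_eq_cis[OF assms(1)] by metis
  obtain t where "s \<le> t" "t < s + 2 * pi" "y = cis t" using sphere_eq_cis[OF assms(2)] by metis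
  with that[of s t] s assms show ?thesis by (cases "s = t") auto
qed

definition harm :: "complex \<Rightarrow> complex \<Rightarrow> complex \<Rightarrow> complex \<Rightarrow> bool" where
  "harm x y z u \<longleftrightarrow> x \<in> X \<and> y \<in> X \<and> z \<in> X \<and> u \<in> X \<and> x \<noteq> y \<and> z \<noteq> u \<and> D x z * D y u = D x u * D y z"

lemma harm_swap:
  assumes "harm x y z u"
  shows "harm y x z u" "harm x y u z" "harm z u x y"
  using assms D_sym[of x z] D_sym[of x u] D_sym[of y z] D_sym[of y u]
  by (auto simp: harm_def mult.commute)

lemma harm_distinct: "harm x y z u \<Longrightarrow> x \<noteq> z \<and> x \<noteq> u \<and> y \<noteq> z \<and> y \<noteq> u"
  by (auto simp: harm_def)

text \<open>Two points on the same arc have different ratios of the distances to its ends by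
  \<open>cross_less\<close>, whereas harmonicity says that the ratios agree. So the axes separate
  each other.\<close>

lemma harm_arcs:
  assumes h: "harm (cis s) (cis t) z u" and st: "s < t" "t < s + 2 * pi"
  obtains r r' where "s < r" "r < t" "t < r'" "r' < s + 2 * pi"
    "(z, u) = (cis r, cis r') \<or> (z, u) = (cis r', cis r)"
proof -
  have "z \<in> X" "u \<in> X" using h by (auto simp: harm_def)
  obtain p where p: "s \<le> p" "p < s + 2 * pi" "z = cis p" using sphere_eq_cis[OF \<open>z \<in> X\<close>] .
  obtain q where q: "s \<le> q" "q < s + 2 * pi" "u = cis q" using sphere_eq_cis[OF \<open>u \<in> X\<close>] .
  have ne: "p \<noteq> s" "p \<noteq> t" "q \<noteq> s" "q \<noteq> t" "p \<noteq> q"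
    using harm_distinct[OF h] h p q by (auto simp: harm_def)
  have eq: "D (cis s) (cis p) * D (cis t) (cis q) = D (cis s) (cis q) * D (cis t) (cis p)"
    using h p q by (simp add: harm_def)
  have False if "a < b" "s < a" "b < t" "a = p \<and> b = q \<or> a = q \<and> b = p" for a b
    using cross_less[of s a b t] eq st that
    by (auto simp: D_sym[of _ "cis t"] mult.commute)
  then have 1: "\<not> (p < t \<and> q < t)"
    using ne p q by (metis linorder_neqE_linordered_idom order_le_imp_less_or_eq)
  have False if "a < b" "t < a" "b < s + 2 * pi" "a = p \<and> b = q \<or> a = q \<and> b = p" for a b
    using cross_less[of t a b "s + 2 * pi"] eq st that
    by (auto simp: D_sym[of _ "cis s"] mult.commute)
  then have 2: "\<not> (t < p \<and> t < q)"
    using ne p q by (metis linorder_neqE_linordered_idom order_le_imp_less_or_eq)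
  show ?thesis
    using that[of p q] that[of q p] 1 2 ne p q by force
qed

lemma harm_cross:
  assumes "harm x y z u"
  shows "D x z * D y u \<le> D x y * D z u"
proof -
  have "x \<in> X" "y \<in> X" "x \<noteq> y" using assms by (auto simp: harm_def)
  then obtain s t where st: "s < t" "t < s + 2 * pi" "x = cis s" "y = cis t" by (rule two_points)
  obtain r r' where r: "s < r" "r < t" "t < r'" "r' < s + 2 * pi"
    "(z, u) = (cis r, cis r') \<or> (z, u) = (cis r', cis r)"
    using assms st by (auto elim: harm_arcs)
  have eq: "D x z * D y u = D x u * D y z" using assms by (simp add: harm_def)
  from cross_less[of s r t r'] r st eq show ?thesis by (auto simp: D_sym[of "cis r" "cis r'"])
qed

text \<open>Either \<open>z\<close> is within \<open>2 * D z u\<close> of \<open>x\<close> and the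
  triangle inequality bounds both factors, or \<open>D x z \<le> 2 * D x u\<close>, and harmonicity
  turns the product into one controlled by \<open>harm_cross\<close>. Only the lengths of the two
  axes remain.\<close>

lemma harm_product_bound:
  assumes h: "harm x y z u"
  shows "D x z * D y z \<le> 4 * (D z u * (D z u + D x y))"
proof (cases "D x z \<le> 2 * D z u")
  case True
  have "D y z \<le> 2 * D z u + D x y" using D_triangle[of y z x] True D_sym[of x y] by linarith
  then have "D x z * D y z \<le> (2 * D z u) * (2 * D z u + D x y)" using True by (intro mult_mono) auto
  also have "\<dots> \<le> 4 * (D z u * (D z u + D x y))" by (simp add: algebra_simps)
  finally show ?thesis .
next
  case False
  then have "D x z \<le> 2 * D x u" using D_triangle[of x z u] D_sym[of z u] by linarith
  then have "D x z * D y z \<le> (2 * D x u) * D y z" by (intro mult_right_mono) auto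
  also have "\<dots> = 2 * (D x z * D y u)" using h by (simp add: harm_def)
  also have "\<dots> \<le> 2 * (D z u * D x y)" using harm_cross[OF h] by (simp add: mult.commute)
  also have "\<dots> \<le> 4 * (D z u * (D z u + D x y))" by (simp add: algebra_simps)
  finally show ?thesis .
qed

text \<open>For two points of one arc, the \<open>\<alpha>\<close>-term of \<open>D_separate\<close>
  contains \<open>D z z' * D x y\<close>. It is at most the difference of the two mixed products,
  whose quotient is at most \<open>E\<close>. Both forms are kept because \<open>arc_step\<close>
  multiplies them.\<close>

lemma arc_displacement:
  assumes "s < r" "r < t" "s < r'" "r' < t" "t < s + 2 * pi"
    and x: "x = cis s" and y: "y = cis t" and z: "z = cis r" and z': "z' = cis r'"
    and E: "D x z' * D y z \<le> E * (D x z * D y z')" "D x z * D y z' \<le> E * (D x z' * D y z)" "1 \<le> E"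
  shows "\<alpha> * (D z z' * D x y) \<le> (E - 1) * (D x z * D y z')"
    and "\<alpha> * (D z z' * D x y) \<le> (E - 1) * (D x z' * D y z)"
proof -
  have *: "\<alpha> * (D z z' * D x y) \<le> (E - 1) * (D x z * D y z') \<and> D x z * D y z' \<le> D x z' * D y z"
    if "r < r'" "z = cis r" "z' = cis r'" "s < r" "r' < t"
      "D x z' * D y z \<le> E * (D x z * D y z')" for r r' z z'
  proof -
    have "D x z * D z' y + \<alpha> * (D x y * D z z') \<le> D x z' * D z y"
      unfolding x y that using assms(5) that by (intro D_separate) auto
    moreover have "0 \<le> \<alpha> * (D x y * D z z')" using \<alpha>_pos by (intro mult_nonneg_nonneg) auto
    ultimately show ?thesis using that(6) by (simp add: D_sym[of _ y] algebra_simps)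
  qed
  have *: "\<alpha> * (D z z' * D x y) \<le> (E - 1) * (D x z * D y z') \<and> \<alpha> * (D z z' * D x y) \<le> (E - 1) * (D x z' * D y z)"
    if "r < r'" "z = cis r" "z' = cis r'" "s < r" "r' < t"
      "D x z' * D y z \<le> E * (D x z * D y z')" for r r' z z'
    using *[OF that] E(3) by (meson diff_ge_0_iff_ge dual_order.trans mult_left_mono)
  consider "r < r'" | "r' < r" | "r = r'" by linarith
  then have "\<alpha> * (D z z' * D x y) \<le> (E - 1) * (D x z * D y z') \<and> \<alpha> * (D z z' * D x y) \<le> (E - 1) * (D x z' * D y z)"
  proof cases
    case 1
    with * assms show ?thesis by blast
  next
    case 2
    have e: "D z z' = D z' z" by (rule D_sym)
    show ?thesis unfolding e using *[of r' r z' z] assms 2 by blast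
  next
    case 3
    with z z' E show ?thesis by simp
  qed
  then show "\<alpha> * (D z z' * D x y) \<le> (E - 1) * (D x z * D y z')"
    "\<alpha> * (D z z' * D x y) \<le> (E - 1) * (D x z' * D y z)" by auto
qed

subsection \<open>Moves along a line\<close>

definition height :: "complex \<Rightarrow> complex \<Rightarrow> complex \<Rightarrow> complex \<Rightarrow> real" where
  "height x y z u = 1 / D x y + 1 / D z u"

lemma height_pos: "harm x y z u \<Longrightarrow> 0 < height x y z u"
  by (auto simp: height_def harm_def intro!: add_pos_pos)

lemma harm_length_iff:
  assumes "harm x y z u" "harm x y z' u'"
  shows "\<bar>ln (D x z' * D y z / (D x z * D y z'))\<bar> \<le> l \<longleftrightarrow>
    D x z' * D y z \<le> exp l * (D x z * D y z') \<and> D x z * D y z' \<le> exp l * (D x z' * D y z)"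
proof -
  have pos: "0 < D x z" "0 < D y z" "0 < D x z'" "0 < D y z'"
    using harm_distinct[OF assms(1)] harm_distinct[OF assms(2)] by auto
  let ?p = "D x z' * D y z" and ?q = "D x z * D y z'"
  have pq: "0 < ?p" "0 < ?q" using pos by auto
  then have "\<bar>ln (?p / ?q)\<bar> \<le> l \<longleftrightarrow> ln ?p \<le> l + ln ?q \<and> ln ?q \<le> l + ln ?p"
    by (auto simp: ln_div)
  moreover have "ln ?p \<le> l + ln ?q \<longleftrightarrow> ?p \<le> exp l * ?q"
    using pq by (metis exp_le_cancel_iff exp_add exp_ln)
  moreover have "ln ?q \<le> l + ln ?p \<longleftrightarrow> ?q \<le> exp l * ?p"
    using pq by (metis exp_le_cancel_iff exp_add exp_ln)
  ultimately show ?thesis by simp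
qed

text \<open>The ratio of the distances to \<open>x\<close> and \<open>y\<close> is the same at both
  ends of a harmonic pair.\<close>

lemma harm_length_other:
  assumes "harm x y z u" "harm x y z' u'"
  shows "D x u' * D y u / (D x u * D y u') = D x z' * D y z / (D x z * D y z')"
proof -
  have pos: "0 < D x z" "0 < D y z" "0 < D x z'" "0 < D y z'" "0 < D x u" "0 < D y u" "0 < D x u'" "0 < D y u'"
    using harm_distinct[OF assms(1)] harm_distinct[OF assms(2)] by auto
  have "D x u / D y u = D x z / D y z" "D x u' / D y u' = D x z' / D y z'"
    using assms pos by (auto simp: harm_def field_simps)
  then have "(D x u' / D y u') / (D x u / D y u) = (D x z' / D y z') / (D x z / D y z)" by simp
  then show ?thesis by (simp add: mult.commute)
qed

lemma arc_step:
  assumes "s < r" "r < t" "s < r'" "r' < t" "t < s + 2 * pi"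
    and xyz: "x = cis s" "y = cis t" "z = cis r" "z' = cis r'"
    and h: "harm x y z u" "harm x y z' u'"
    and l: "\<bar>ln (D x z' * D y z / (D x z * D y z'))\<bar> \<le> l"
  shows "\<alpha> * D z z' \<le> 4 * (exp l - 1) * (D z u * D z' u' * sqrt (height x y z u * height x y z' u'))"
proof -
  have l0: "0 \<le> l" using l by linarith
  define E where "E = exp l"
  have E: "1 \<le> E" "D x z' * D y z \<le> E * (D x z * D y z')" "D x z * D y z' \<le> E * (D x z' * D y z)"
    using l l0 by (auto simp: E_def harm_length_iff[OF h])
  note d = arc_displacement[OF assms(1-5) xyz E(2,3,1)]
  define c a b where "c = D x y" and "a = D z u" and "b = D z' u'"
  have pos: "0 < a" "0 < b" "0 < c" using h by (auto simp: a_def b_def c_def harm_def)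
  have "0 \<le> \<alpha> * (D z z' * c)" using \<alpha>_pos pos by simp
  then have "(\<alpha> * (D z z' * c)) * (\<alpha> * (D z z' * c)) \<le>
      ((E - 1) * (D x z * D y z')) * ((E - 1) * (D x z' * D y z))"
    using d E(1) unfolding c_def by (intro mult_mono[of _ "(E - 1) * (D x z * D y z')"]) auto
  also have "\<dots> = (E - 1)\<^sup>2 * ((D x z * D y z) * (D x z' * D y z'))" by (simp add: power2_eq_square)
  also have "\<dots> \<le> (E - 1)\<^sup>2 * ((4 * (a * (a + c))) * (4 * (b * (b + c))))"
    by (intro mult_left_mono mult_mono[OF harm_product_bound[OF h(1), folded a_def c_def]
      harm_product_bound[OF h(2), folded b_def c_def]]) (use pos in auto)
  \<comment> \<open>The quotients \<open>(a + c) / (a * c)\<close> and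
    \<open>(b + c) / (b * c)\<close> are the two heights. Written this way, the square of
    \<open>c\<close> factors out on both sides and cancels.\<close>
  also have "\<dots> = (4 * (E - 1) * (a * b) * c)\<^sup>2 * (((a + c) / (a * c)) * ((b + c) / (b * c)))"
  proof -
    define Q where "Q = ((a + c) / (a * c)) * ((b + c) / (b * c))"
    have "Q * (a * b * c)\<^sup>2 = a * (a + c) * (b * (b + c))"
      using pos by (simp add: power2_eq_square Q_def)
    moreover have "(4 * (E - 1) * (a * b) * c)\<^sup>2 * Q = 16 * (E - 1)\<^sup>2 * (Q * (a * b * c)\<^sup>2)"
      by (simp only: power_mult_distrib) simp
    ultimately have "(4 * (E - 1) * (a * b) * c)\<^sup>2 * Q = 16 * (E - 1)\<^sup>2 * (a * (a + c) * (b * (b + c)))"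
      by simp
    then show ?thesis unfolding Q_def by simp
  qed
  finally have "(\<alpha> * (D z z' * c)) * (\<alpha> * (D z z' * c)) \<le> (4 * (E - 1) * (a * b) * c)\<^sup>2 * (((a + c) / (a * c)) * ((b + c) / (b * c)))" .
  moreover have "(\<alpha> * (D z z' * c)) * (\<alpha> * (D z z' * c)) = (\<alpha> * D z z')\<^sup>2 * c\<^sup>2"
    by (simp only: power2_eq_square mult_ac)
  moreover have "(4 * (E - 1) * (a * b) * c)\<^sup>2 * (((a + c) / (a * c)) * ((b + c) / (b * c)))
    = ((4 * (E - 1) * (a * b))\<^sup>2 * (((a + c) / (a * c)) * ((b + c) / (b * c)))) * c\<^sup>2"
    by (simp only: power_mult_distrib mult_ac)
  ultimately have *: "(\<alpha> * D z z')\<^sup>2 * c\<^sup>2 \<le> ((4 * (E - 1) * (a * b))\<^sup>2 * (((a + c) / (a * c)) * ((b + c) / (b * c)))) * c\<^sup>2"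
    by (simp only:)
  have "(a + c) / (a * c) = height x y z u" "(b + c) / (b * c) = height x y z' u'"
    using pos unfolding height_def by (simp_all add: add_divide_distrib flip: a_def b_def c_def)
  with * pos have "(\<alpha> * D z z')\<^sup>2 \<le> (4 * (E - 1) * (a * b))\<^sup>2 * (height x y z u * height x y z' u')"
    by (simp add: mult_le_cancel_right)
  then have "sqrt ((\<alpha> * D z z')\<^sup>2) \<le> sqrt ((4 * (E - 1) * (a * b))\<^sup>2 * (height x y z u * height x y z' u'))"
    by (rule real_sqrt_le_mono)
  moreover have "sqrt ((\<alpha> * D z z')\<^sup>2) = \<alpha> * D z z'" using \<alpha>_pos by simp
  moreover have "sqrt ((4 * (E - 1) * (a * b))\<^sup>2 * H) = 4 * (E - 1) * (a * b) * sqrt H" for H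
    using pos E(1) by (simp add: real_sqrt_mult)
  ultimately show ?thesis by (simp add: a_def b_def E_def)
qed

text \<open>The 4 comes from \<open>harm_product_bound\<close> through \<open>arc_step\<close>. The
  second exponential accounts for the growth of the height, so that the bound refers only to the
  height \<open>F\<close> at the start.\<close>

definition displacement_bound :: "real \<Rightarrow> real \<Rightarrow> real" where
  "displacement_bound l F = 4 / \<alpha> * (exp l - 1) * exp (16 / \<alpha> * l) * F"

text \<open>Once the ends are matched, \<open>arc_step\<close> applies to each of the two arcs. The
  two displacements together bound the change of the length of the moving axis, hence of the
  height.\<close>

lemma line_step:
  assumes h: "harm x y z u" "harm x y z' u'"
    and l: "\<bar>ln (D x z' * D y z / (D x z * D y z'))\<bar> \<le> l"
  obtains v w where "(v, w) = (z', u') \<or> (v, w) = (u', z')"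
    "D z v \<le> displacement_bound l (height x y z u)" "D u w \<le> displacement_bound l (height x y z u)"
    "height x y v w \<le> exp (16 / \<alpha> * l) * height x y z u"
proof -
  have l0: "0 \<le> l" using l by linarith
  have "x \<in> X" "y \<in> X" "x \<noteq> y" using h by (auto simp: harm_def)
  then obtain s t where st: "s < t" "t < s + 2 * pi" "x = cis s" "y = cis t" by (rule two_points)
  from h(1) obtain r1 r2 where r: "s < r1" "r1 < t" "t < r2" "r2 < s + 2 * pi"
    "(z, u) = (cis r1, cis r2) \<or> (z, u) = (cis r2, cis r1)"
    unfolding st(3,4) by (rule harm_arcs[OF _ st(1,2)])
  from h(2) obtain r1' r2' where r': "s < r1'" "r1' < t" "t < r2'" "r2' < s + 2 * pi"
    "(z', u') = (cis r1', cis r2') \<or> (z', u') = (cis r2', cis r1')"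
    unfolding st(3,4) by (rule harm_arcs[OF _ st(1,2)])
  obtain v w where vw: "(v, w) = (z', u') \<or> (v, w) = (u', z')" 
    "(z, u, v, w) = (cis r1, cis r2, cis r1', cis r2') \<or> (z, u, v, w) = (cis r2, cis r1, cis r2', cis r1')"
    using pair_matching[OF r(5) r'(5)] by (elim exE conjE)
  have hv: "harm x y v w" using vw(1) h(2) harm_swap(2)[OF h(2)] by auto
  have lz: "\<bar>ln (D x v * D y z / (D x z * D y v))\<bar> \<le> l"
  proof (cases "v = z'")
    case True
    then show ?thesis using l by simp
  next
    case False
    then have "v = u'" using vw(1) by simp
    then have "D x v / D y v = D x z' / D y z'"
      using h(2) harm_distinct[OF h(2)] by (simp add: harm_def frac_eq_eq)
    then have "D x v / D y v * (D y z / D x z) = D x z' / D y z' * (D y z / D x z)" by simp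
    then have "D x v * D y z / (D x z * D y v) = D x z' * D y z / (D x z * D y z')"
      by (simp add: mult.commute)
    then show ?thesis using l by simp
  qed
  then have lu: "\<bar>ln (D x w * D y u / (D x u * D y w))\<bar> \<le> l"
    using harm_length_other[OF h(1) hv] by simp
  have lu': "\<bar>ln (D y w * D x u / (D y u * D x w))\<bar> \<le> l" if "harm x y z u" "harm x y v w"
    "\<bar>ln (D x w * D y u / (D x u * D y w))\<bar> \<le> l" for z u v w
  proof -
    have "0 < D x w * D y u / (D x u * D y w)" using harm_distinct[OF that(1)] harm_distinct[OF that(2)] by simp
    moreover have "D y w * D x u / (D y u * D x w) = inverse (D x w * D y u / (D x u * D y w))"
      by (simp add: mult.commute)
    ultimately show ?thesis using that(3) by (simp only: ln_inverse abs_minus_cancel)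
  qed
  define H H' where "H = height x y z u" and "H' = height x y v w"
  have step: "\<alpha> * D z v \<le> 4 * (exp l - 1) * (D z u * D v w * sqrt (H * H'))"
     "\<alpha> * D u w \<le> 4 * (exp l - 1) * (D z u * D v w * sqrt (H * H'))"
  proof -
    have *: "\<alpha> * D p p' \<le> 4 * (exp l - 1) * (D p q * D p' q' * sqrt (height x y p q * height x y p' q'))
       \<and> \<alpha> * D q q' \<le> 4 * (exp l - 1) * (D p q * D p' q' * sqrt (height x y p q * height x y p' q'))"
      if pq: "p = cis r1" "q = cis r2" "p' = cis r1'" "q' = cis r2'"
        and hp: "harm x y p q" "harm x y p' q'"
        and lp: "\<bar>ln (D x p' * D y p / (D x p * D y p'))\<bar> \<le> l" "\<bar>ln (D x q' * D y q / (D x q * D y q'))\<bar> \<le> l" for p q p' q'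
    proof
      show "\<alpha> * D p p' \<le> 4 * (exp l - 1) * (D p q * D p' q' * sqrt (height x y p q * height x y p' q'))"
        by (rule arc_step[of s r1 t r1']) (use st r r' pq hp lp in auto)
      \<comment> \<open>The other arc runs from \<open>y\<close> to \<open>x\<close>, so
        \<open>x\<close> and \<open>y\<close> exchange their roles and the angles go from
        \<open>t\<close> to \<open>s + 2 * pi\<close>.\<close>
      have "\<alpha> * D q q' \<le> 4 * (exp l - 1) * (D q p * D q' p' * sqrt (height y x q p * height y x q' p'))"
        by (rule arc_step[of t r2 "s + 2 * pi" r2'])
          (use st r r' pq lu'[OF hp lp(2)] hp[THEN harm_swap(1), THEN harm_swap(2)] in auto)
      then show "\<alpha> * D q q' \<le> 4 * (exp l - 1) * (D p q * D p' q' * sqrt (height x y p q * height x y p' q'))"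
        by (simp add: height_def D_sym[of y x] D_sym[of q p] D_sym[of q' p'])
    qed
    have e: "D u z = D z u" "D w v = D v w" "height x y u z = H" "height x y w v = H'"
      using D_sym[of u z] D_sym[of w v] by (auto simp: height_def H_def H'_def)
    from vw(2) have "\<alpha> * D z v \<le> 4 * (exp l - 1) * (D z u * D v w * sqrt (H * H'))
       \<and> \<alpha> * D u w \<le> 4 * (exp l - 1) * (D z u * D v w * sqrt (H * H'))"
    proof
      assume "(z, u, v, w) = (cis r1, cis r2, cis r1', cis r2')"
      then show ?thesis
        unfolding H_def H'_def by (intro * h(1) hv lz lu) simp_all
    next
      assume "(z, u, v, w) = (cis r2, cis r1, cis r2', cis r1')"
      then have "\<alpha> * D u w \<le> 4 * (exp l - 1) * (D u z * D w v * sqrt (height x y u z * height x y w v)) \<and>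
          \<alpha> * D z v \<le> 4 * (exp l - 1) * (D u z * D w v * sqrt (height x y u z * height x y w v))"
        by (intro * harm_swap(2)[OF h(1)] harm_swap(2)[OF hv] lz lu) simp_all
      then show ?thesis unfolding e by blast
    qed
    then show "\<alpha> * D z v \<le> 4 * (exp l - 1) * (D z u * D v w * sqrt (H * H'))"
      "\<alpha> * D u w \<le> 4 * (exp l - 1) * (D z u * D v w * sqrt (H * H'))" by blast+
  qed
  have H: "0 < H" "0 < H'" using h(1) hv by (auto simp: H_def H'_def height_pos)
  \<comment> \<open>\<open>K\<close> is twice the constant \<open>4 / \<alpha>\<close> of
    \<open>arc_step\<close>, once for each end of the moving axis.\<close>
  define a b K where "a = D z u" and "b = D v w" and "K = 8 / \<alpha>"
  have ab: "0 < a" "0 < b" "a \<le> 1" "b \<le> 1" using h hv by (auto simp: a_def b_def harm_def D_le_1)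
  have "b \<ge> a - D z v - D u w"
    using D_triangle[of z u v] D_triangle[of v u w] D_sym[of w u] by (simp add: a_def b_def)
  then have "\<alpha> * (a - b) \<le> \<alpha> * (D z v + D u w)" using \<alpha>_pos by (intro mult_left_mono) auto
  also have "\<dots> \<le> 8 * (exp l - 1) * (a * b * sqrt (H * H'))"
    using step by (simp add: algebra_simps a_def b_def)
  finally have "\<alpha> * (a - b) \<le> 8 * (exp l - 1) * (a * b * sqrt (H * H'))" .
  then have "1 / b - 1 / a \<le> K * (exp l - 1) * sqrt (H * H')"
  proof -
    assume "\<alpha> * (a - b) \<le> 8 * (exp l - 1) * (a * b * sqrt (H * H'))"
    then have "a - b \<le> 8 * (exp l - 1) * (a * b * sqrt (H * H')) / \<alpha>"
      using \<alpha>_pos by (simp add: pos_le_divide_eq mult.commute)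
    also have "\<dots> = K * (exp l - 1) * sqrt (H * H') * (a * b)" by (simp add: K_def)
    finally have "(a - b) / (a * b) \<le> K * (exp l - 1) * sqrt (H * H')"
      using ab by (simp only: pos_divide_le_eq mult_pos_pos)
    moreover have "1 / b - 1 / a = (a - b) / (a * b)" using ab by (simp add: diff_frac_eq)
    ultimately show ?thesis by simp
  qed
  moreover have "H' - H = 1 / b - 1 / a" by (simp add: H_def H'_def height_def a_def b_def)
  moreover have "sqrt (H * H') = sqrt H' * sqrt H" unfolding real_sqrt_mult by (rule mult.commute)
  ultimately have HH: "H' - H \<le> K * (exp l - 1) * (sqrt H' * sqrt H)" by (simp only:)
  have K: "1 \<le> K" using \<alpha>_pos \<alpha>_less_1 by (simp add: K_def)
  \<comment> \<open>If the height grows, \<open>H' - H\<close> is at least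
    \<open>sqrt H' * (sqrt H' - sqrt H)\<close>, and a factor \<open>sqrt H'\<close> cancels. What
    remains is linear in the roots.\<close>
  have s: "sqrt H' \<le> (1 + K * (exp l - 1)) * sqrt H"
  proof (cases "sqrt H' \<le> sqrt H")
    case True
    have "1 * sqrt H \<le> (1 + K * (exp l - 1)) * sqrt H" using K l0 H by (intro mult_right_mono) auto
    with True show ?thesis by linarith
  next
    case False
    have "H' - H = sqrt H' * sqrt H' - sqrt H * sqrt H" using H by simp
    moreover have "sqrt H * sqrt H \<le> sqrt H' * sqrt H" using False H by (intro mult_right_mono) auto
    ultimately have "sqrt H' * (sqrt H' - sqrt H) \<le> sqrt H' * (K * (exp l - 1) * sqrt H)"
      using HH by (simp add: algebra_simps)
    then have "sqrt H' - sqrt H \<le> K * (exp l - 1) * sqrt H" using H by simp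
    then show ?thesis by (simp add: algebra_simps)
  qed
  have "sqrt H' \<le> exp (K * l) * sqrt H"
    by (rule order_trans[OF s]) (use one_plus_mult_expm1_le[OF K] H in \<open>auto intro!: mult_right_mono\<close>)
  then have s': "sqrt H' * sqrt H' \<le> (exp (K * l) * sqrt H) * (exp (K * l) * sqrt H)"
    using H by (intro mult_mono) auto
  also have "\<dots> = (exp (K * l) * exp (K * l)) * (sqrt H * sqrt H)" by (simp only: mult_ac)
  also have "\<dots> = exp (K * l + K * l) * H" using H by (simp only: exp_add) simp
  finally have H': "H' \<le> exp (16 / \<alpha> * l) * H" using H by (simp add: K_def)
  have "H * H' \<le> (exp (16 / \<alpha> * l) * H)\<^sup>2"
  proof -
    have "1 * H \<le> exp (16 / \<alpha> * l) * H" using H l0 \<alpha>_pos by (intro mult_right_mono) auto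
    then show ?thesis unfolding power2_eq_square using H H' by (intro mult_mono) auto
  qed
  then have sq: "sqrt (H * H') \<le> exp (16 / \<alpha> * l) * H"
    using H by (intro real_le_lsqrt) auto
  \<comment> \<open>Here \<open>D \<le> 1\<close> discards the factors \<open>a\<close> and
    \<open>b\<close>.\<close>
  have "a * b * sqrt (H * H') \<le> 1 * (exp (16 / \<alpha> * l) * H)"
    using ab sq H by (intro mult_mono mult_le_one) auto
  then have "4 * (exp l - 1) * (a * b * sqrt (H * H')) \<le> 4 * (exp l - 1) * (exp (16 / \<alpha> * l) * H)"
    using l0 by (intro mult_left_mono) auto
  then have "\<alpha> * D z v \<le> 4 * (exp l - 1) * (exp (16 / \<alpha> * l) * H)"
     "\<alpha> * D u w \<le> 4 * (exp l - 1) * (exp (16 / \<alpha> * l) * H)"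
    using step unfolding a_def b_def by linarith+
  then have "D z v \<le> displacement_bound l H" "D u w \<le> displacement_bound l H"
    using \<alpha>_pos by (auto simp: displacement_bound_def field_simps)
  with that[OF vw(1)] H' show ?thesis by (simp add: H_def H'_def)
qed

subsection \<open>Common perpendiculars\<close>

lemma ratio_root:
  assumes "a < b" "D x (cis a) < c * D y (cis a)" "c * D y (cis b) < D x (cis b)"
    and xy: "x \<in> X" "y \<in> X"
  obtains r where "a < r" "r < b" "D x (cis r) = c * D y (cis r)"
proof -
  define f where "f = (\<lambda>r. D x (cis r) - c * D y (cis r))"
  have "continuous_on {a..b} f"
    unfolding f_def using xy by (intro continuous_intros continuous_on_D) auto
  then obtain r where r: "a \<le> r" "r \<le> b" "f r = 0"
    using IVT'[of f a 0 b] assms(1-3) by (auto simp: f_def)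
  with assms(1-3) have "r \<noteq> a" "r \<noteq> b" by (auto simp: f_def)
  with r that[of r] show ?thesis by (simp add: f_def)
qed

text \<open>The ratio of the distances to \<open>cis s\<close> and \<open>cis t\<close> increases
  strictly along the arc. Products instead of ratios admit the ends of the arc, where a distance
  vanishes.\<close>

lemma cross_mono:
  assumes "s \<le> r" "r < r'" "r' \<le> t" "t < s + 2 * pi"
  shows "D (cis s) (cis r) * D (cis t) (cis r') < D (cis s) (cis r') * D (cis t) (cis r)"
proof (cases "s = r \<or> r' = t")
  case True
  have "0 < D (cis s) (cis r') * D (cis t) (cis r)"
    using assms D_cis_pos[of s r'] D_cis_pos[of r t] D_sym[of "cis r" "cis t"] by simp
  then show ?thesis using True by auto
next
  case False
  then show ?thesis using cross_less[of s r r' t] assms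
    by (simp add: D_sym[of _ "cis t"])
qed

text \<open>Reflecting a point of the arc from \<open>t1\<close> to \<open>t2\<close> in the axis
  \<open>{p, q}\<close> gives a harmonic conjugate \<open>cis (\<sigma> r)\<close> on the arc from
  \<open>t3\<close> to \<open>t4\<close>. It depends continuously on \<open>r\<close>, so the
  intermediate value theorem finds an \<open>r\<close> for which the pair is also harmonic to
  \<open>{x, y}\<close>.\<close>

lemma common_perpendicular_ex:
  assumes t: "t1 < t2" "t2 < t3" "t3 < t4" "t4 < t1 + 2 * pi"
  obtains r r' where "t1 < r" "r < t2" "t3 < r'" "r' < t4"
    "harm (cis t1) (cis t2) (cis r) (cis r')" "harm (cis t3) (cis t4) (cis r) (cis r')"
proof -
  define x y p q where "x = cis t1" and "y = cis t2" and "p = cis t3" and "q = cis t4"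
  note defs = x_def y_def p_def q_def
  have X: "x \<in> X" "y \<in> X" "p \<in> X" "q \<in> X" by (auto simp: defs)
  have ne: "x \<noteq> y" "x \<noteq> p" "x \<noteq> q" "y \<noteq> p" "y \<noteq> q" "p \<noteq> q"
    using t unfolding defs by (auto dest!: cis_eq_imp_eq)
  \<comment> \<open>The ratio of the distances to \<open>p\<close> and \<open>q\<close>, normalised
    to \<open>{0..1}\<close> so that it stays finite at \<open>q\<close>.\<close>
  define h where "h = (\<lambda>r. D p (cis r) / (D p (cis r) + D q (cis r)))"
  have den: "0 < D p w + D q w" for w
    using ne(6) by (cases "p = w") (auto intro: add_pos_nonneg add_nonneg_pos)
  have cont_h: "continuous_on S h" for S
    unfolding h_def using X den less_imp_neq[OF den]
    by (intro continuous_intros continuous_on_D) (auto simp: less_imp_neq[OF den, symmetric])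
  have "strict_mono_on {t3..t4} h"
  proof (rule strict_mono_onI)
    fix r r' assume "r \<in> {t3..t4}" "r' \<in> {t3..t4}" "r < r'"
    then have "D p (cis r) * D q (cis r') < D p (cis r') * D q (cis r)"
      unfolding p_def q_def using t by (intro cross_mono) auto
    then show "h r < h r'"
      unfolding h_def by (simp add: frac_less_eq divide_less_eq den pos_divide_less_eq less_divide_eq algebra_simps)
  qed
  then have inj: "inj_on h {t3..t4}" by (rule strict_mono_on_imp_inj_on)
  define g where "g = inv_into {t3..t4} h"
  have cont_g: "continuous_on (h ` {t3..t4}) g"
    unfolding g_def by (rule continuous_on_inv[OF cont_h]) (use inj in auto)
  have surj: "{0..1} \<subseteq> h ` {t3..t4}"
  proof
    fix v :: real assume "v \<in> {0..1}"
    moreover have "h t3 = 0" "h t4 = 1" using ne by (auto simp: h_def defs)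
    ultimately obtain r where "t3 \<le> r" "r \<le> t4" "h r = v"
      using IVT'[of h t3 v t4] cont_h t by auto
    then show "v \<in> h ` {t3..t4}" by auto
  qed
  have h01: "h r \<in> {0..1}" for r using den[of "cis r"] by (simp add: h_def)
  define \<sigma> where "\<sigma> = (\<lambda>r. g (h r))"
  have \<sigma>: "h (\<sigma> r) = h r" "\<sigma> r \<in> {t3..t4}" for r
    using f_inv_into_f[of "h r" h "{t3..t4}"] inv_into_into[of "h r" h "{t3..t4}"] subsetD[OF surj h01[of r]]
    unfolding \<sigma>_def g_def by blast+
  have cont_\<sigma>: "continuous_on S \<sigma>" for S
    unfolding \<sigma>_def by (rule continuous_on_compose2[OF cont_g cont_h]) (use surj h01 in blast)
  have eq: "D p (cis r) * D q (cis (\<sigma> r)) = D p (cis (\<sigma> r)) * D q (cis r)" for r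
    using \<sigma>(1)[of r] den[of "cis r"] den[of "cis (\<sigma> r)"]
    by (simp add: h_def frac_eq_eq less_imp_neq[symmetric] algebra_simps)
  have ne\<sigma>: "\<sigma> r \<noteq> t3" "\<sigma> r \<noteq> t4" "cis (\<sigma> r) \<noteq> cis r" if "t1 \<le> r" "r \<le> t2" for r
  proof -
    have "p \<noteq> cis r" "q \<noteq> cis r" using that t unfolding defs by (auto dest!: cis_eq_imp_eq)
    then show "\<sigma> r \<noteq> t3" "\<sigma> r \<noteq> t4" using eq[of r] ne by (auto simp: defs)
    show "cis (\<sigma> r) \<noteq> cis r" using cis_eq_imp_eq[of "\<sigma> r" r] \<sigma>(2)[of r] t that by auto
  qed
  define f where "f = (\<lambda>r. D x (cis r) * D y (cis (\<sigma> r)) - D x (cis (\<sigma> r)) * D y (cis r))"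
  have pos: "0 < D x (cis (\<sigma> r))" "0 < D y (cis (\<sigma> r))" for r
    using \<sigma>(2)[of r] t cis_eq_imp_eq[of t1 "\<sigma> r"] cis_eq_imp_eq[of t2 "\<sigma> r"] by (auto simp: defs)
  \<comment> \<open>At each end one of the two products vanishes, which gives opposite
    signs.\<close>
  have "f t1 < 0" "0 < f t2" using pos ne D_sym[of y x] by (auto simp: f_def simp flip: x_def y_def)
  moreover have "continuous_on {t1..t2} f"
    unfolding f_def using X by (intro continuous_intros continuous_on_D cont_\<sigma>) auto
  ultimately obtain r where r: "t1 \<le> r" "r \<le> t2" "f r = 0"
    using IVT'[of f t1 0 t2] t by auto
  with \<open>f t1 < 0\<close> \<open>0 < f t2\<close> have "r \<noteq> t1" "r \<noteq> t2" by auto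
  with that[of r "\<sigma> r"] r ne\<sigma>[of r] \<sigma>(2)[of r] eq[of r] X ne show ?thesis
    by (auto simp: harm_def f_def simp flip: defs)
qed

text \<open>For two points of an arc, the cross-ratio with the ends of the arc decreases strictly when the
  arc grows. Two common perpendiculars \<open>(r1, r1')\<close>, \<open>(r2, r2')\<close> would give the same cross-ratio at
  \<open>r1, r2\<close> and at \<open>r1', r2'\<close>, for each of the two axes; but the arc of the first axis is the smaller one
  at \<open>r1, r2\<close> and the larger one at \<open>r1', r2'\<close>.\<close>

lemma common_perpendicular_unique_aux:
  assumes t: "t1 < t2" "t2 < t3" "t3 < t4" "t4 < t1 + 2 * pi"
    and r: "t1 < r1" "r1 < r2" "r2 < t2" "t3 < r1'" "r1' < t4" "t3 < r2'" "r2' < t4"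
    and h: "harm (cis t1) (cis t2) (cis r1) (cis r1')" "harm (cis t3) (cis t4) (cis r1) (cis r1')"
      "harm (cis t1) (cis t2) (cis r2) (cis r2')" "harm (cis t3) (cis t4) (cis r2) (cis r2')"
  shows False
proof -
  define x y p q where "x = cis t1" and "y = cis t2" and "p = cis t3" and "q = cis t4"
  note defs = x_def y_def p_def q_def
  have h': "harm x y (cis r1) (cis r1')" "harm p q (cis r1) (cis r1')"
      "harm x y (cis r2) (cis r2')" "harm p q (cis r2) (cis r2')" using h unfolding defs .
  have ratio: "\<exists>A>0. D x z = A * D y z \<and> D x u = A * D y u" if "harm x y z u" for x y z u
    using that harm_distinct[OF that] by (intro exI[of _ "D x z / D y z"]) (auto simp: harm_def field_simps)
  \<comment> \<open>Harmonicity as equality of ratios: \<open>A\<close> and \<open>B\<close>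
    describe the two perpendiculars relative to \<open>{x, y}\<close>, \<open>C\<close> and
    \<open>E\<close> relative to \<open>{p, q}\<close>.\<close>
  obtain A where A: "0 < A" "D x (cis r1) = A * D y (cis r1)" "D x (cis r1') = A * D y (cis r1')"
    using ratio[OF h'(1)] by blast
  obtain B where B: "0 < B" "D x (cis r2) = B * D y (cis r2)" "D x (cis r2') = B * D y (cis r2')"
    using ratio[OF h'(3)] by blast
  obtain C where C: "0 < C" "D q (cis r1) = C * D p (cis r1)" "D q (cis r1') = C * D p (cis r1')"
    using ratio[OF harm_swap(1)[OF h'(2)]] by blast
  obtain E where E: "0 < E" "D q (cis r2) = E * D p (cis r2)" "D q (cis r2') = E * D p (cis r2')"
    using ratio[OF harm_swap(1)[OF h'(4)]] by blast
  have pos: "0 < D y (cis r1)" "0 < D y (cis r1')" "0 < D y (cis r2)" "0 < D y (cis r2')"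
    "0 < D p (cis r1)" "0 < D p (cis r1')" "0 < D p (cis r2)" "0 < D p (cis r2')"
    using h'[THEN harm_distinct] by auto
  have "D x (cis r1) * D y (cis r2) < D x (cis r2) * D y (cis r1)"
    unfolding x_def y_def using t r by (intro cross_mono) auto
  then have "A * (D y (cis r1) * D y (cis r2)) < B * (D y (cis r1) * D y (cis r2))"
    unfolding A(2) B(2) by (simp add: mult_ac)
  then have "A < B" using pos by simp
  \<comment> \<open>On the complementary arc from \<open>y\<close> to \<open>x\<close> the ratio
    decreases, so the order of the second ends is reversed.\<close>
  have "r2' < r1'"
  proof (rule ccontr)
    assume "\<not> r2' < r1'"
    then have "r1' = r2' \<or> r1' < r2'" by auto
    then have "D y (cis r1') * D x (cis r2') \<le> D y (cis r2') * D x (cis r1')"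
    proof
      assume "r1' < r2'"
      then show ?thesis using cross_mono[of t2 r1' r2' "t1 + 2 * pi"] t r by (simp add: x_def y_def)
    qed simp
    then have "B * (D y (cis r1') * D y (cis r2')) \<le> A * (D y (cis r1') * D y (cis r2'))"
      unfolding A(3) B(3) by (simp add: mult_ac)
    then have "B \<le> A" using pos by simp
    with \<open>A < B\<close> show False by simp
  qed
  \<comment> \<open>Each of the four comparisons exchanges one end of an arc, \<open>x\<close> with
    \<open>q\<close> or \<open>y\<close> with \<open>p\<close>. Multiplying two of them exchanges
    the whole arc.\<close>
  have 1: "D q (cis r2) * D x (cis r1) < D q (cis r1) * D x (cis r2)"
    using cross_less[of t1 r1 r2 t4] t r by (simp add: defs D_sym[of _ "cis t4"] mult_ac)
  have 2: "D p (cis r1) * D y (cis r2) < D p (cis r2) * D y (cis r1)"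
    using cross_less'[of r1 r2 t2 t3] t r by (simp add: defs D_sym[of _ "cis t3"] D_sym[of _ "cis t2"] mult_ac)
  have 3: "D q (cis r1') * D x (cis r2') < D q (cis r2') * D x (cis r1')"
    using cross_less'[of r2' r1' t4 "t1 + 2 * pi"] t r \<open>r2' < r1'\<close>
    by (simp add: defs D_sym[of _ "cis t4"] D_sym[of _ "cis t1"] mult_ac)
  have 4: "D p (cis r2') * D y (cis r1') < D p (cis r1') * D y (cis r2')"
    using cross_less'[of t2 t3 r2' r1'] t r \<open>r2' < r1'\<close> by (simp add: defs mult_ac)
  have "(D q (cis r2) * D x (cis r1)) * (D p (cis r1) * D y (cis r2))
      < (D q (cis r1) * D x (cis r2)) * (D p (cis r2) * D y (cis r1))"
    by (rule mult_strict_mono[OF 1 2]) (use pos in \<open>auto simp: C E A B\<close>)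
  then have "(E * A) * (D p (cis r2) * D y (cis r1) * D p (cis r1) * D y (cis r2))
     < (C * B) * (D p (cis r2) * D y (cis r1) * D p (cis r1) * D y (cis r2))"
    unfolding C E A B by (simp add: mult_ac)
  then have "E * A < C * B" using pos by (simp add: mult_less_cancel_right)
  have "(D q (cis r1') * D x (cis r2')) * (D p (cis r2') * D y (cis r1'))
      < (D q (cis r2') * D x (cis r1')) * (D p (cis r1') * D y (cis r2'))"
    by (rule mult_strict_mono[OF 3 4]) (use pos in \<open>auto simp: C E A B\<close>)
  then have "(C * B) * (D p (cis r2') * D y (cis r1') * D p (cis r1') * D y (cis r2'))
     < (E * A) * (D p (cis r2') * D y (cis r1') * D p (cis r1') * D y (cis r2'))"
    unfolding C E A B by (simp add: mult_ac)
  then have "C * B < E * A" using pos by (simp add: mult_less_cancel_right)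
  with \<open>E * A < C * B\<close> show False by simp
qed

text \<open>The second end is determined by the first, because the ratio of the distances to
  \<open>cis t3\<close> and \<open>cis t4\<close> is injective on their arc.\<close>

lemma common_perpendicular_unique:
  assumes t: "t1 < t2" "t2 < t3" "t3 < t4" "t4 < t1 + 2 * pi"
    and r: "t1 < r1" "r1 < t2" "t1 < r2" "r2 < t2" "t3 < r1'" "r1' < t4" "t3 < r2'" "r2' < t4"
    and h: "harm (cis t1) (cis t2) (cis r1) (cis r1')" "harm (cis t3) (cis t4) (cis r1) (cis r1')"
      "harm (cis t1) (cis t2) (cis r2) (cis r2')" "harm (cis t3) (cis t4) (cis r2) (cis r2')"
  shows "r1 = r2 \<and> r1' = r2'"
proof
  show eq: "r1 = r2"
    using common_perpendicular_unique_aux[OF t, of r1 r2 r1' r2']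
      common_perpendicular_unique_aux[OF t, of r2 r1 r2' r1'] r h by (cases r1 r2 rule: linorder_cases) auto
  have False if "a < b" "t3 < a" "b < t4" "harm (cis t3) (cis t4) (cis r1) (cis a)" 
     "harm (cis t3) (cis t4) (cis r1) (cis b)" for a b
  proof -
    have "D (cis t3) (cis a) * D (cis t4) (cis b) < D (cis t3) (cis b) * D (cis t4) (cis a)"
      using that t by (intro cross_mono) auto
    moreover have "D (cis t3) (cis r1) * D (cis t4) (cis a) = D (cis t3) (cis a) * D (cis t4) (cis r1)"
      "D (cis t3) (cis r1) * D (cis t4) (cis b) = D (cis t3) (cis b) * D (cis t4) (cis r1)"
      using that by (auto simp: harm_def)
    moreover have "0 < D (cis t3) (cis r1)" "0 < D (cis t4) (cis r1)" using harm_distinct[OF that(4)] by auto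
    ultimately show False
      by (smt (verit, ccfv_SIG) mult.assoc mult.commute mult_less_cancel_left_pos)
  qed
  from this[of r1' r2'] this[of r2' r1'] show "r1' = r2'"
    using r h eq by (cases r1' r2' rule: linorder_cases) auto
qed

subsection \<open>Paths\<close>

definition line_dist :: "complex \<Rightarrow> complex \<Rightarrow> complex \<Rightarrow> complex \<Rightarrow> real" where
  "line_dist x y z z' = \<bar>ln (D x z' * D y z / (D x z * D y z'))\<bar>"

text \<open>The logarithm of the ratio of the distances to \<open>x\<close> and \<open>y\<close> is
  an arc-length coordinate on the line with axis \<open>{x, y}\<close>.\<close>

lemma line_dist_ratio:
  assumes "0 < a" "0 < b" "D x z = a * D y z" "D x z' = b * D y z'" "y \<noteq> z" "y \<noteq> z'"
  shows "line_dist x y z z' = \<bar>ln a - ln b\<bar>"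
proof -
  have "D x z' * D y z / (D x z * D y z') = b / a" using assms by (simp add: field_simps)
  then show ?thesis using assms by (simp add: line_dist_def ln_div abs_minus_commute)
qed

lemma harm_ratio:
  assumes "harm x y z u"
  obtains a where "0 < a" "D x z = a * D y z" "D x u = a * D y u"
  using that[of "D x z / D y z"] assms harm_distinct[OF assms] by (auto simp: harm_def field_simps)

text \<open>Each ratio occurs on both arcs between \<open>x\<close> and \<open>y\<close>, and two
  points with the same ratio are harmonic to \<open>{x, y}\<close>. So the coordinate of a line
  takes all real values.\<close>

lemma line_point_ex:
  assumes "x \<in> X" "y \<in> X" "x \<noteq> y" "0 < c"
  obtains v w where "harm x y v w" "D x v = c * D y v" "D x w = c * D y w"
proof -
  obtain s t where st: "s < t" "t < s + 2 * pi" "x = cis s" "y = cis t" using two_points[OF assms(1-3)] .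
  obtain r where r: "s < r" "r < t" "D x (cis r) = c * D y (cis r)"
    using ratio_root[of s t x c y] st assms D_sym[of x y] by auto
  obtain r' where r': "t < r'" "r' < s + 2 * pi" "D y (cis r') = inverse c * D x (cis r')"
    using ratio_root[of t "s + 2 * pi" y "inverse c" x] st assms D_sym[of x y] by auto
  have "D x (cis r') = c * D y (cis r')" using r'(3) assms by (simp add: field_simps)
  moreover have "cis r \<noteq> cis r'" using r r' cis_eq_imp_eq[of r r'] by auto
  ultimately show ?thesis using that[of "cis r" "cis r'"] r(3) assms by (auto simp: harm_def)
qed

text \<open>Zig-zag paths with their exact length, but without the condition that consecutive sides
  use the two different axes of their junction. Concatenation, reversal and splitting become simple;
  \<open>zz_path_prepend\<close> restores the condition.\<close>

inductive reach :: "complex set set \<Rightarrow> real \<Rightarrow> complex set set \<Rightarrow> bool" where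
  stay: "harm x y z u \<Longrightarrow> reach (quad x y z u) 0 (quad x y z u)"
| move: "harm x y z u \<Longrightarrow> harm x y z' u' \<Longrightarrow> reach (quad x y z' u') l q' \<Longrightarrow>
    reach (quad x y z u) (line_dist x y z z' + l) q'"

lemma reach_line: "harm x y z u \<Longrightarrow> harm x y z' u' \<Longrightarrow> reach (quad x y z u) (line_dist x y z z') (quad x y z' u')"
  using move[OF _ _ stay] by fastforce

lemma reach_nonneg: "reach q l q' \<Longrightarrow> 0 \<le> l"
  by (induction rule: reach.induct) (auto simp: line_dist_def)

lemma reach_trans: "reach q l q' \<Longrightarrow> reach q' l' q'' \<Longrightarrow> reach q (l + l') q''"
  by (induction rule: reach.induct) (auto simp: add.assoc intro: move)

lemma line_dist_commute:
  assumes "harm x y z u" "harm x y z' u'"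
  shows "line_dist x y z z' = line_dist x y z' z"
proof -
  obtain a where a: "0 < a" "D x z = a * D y z" using assms(1) by (rule harm_ratio)
  obtain b where b: "0 < b" "D x z' = b * D y z'" using assms(2) by (rule harm_ratio)
  have "y \<noteq> z" "y \<noteq> z'" using harm_distinct[OF assms(1)] harm_distinct[OF assms(2)] by auto
  then show ?thesis
    using line_dist_ratio[of a b x z y z'] line_dist_ratio[of b a x z' y z] a b
    by (simp add: abs_minus_commute)
qed

lemma reach_sym: "reach q l q' \<Longrightarrow> reach q' l q"
proof (induction rule: reach.induct)
  case (move x y z u z' u' l q')
  then have "reach q' (l + line_dist x y z' z) (quad x y z u)"
    by (intro reach_trans[OF move.IH] reach_line)
  with move show ?case using line_dist_commute[of x y z u z' u'] by (simp add: add.commute)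
qed (auto intro: reach.stay)

lemma reach_split: 
  assumes "reach q l q'" "0 \<le> t" "t \<le> l"
  shows "\<exists>m. reach q t m \<and> reach m (l - t) q'"
  using assms
proof (induction arbitrary: t rule: reach.induct)
  case (stay x y z u)
  then show ?case by (auto intro: reach.stay)
next
  case (move x y z u z' u' l q')
  define d where "d = line_dist x y z z'"
  show ?case
  proof (cases "d \<le> t")
    case True
    with move.IH[of "t - d"] move.prems obtain m where m: "reach (quad x y z' u') (t - d) m" "reach m (l - (t - d)) q'"
      by (auto simp: d_def)
    have "reach (quad x y z u) (d + (t - d)) m" unfolding d_def by (rule reach.move[OF move.hyps(1,2)]) (use m(1) d_def in simp)
    with m(2) show ?thesis by (auto simp: d_def algebra_simps)
  next
    case False
    obtain a where a: "0 < a" "D x z = a * D y z" using move.hyps(1) by (rule harm_ratio)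
    obtain b where b: "0 < b" "D x z' = b * D y z'" using move.hyps(2) by (rule harm_ratio)
    have ne: "y \<noteq> z" "y \<noteq> z'" using harm_distinct[OF move.hyps(1)] harm_distinct[OF move.hyps(2)] by auto
    have d: "d = \<bar>ln a - ln b\<bar>" unfolding d_def using a b ne by (intro line_dist_ratio) auto
    \<comment> \<open>The ratio at distance \<open>t\<close> from \<open>a\<close> in the
      logarithmic coordinate, in the direction of \<open>b\<close>.\<close>
    define c where "c = (if ln a \<le> ln b then a * exp t else a / exp t)"
    have c: "0 < c" "\<bar>ln a - ln c\<bar> = t" "\<bar>ln c - ln b\<bar> = d - t"
      using a(1) False move.prems(1) d by (auto simp: c_def ln_mult ln_div)
    have xy: "x \<in> X" "y \<in> X" "x \<noteq> y" using move.hyps(1) by (auto simp: harm_def)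
    obtain v w where v: "harm x y v w" "D x v = c * D y v" "D x w = c * D y w"
      using line_point_ex[OF xy c(1)] .
    have "y \<noteq> v" using harm_distinct[OF v(1)] by auto
    with a b c v ne have "line_dist x y z v = t" "line_dist x y v z' = d - t"
      using line_dist_ratio[of a c x z y v] line_dist_ratio[of c b x v y z'] by auto
    with reach_line[OF move.hyps(1) v(1)] reach.move[OF v(1) move.hyps(2) move.hyps(3)]
    show ?thesis by (auto simp: d_def algebra_simps intro!: exI[of _ "quad x y v w"])
  qed
qed

text \<open>The second displacement starts from a height enlarged by at most
  \<open>exp (16 / \<alpha> * l)\<close>, and \<open>(e - 1) + (e' - 1) \<le> e * e' - 1\<close>. So
  the bound for a path depends on its total length and not on the number of sides.\<close>

lemma displacement_bound_trans:
  assumes "0 \<le> l" "0 \<le> l'" "0 \<le> F" "F' \<le> exp (16 / \<alpha> * l) * F"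
  shows "displacement_bound l F + displacement_bound l' F' \<le> displacement_bound (l + l') F"
proof -
  define e e' E E' where "e = exp l" and "e' = exp l'" and "E = exp (16 / \<alpha> * l)" and "E' = exp (16 / \<alpha> * l')"
  have one: "1 \<le> e" "1 \<le> e'" "1 \<le> E" "1 \<le> E'" using assms \<alpha>_pos by (auto simp: e_def e'_def E_def E'_def)
  have "(e - 1) * E * F + (e' - 1) * E' * F' \<le> (e - 1) * (E * E') * F + (e' - 1) * E' * (E * F)"
    using one assms(3,4) unfolding E_def[symmetric] by (intro add_mono mult_mono mult_left_mono) auto
  also have "\<dots> = (e + e' - 2) * (E * E' * F)" by (simp add: algebra_simps)
  also have "\<dots> \<le> (e * e' - 1) * (E * E' * F)"
  proof (intro mult_right_mono)
    have "0 \<le> (e - 1) * (e' - 1)" using one by simp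
    then show "e + e' - 2 \<le> e * e' - 1" by (simp add: algebra_simps)
  qed (use one assms in auto)
  finally have "4 / \<alpha> * ((e - 1) * E * F + (e' - 1) * E' * F') \<le> 4 / \<alpha> * ((e * e' - 1) * (E * E' * F))"
    using \<alpha>_pos by (intro mult_left_mono) auto
  moreover have "e * e' = exp (l + l')" "E * E' = exp (16 / \<alpha> * (l + l'))"
    unfolding distrib_left exp_add by (simp_all only: e_def e'_def E_def E'_def)
  ultimately have "4 / \<alpha> * ((e - 1) * E * F + (e' - 1) * E' * F')
      \<le> 4 / \<alpha> * ((exp (l + l') - 1) * (exp (16 / \<alpha> * (l + l')) * F))" by (simp only:)
  then show ?thesis
    unfolding displacement_bound_def e_def[symmetric] e'_def[symmetric] E_def[symmetric] E'_def[symmetric]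
    by (simp only: distrib_left mult.assoc)
qed

lemma line_dist_swap:
  assumes "harm x y z u" "harm x y z' u'"
  shows "line_dist y x z z' = line_dist x y z z'" "line_dist x y u z' = line_dist x y z z'"
    "line_dist x y z u' = line_dist x y z z'"
proof -
  obtain a where a: "0 < a" "D x z = a * D y z" "D x u = a * D y u" using assms(1) by (rule harm_ratio)
  obtain b where b: "0 < b" "D x z' = b * D y z'" "D x u' = b * D y u'" using assms(2) by (rule harm_ratio)
  have ne: "y \<noteq> z" "y \<noteq> z'" "x \<noteq> z" "x \<noteq> z'" "y \<noteq> u" "y \<noteq> u'"
    using harm_distinct[OF assms(1)] harm_distinct[OF assms(2)] by auto
  have *: "line_dist x y z z' = \<bar>ln a - ln b\<bar>" using a b ne by (intro line_dist_ratio) auto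
  have "line_dist y x z z' = \<bar>ln (inverse a) - ln (inverse b)\<bar>"
    using a b ne by (intro line_dist_ratio) auto
  then show "line_dist y x z z' = line_dist x y z z'" using * a b by (simp add: ln_inverse)
  have "line_dist x y u z' = \<bar>ln a - ln b\<bar>" "line_dist x y z u' = \<bar>ln a - ln b\<bar>"
    using a b ne by (auto intro!: line_dist_ratio)
  then show "line_dist x y u z' = line_dist x y z z'" "line_dist x y z u' = line_dist x y z z'" using * by auto
qed

text \<open>Quantifying over all representatives of \<open>q\<close> makes the relation composable.\<close>

definition near :: "real \<Rightarrow> complex set set \<Rightarrow> complex set set \<Rightarrow> bool" where
  "near l q q' \<longleftrightarrow> (\<forall>x y z u. harm x y z u \<longrightarrow> q = quad x y z u \<longrightarrow>
    (\<exists>x' y' z' u'. harm x' y' z' u' \<and> q' = quad x' y' z' u' \<and>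
      height x' y' z' u' \<le> exp (16 / \<alpha> * l) * height x y z u \<and>
      D x x' \<le> displacement_bound l (height x y z u) \<and> D y y' \<le> displacement_bound l (height x y z u) \<and>
      D z z' \<le> displacement_bound l (height x y z u) \<and> D u u' \<le> displacement_bound l (height x y z u)))"

lemma near_trans:
  assumes "near l q q'" "near l' q' q''" "0 \<le> l" "0 \<le> l'"
  shows "near (l + l') q q''"
  unfolding near_def
proof (intro allI impI)
  fix x y z u assume h: "harm x y z u" "q = quad x y z u"
  define F where "F = height x y z u"
  obtain x1 y1 z1 u1 where 1: "harm x1 y1 z1 u1" "q' = quad x1 y1 z1 u1"
      "height x1 y1 z1 u1 \<le> exp (16 / \<alpha> * l) * F"
      "D x x1 \<le> displacement_bound l F" "D y y1 \<le> displacement_bound l F"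
      "D z z1 \<le> displacement_bound l F" "D u u1 \<le> displacement_bound l F"
    using assms(1) h unfolding near_def F_def by blast
  define F1 where "F1 = height x1 y1 z1 u1"
  obtain x2 y2 z2 u2 where 2: "harm x2 y2 z2 u2" "q'' = quad x2 y2 z2 u2"
      "height x2 y2 z2 u2 \<le> exp (16 / \<alpha> * l') * F1"
      "D x1 x2 \<le> displacement_bound l' F1" "D y1 y2 \<le> displacement_bound l' F1"
      "D z1 z2 \<le> displacement_bound l' F1" "D u1 u2 \<le> displacement_bound l' F1"
    using assms(2) 1(1,2) unfolding near_def F1_def by blast
  have "0 \<le> F" using height_pos[OF h(1)] by (simp add: F_def)
  then have b: "displacement_bound l F + displacement_bound l' F1 \<le> displacement_bound (l + l') F"
    using displacement_bound_trans[of l l' F F1] assms(3,4) 1(3) F1_def by simp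
  have "exp (16 / \<alpha> * l') * F1 \<le> exp (16 / \<alpha> * l') * (exp (16 / \<alpha> * l) * F)"
    using 1(3) unfolding F1_def by (intro mult_left_mono) auto
  also have "\<dots> = exp (16 / \<alpha> * (l + l')) * F" unfolding distrib_left exp_add by (simp only: mult_ac)
  finally have f: "exp (16 / \<alpha> * l') * F1 \<le> exp (16 / \<alpha> * (l + l')) * F" .
  show "\<exists>x' y' z' u'. harm x' y' z' u' \<and> q'' = quad x' y' z' u' \<and>
      height x' y' z' u' \<le> exp (16 / \<alpha> * (l + l')) * height x y z u \<and>
      D x x' \<le> displacement_bound (l + l') (height x y z u) \<and> D y y' \<le> displacement_bound (l + l') (height x y z u) \<and>
      D z z' \<le> displacement_bound (l + l') (height x y z u) \<and> D u u' \<le> displacement_bound (l + l') (height x y z u)"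
    unfolding F_def[symmetric]
    by (rule exI[of _ x2], rule exI[of _ y2], rule exI[of _ z2], rule exI[of _ u2])
      (use 1 2 b f D_triangle[of x x2 x1] D_triangle[of y y2 y1] D_triangle[of z z2 z1] D_triangle[of u u2 u1] in auto)
qed

lemma displacement_bound_nonneg: "0 \<le> l \<Longrightarrow> 0 \<le> F \<Longrightarrow> 0 \<le> displacement_bound l F"
  using \<alpha>_pos by (simp add: displacement_bound_def)

text \<open>A representative of the starting pair may list the fixed axis second. The height is
  symmetric in the two axes, so \<open>harm_swap\<close> reduces that case to the other.\<close>

lemma near_line:
  assumes h: "harm x y z u" "harm x y z' u'"
  shows "near (line_dist x y z z') (quad x y z u) (quad x y z' u')"
  unfolding near_def
proof (intro allI impI)
  fix a b c d assume abcd: "harm a b c d" "quad x y z u = quad a b c d"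
  define l where "l = line_dist x y z z'"
  have l0: "0 \<le> l" by (simp add: l_def line_dist_def)
  have *: "\<exists>v w. {v, w} = {z', u'} \<and> harm a b v w \<and> height a b v w \<le> exp (16 / \<alpha> * l) * height a b c d \<and>
     D c v \<le> displacement_bound l (height a b c d) \<and> D d w \<le> displacement_bound l (height a b c d)"
    if abcd: "harm a b c d" "{a, b} = {x, y}" "{c, d} = {z, u}" for a b c d
  proof -
    have h': "harm a b z' u'" using abcd(2) h(2) harm_swap(1)[OF h(2)] by (auto simp: doubleton_eq_iff)
    have "line_dist a b c z' = l"
      using abcd(2,3) line_dist_swap[OF h] line_dist_swap(1)[OF harm_swap(2)[OF h(1)] h(2)]
      by (auto simp: doubleton_eq_iff l_def)
    then have "\<bar>ln (D a z' * D b c / (D a c * D b z'))\<bar> \<le> l" by (simp add: line_dist_def)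
    then obtain v w where vw: "(v, w) = (z', u') \<or> (v, w) = (u', z')"
      "D c v \<le> displacement_bound l (height a b c d)" "D d w \<le> displacement_bound l (height a b c d)"
      "height a b v w \<le> exp (16 / \<alpha> * l) * height a b c d"
      by (rule line_step[OF abcd(1) h'])
    then show ?thesis using h' harm_swap(2)[OF h'] by (intro exI[of _ v] exI[of _ w]) auto
  qed
  have F: "0 < height a b c d" using abcd(1) by (rule height_pos)
  note nn = displacement_bound_nonneg[OF l0 less_imp_le[OF F]]
  from quad_eqD[OF abcd(2)] consider "{a, b} = {x, y}" "{c, d} = {z, u}" | "{a, b} = {z, u}" "{c, d} = {x, y}"
    by (elim disjE conjE)
  then show "\<exists>x'' y'' z'' u''. harm x'' y'' z'' u'' \<and> quad x y z' u' = quad x'' y'' z'' u'' \<and>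
      height x'' y'' z'' u'' \<le> exp (16 / \<alpha> * line_dist x y z z') * height a b c d \<and>
      D a x'' \<le> displacement_bound (line_dist x y z z') (height a b c d) \<and>
      D b y'' \<le> displacement_bound (line_dist x y z z') (height a b c d) \<and>
      D c z'' \<le> displacement_bound (line_dist x y z z') (height a b c d) \<and>
      D d u'' \<le> displacement_bound (line_dist x y z z') (height a b c d)"
    unfolding l_def[symmetric]
  proof cases
    case 1
    from *[OF abcd(1) 1] obtain v w where "{v, w} = {z', u'}" "harm a b v w" "height a b v w \<le> exp (16 / \<alpha> * l) * height a b c d"
     "D c v \<le> displacement_bound l (height a b c d)" "D d w \<le> displacement_bound l (height a b c d)" by blast
    then show "\<exists>x'' y'' z'' u''. harm x'' y'' z'' u'' \<and> quad x y z' u' = quad x'' y'' z'' u'' \<and>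
      height x'' y'' z'' u'' \<le> exp (16 / \<alpha> * l) * height a b c d \<and>
      D a x'' \<le> displacement_bound l (height a b c d) \<and> D b y'' \<le> displacement_bound l (height a b c d) \<and>
      D c z'' \<le> displacement_bound l (height a b c d) \<and> D d u'' \<le> displacement_bound l (height a b c d)"
      using nn 1 by (intro exI[of _ a] exI[of _ b] exI[of _ v] exI[of _ w]) simp
  next
    case 2
    have e: "height v w c d = height c d v w" for v w by (simp add: height_def)
    from *[OF harm_swap(3)[OF abcd(1)] 2(2,1)] obtain v w where "{v, w} = {z', u'}" "harm c d v w"
      "height c d v w \<le> exp (16 / \<alpha> * l) * height a b c d"
     "D a v \<le> displacement_bound l (height a b c d)" "D b w \<le> displacement_bound l (height a b c d)"
      unfolding e[of a b] by blast
    then show "\<exists>x'' y'' z'' u''. harm x'' y'' z'' u'' \<and> quad x y z' u' = quad x'' y'' z'' u'' \<and>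
      height x'' y'' z'' u'' \<le> exp (16 / \<alpha> * l) * height a b c d \<and>
      D a x'' \<le> displacement_bound l (height a b c d) \<and> D b y'' \<le> displacement_bound l (height a b c d) \<and>
      D c z'' \<le> displacement_bound l (height a b c d) \<and> D d u'' \<le> displacement_bound l (height a b c d)"
      using nn 2 harm_swap(3)[of c d v w]
      by (intro exI[of _ v] exI[of _ w] exI[of _ c] exI[of _ d]) (simp add: e insert_commute)
  qed
qed

lemma reach_near: "reach q l q' \<Longrightarrow> near l q q'"
proof (induction rule: reach.induct)
  case (stay x y z u)
  then show ?case unfolding near_def
    by (metis D_self displacement_bound_nonneg exp_zero height_pos less_imp_le mult_1 mult_zero_right order_refl)
next
  case (move x y z u z' u' l q')
  show ?case
    using near_trans[OF near_line[OF move.hyps(1,2)] move.IH] reach_nonneg[OF move.hyps(3)]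
    by (simp add: line_dist_def)
qed

lemma line_dist_doubleton:
  assumes h: "harm x y z u" "harm x y z' u'"
    and eq: "{x, y} = {x1, y1}" "{z, u} = {z1, u1}" "{z', u'} = {z1', u1'}"
  shows "line_dist x1 y1 z1 z1' = line_dist x y z z'"
proof -
  have "line_dist a b z1 z1' = line_dist a b z z'" if "harm a b z u" "harm a b z' u'" for a b
    using that eq(2,3) line_dist_swap(2)[OF that] line_dist_swap(3)[OF that]
      line_dist_swap(3)[OF harm_swap(2)[OF that(1)] that(2)]
    by (auto simp: doubleton_eq_iff)
  from this[OF h] this[OF harm_swap(1)[OF h(1)] harm_swap(1)[OF h(2)]] show ?thesis
    using eq(1) line_dist_swap(1)[OF h] by (auto simp: doubleton_eq_iff)
qed

subsection \<open>Short paths between neighbours\<close>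

lemma reach_line':
  assumes "harm x y z u" "harm x' y' z u"
  shows "reach (quad x y z u) (line_dist z u x x') (quad x' y' z u)"
  using reach_line[OF harm_swap(3)[OF assms(1)] harm_swap(3)[OF assms(2)]] by (simp add: insert_commute)

lemma ratio_root':
  assumes "a < b" "c * D y (cis a) < D x (cis a)" "D x (cis b) < c * D y (cis b)" 
    and xy: "x \<in> X" "y \<in> X" "0 < c"
  obtains r where "a < r" "r < b" "D x (cis r) = c * D y (cis r)"
proof -
  obtain r where "a < r" "r < b" "D y (cis r) = inverse c * D x (cis r)"
    using ratio_root[of a b y "inverse c" x] assms by (auto simp: field_simps)
  with that[of r] xy show ?thesis by (auto simp: field_simps)
qed

text \<open>Points with a small ratio \<open>c\<close> of the distances to \<open>z\<close> and
  \<open>u\<close> lie close to \<open>z\<close>. Since \<open>D \<le> 1\<close>, any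
  \<open>c\<close> below both \<open>a\<close> and \<open>b\<close> forces a root on either side of
  \<open>s\<close> within \<open>e\<close>.\<close>

lemma small_perpendicular:
  assumes z: "z = cis s" and zu: "z \<noteq> u" "u \<in> X" and e: "0 < e" "e \<le> pi"
  obtains t1 t2 where "s - e < t1" "t1 < s" "s < t2" "t2 < s + e" "harm (cis t1) (cis t2) z u"
proof -
  define a b where "a = D z (cis (s - e))" and "b = D z (cis (s + e))"
  have ab: "0 < a" "0 < b" using cis_eq_imp_eq[of s "s - e"] cis_eq_imp_eq[of s "s + e"] e by (auto simp: a_def b_def z)
  define c where "c = min a b / 2"
  have c: "0 < c" "c < a" "c < b" using ab by (auto simp: c_def)
  have zX: "z \<in> X" by (simp add: z)
  have le: "c * D u w \<le> c" for w using c D_le_1[of u w] by (simp add: mult_left_le)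
  have s: "D z (cis s) = 0" "0 < c * D u (cis s)" using z zu c by auto
  have far: "c * D u (cis (s + e)) < D z (cis (s + e))" "c * D u (cis (s - e)) < D z (cis (s - e))"
    using c unfolding a_def b_def by (auto intro: le_less_trans[OF le])
  obtain t2 where t2: "s < t2" "t2 < s + e" "D z (cis t2) = c * D u (cis t2)"
    by (rule ratio_root[of s "s + e" z c u]) (use e s far zX zu in auto)
  obtain t1 where t1: "s - e < t1" "t1 < s" "D z (cis t1) = c * D u (cis t1)"
    by (rule ratio_root'[of "s - e" s c u z]) (use e s far c zX zu in auto)
  have "cis t1 \<noteq> cis t2" using cis_eq_imp_eq[of t1 t2] t1 t2 e by auto
  then have "harm z u (cis t1) (cis t2)" using t1 t2 zX zu by (simp add: harm_def)
  then show ?thesis using that[OF t1(1,2) t2(1,2)] harm_swap(3) by blast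
qed

text \<open>Five sides: moving \<open>{x, y}\<close> along \<open>{z, u}\<close> and
  \<open>{x', y'}\<close> along \<open>{z', u'}\<close> produces axes that bound small disjoint arcs
  around \<open>z\<close> and \<open>z'\<close>. These are unlinked, and the other three sides pass
  through their common perpendicular.\<close>

lemma reach_ex:
  assumes h: "harm x y z u" "harm x' y' z' u'"
  shows "\<exists>l. reach (quad x y z u) l (quad x' y' z' u')"
proof -
  have main: "\<exists>l. reach (quad x y z u) l (quad x' y' z' u')"
    if h: "harm x y z u" "harm x' y' z' u'" and ne: "z \<noteq> z'" for x y z u x' y' z' u'
  proof -
    have X: "z \<in> X" "z' \<in> X" "u \<in> X" "u' \<in> X" "z \<noteq> u" "z' \<noteq> u'" using h by (auto simp: harm_def)
    obtain s s' where s: "s < s'" "s' < s + 2 * pi" "z = cis s" "z' = cis s'" using two_points[OF X(1,2) ne] .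
    \<comment> \<open>Half the shorter arc between \<open>z\<close> and \<open>z'\<close>, so that
      the arcs of radius \<open>e\<close> around them do not overlap.\<close>
    define e where "e = min (s' - s) (s + 2 * pi - s') / 2"
    have e: "0 < e" "e \<le> pi" "s + e \<le> s' - e" "s' + e \<le> s + 2 * pi - e" using s by (auto simp: e_def min_def field_simps)
    obtain t1 t2 where t: "s - e < t1" "t1 < s" "s < t2" "t2 < s + e" "harm (cis t1) (cis t2) z u"
      using small_perpendicular[OF s(3) X(5,3) e(1,2)] .
    obtain t3 t4 where t': "s' - e < t3" "t3 < s'" "s' < t4" "t4 < s' + e" "harm (cis t3) (cis t4) z' u'"
      using small_perpendicular[OF s(4) X(6,4) e(1,2)] .
    have ord: "t1 < t2" "t2 < t3" "t3 < t4" "t4 < t1 + 2 * pi" using t(1-4) t'(1-4) e by auto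
    obtain r r' where r: "harm (cis t1) (cis t2) (cis r) (cis r')" "harm (cis t3) (cis t4) (cis r) (cis r')"
      using common_perpendicular_ex[OF ord] .
    note reach_trans[OF reach_trans[OF reach_trans[OF reach_trans[OF reach_line'[OF h(1) t(5)] 
      reach_line[OF t(5) r(1)]] reach_line'[OF r]] reach_line[OF r(2) t'(5)]] reach_line'[OF t'(5) h(2)]]
    then show ?thesis by blast
  qed
  show ?thesis
  proof (cases "z = z'")
    case False
    then show ?thesis using main h by blast
  next
    case True
    then have "u \<noteq> z'" using h by (auto simp: harm_def)
    with main[OF harm_swap(2)[OF h(1)] h(2)] show ?thesis by (simp add: insert_commute)
  qed
qed

lemma tendsto_line_dist:
  assumes lim: "x \<longlonglongrightarrow> x0" "y \<longlonglongrightarrow> y0" "z \<longlonglongrightarrow> z0" "z' \<longlonglongrightarrow> z0'"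
    and X: "\<And>n. x n \<in> X" "\<And>n. y n \<in> X" "\<And>n. z n \<in> X" "\<And>n. z' n \<in> X" "x0 \<in> X" "y0 \<in> X" "z0 \<in> X" "z0' \<in> X"
    and ne: "x0 \<noteq> z0" "y0 \<noteq> z0" "x0 \<noteq> z0'" "y0 \<noteq> z0'"
  shows "(\<lambda>n. line_dist (x n) (y n) (z n) (z' n)) \<longlonglongrightarrow> line_dist x0 y0 z0 z0'"
  unfolding line_dist_def using ne X by (intro tendsto_intros tendsto_D lim) auto

text \<open>Four sides: \<open>{x0, y0}\<close> moves along \<open>{z0, u0}\<close> to
  \<open>{p, q}\<close>; \<open>{z0, u0}\<close> moves to the common perpendicular of
  \<open>{p, q}\<close> and \<open>{x n, y n}\<close>; \<open>{p, q}\<close> moves along it to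
  \<open>{x n, y n}\<close>; the perpendicular moves to \<open>{z n, u n}\<close>. Along a
  subsequence, the lengths tend to \<open>e / 4\<close>, 0, \<open>e / 4\<close> and 0.\<close>

lemma reach_small_aux:
  assumes lim: "x \<longlonglongrightarrow> cis s" "y \<longlonglongrightarrow> cis t" "z \<longlonglongrightarrow> cis r" "u \<longlonglongrightarrow> cis r'"
    and ord: "s < r" "r < t" "t < r'" "r' < s + 2 * pi"
    and h: "\<And>n. harm (x n) (y n) (z n) (u n)" and h0: "harm (cis s) (cis t) (cis r) (cis r')"
    and e: "0 < e"
  shows "\<exists>n l. l < e \<and> reach (quad (cis s) (cis t) (cis r) (cis r')) l (quad (x n) (y n) (z n) (u n))"
proof -
  define x0 y0 z0 u0 where "x0 = cis s" and "y0 = cis t" and "z0 = cis r" and "u0 = cis r'"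
  note defs = x0_def y0_def z0_def u0_def
  have X: "x n \<in> X" "y n \<in> X" "z n \<in> X" "u n \<in> X" "x0 \<in> X" "y0 \<in> X" "z0 \<in> X" "u0 \<in> X" for n
    using h[of n] by (auto simp: harm_def defs)
  have h0': "harm x0 y0 z0 u0" using h0 by (simp add: defs)
  have ne: "x0 \<noteq> y0" "z0 \<noteq> u0" "x0 \<noteq> z0" "y0 \<noteq> z0" "x0 \<noteq> u0" "y0 \<noteq> u0"
    using h0' harm_distinct[OF h0'] by (auto simp: harm_def)
  obtain a where a: "0 < a" "D z0 x0 = a * D u0 x0" "D z0 y0 = a * D u0 y0"
    using harm_ratio[OF harm_swap(3)[OF h0']] .
  \<comment> \<open>The ratio at distance \<open>e / 4\<close> from \<open>{x0, y0}\<close>. Being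
    larger than \<open>a\<close>, it places \<open>p\<close> and \<open>q\<close> on the arc through
    \<open>u0\<close>, one on each side of \<open>u0\<close>, hence unlinked from
    \<open>{x0, y0}\<close>.\<close>
  define b where "b = exp (e / 4) * a"
  have b: "0 < b" "a < b" "ln b = e / 4 + ln a" using a e by (auto simp: b_def ln_mult)
  obtain t3 where t3: "t < t3" "t3 < r'" "D z0 (cis t3) = b * D u0 (cis t3)"
  proof (rule ratio_root[of t r' z0 b u0])
    show "D z0 (cis t) < b * D u0 (cis t)" using a b ne by (simp flip: y0_def)
    show "b * D u0 (cis r') < D z0 (cis r')" using ne by (simp flip: u0_def)
  qed (use ord X in auto)
  obtain t4 where t4: "r' < t4" "t4 < s + 2 * pi" "D z0 (cis t4) = b * D u0 (cis t4)"
  proof (rule ratio_root'[of r' "s + 2 * pi" b u0 z0])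
    show "b * D u0 (cis r') < D z0 (cis r')" using ne by (simp flip: u0_def)
    show "D z0 (cis (s + 2 * pi)) < b * D u0 (cis (s + 2 * pi))" using a b ne by (simp flip: x0_def)
  qed (use ord X b in auto)
  define p q where "p = cis t3" and "q = cis t4"
  have "p \<noteq> q" using cis_eq_imp_eq[of t3 t4] t3 t4 ord by (auto simp: p_def q_def)
  then have pq: "harm p q z0 u0" using X ne t3 t4 harm_swap(3)[of z0 u0 p q] by (simp add: harm_def p_def q_def)
  have pX: "p \<in> X" "q \<in> X" by (auto simp: p_def q_def)
  have eta: "line_dist z0 u0 x0 p = e / 4" "line_dist z0 u0 p x0 = e / 4"
    using line_dist_ratio[of a b z0 x0 u0 p] line_dist_ratio[of b a z0 p u0 x0] a b t3 ne harm_distinct[OF pq] e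
    by (auto simp: p_def)
  obtain sn where sn: "sn \<longlonglongrightarrow> s" "\<And>n. x n = cis (sn n)" using tendsto_cis_lift[OF lim(1)] X by metis
  obtain tn where tn: "tn \<longlonglongrightarrow> t" "\<And>n. y n = cis (tn n)" using tendsto_cis_lift[OF lim(2)] X by metis
  have "\<forall>\<^sub>F n in sequentially. t4 - 2 * pi < sn n" using order_tendstoD(1)[OF sn(1)] t4 by auto
  moreover have "\<forall>\<^sub>F n in sequentially. tn n < t3" using order_tendstoD(2)[OF tn(1)] t3 by auto
  moreover have "\<forall>\<^sub>F n in sequentially. sn n < (s + t) / 2" using order_tendstoD(2)[OF sn(1), of "(s + t) / 2"] ord by auto
  moreover have "\<forall>\<^sub>F n in sequentially. (s + t) / 2 < tn n" using order_tendstoD(1)[OF tn(1), of "(s + t) / 2"] ord by auto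
  ultimately have "\<forall>\<^sub>F n in sequentially. t4 - 2 * pi < sn n \<and> sn n < tn n \<and> tn n < t3"
    by eventually_elim auto
  then obtain N where N: "\<And>n. n \<ge> N \<Longrightarrow> t4 - 2 * pi < sn n \<and> sn n < tn n \<and> tn n < t3"
    by (auto simp: eventually_sequentially)
  define k where "k = (\<lambda>n. n + N)"
  have "\<exists>\<rho>. t4 - 2 * pi < sn (k n) \<and> sn (k n) < fst \<rho> \<and> fst \<rho> < tn (k n) \<and> tn (k n) < t3 \<and> t3 < snd \<rho> \<and> snd \<rho> < t4 \<and>
      harm (x (k n)) (y (k n)) (cis (fst \<rho>)) (cis (snd \<rho>)) \<and> harm p q (cis (fst \<rho>)) (cis (snd \<rho>))" for n
  proof -
    have k: "t4 - 2 * pi < sn (k n)" "sn (k n) < tn (k n)" "tn (k n) < t3" using N[of "k n"] by (auto simp: k_def)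
    with common_perpendicular_ex[of "sn (k n)" "tn (k n)" t3 t4] t3 t4
    obtain r r' where "sn (k n) < r" "r < tn (k n)" "t3 < r'" "r' < t4"
      "harm (cis (sn (k n))) (cis (tn (k n))) (cis r) (cis r')" "harm (cis t3) (cis t4) (cis r) (cis r')" by auto
    with k show ?thesis by (intro exI[of _ "(r, r')"]) (simp add: sn tn p_def q_def)
  qed
  then obtain \<rho> where \<rho>: "\<And>n. t4 - 2 * pi < sn (k n)" "\<And>n. sn (k n) < fst (\<rho> n)" "\<And>n. fst (\<rho> n) < tn (k n)"
      "\<And>n. tn (k n) < t3" "\<And>n. t3 < snd (\<rho> n)" "\<And>n. snd (\<rho> n) < t4"
      "\<And>n. harm (x (k n)) (y (k n)) (cis (fst (\<rho> n))) (cis (snd (\<rho> n)))"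
      "\<And>n. harm p q (cis (fst (\<rho> n))) (cis (snd (\<rho> n)))"
    by metis
  \<comment> \<open>Nothing is known yet about how the perpendiculars vary with \<open>n\<close>. A
    convergent subsequence is extracted, and uniqueness identifies its limit as
    \<open>{z0, u0}\<close>.\<close>
  have "compact ({t4 - 2 * pi..t3} \<times> {t3..t4})" by (intro compact_Times compact_Icc)
  moreover have "\<rho> n \<in> {t4 - 2 * pi..t3} \<times> {t3..t4}" for n
    using \<rho>[of n] by (auto simp: mem_Times_iff)
  ultimately obtain \<rho>0 \<phi> where \<phi>: "strict_mono \<phi>" "(\<rho> \<circ> \<phi>) \<longlonglongrightarrow> \<rho>0"
    unfolding compact_def by metis
  define m where "m = (\<lambda>n. k (\<phi> n))"
  have m: "strict_mono m" using \<phi>(1) by (auto simp: m_def k_def strict_mono_def)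
  define v w where "v = (\<lambda>n. fst (\<rho> (\<phi> n)))" and "w = (\<lambda>n. snd (\<rho> (\<phi> n)))"
  define v0 w0 where "v0 = fst \<rho>0" and "w0 = snd \<rho>0"
  have vlim: "v \<longlonglongrightarrow> v0" "w \<longlonglongrightarrow> w0"
    using tendsto_fst[OF \<phi>(2)] tendsto_snd[OF \<phi>(2)] by (auto simp: v_def w_def v0_def w0_def o_def)
  have xm: "(\<lambda>n. x (m n)) \<longlonglongrightarrow> x0" "(\<lambda>n. y (m n)) \<longlonglongrightarrow> y0" "(\<lambda>n. z (m n)) \<longlonglongrightarrow> z0" "(\<lambda>n. u (m n)) \<longlonglongrightarrow> u0"
    "(\<lambda>n. sn (m n)) \<longlonglongrightarrow> s" "(\<lambda>n. tn (m n)) \<longlonglongrightarrow> t"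
    using lim sn(1) tn(1) by (auto simp: defs intro!: LIMSEQ_subseq_LIMSEQ[OF _ m, unfolded o_def])
  have hv: "harm (x (m n)) (y (m n)) (cis (v n)) (cis (w n))" "harm p q (cis (v n)) (cis (w n))"
     "sn (m n) \<le> v n" "v n \<le> tn (m n)" "t3 \<le> w n" "w n \<le> t4" for n
    using \<rho>[of "\<phi> n"] by (auto simp: m_def v_def w_def)
  have bd: "s \<le> v0" "v0 \<le> t" "t3 \<le> w0" "w0 \<le> t4"
    using LIMSEQ_le[OF xm(5) vlim(1)] LIMSEQ_le[OF vlim(1) xm(6)] hv
      LIMSEQ_le_const[OF vlim(2), of t3] LIMSEQ_le_const2[OF vlim(2), of t4] by auto
  have cv: "(\<lambda>n. cis (v n)) \<longlonglongrightarrow> cis v0" "(\<lambda>n. cis (w n)) \<longlonglongrightarrow> cis w0"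
    using vlim by (auto intro!: tendsto_intros)
  have vw: "cis v0 \<noteq> cis w0" using cis_eq_imp_eq[of v0 w0] bd t3 t4 by auto
  have "D x0 (cis v0) * D y0 (cis w0) = D x0 (cis w0) * D y0 (cis v0)"
  proof (rule LIMSEQ_unique)
    show "(\<lambda>n. D (x (m n)) (cis (v n)) * D (y (m n)) (cis (w n))) \<longlonglongrightarrow> D x0 (cis v0) * D y0 (cis w0)"
      using X by (intro tendsto_intros tendsto_D xm cv) auto
    have "(\<lambda>n. D (x (m n)) (cis (w n)) * D (y (m n)) (cis (v n))) \<longlonglongrightarrow> D x0 (cis w0) * D y0 (cis v0)"
      using X by (intro tendsto_intros tendsto_D xm cv) auto
    then show "(\<lambda>n. D (x (m n)) (cis (v n)) * D (y (m n)) (cis (w n))) \<longlonglongrightarrow> D x0 (cis w0) * D y0 (cis v0)"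
      using hv(1) by (simp add: harm_def)
  qed
  then have h1: "harm x0 y0 (cis v0) (cis w0)" using X ne vw by (simp add: harm_def)
  have "D p (cis v0) * D q (cis w0) = D p (cis w0) * D q (cis v0)"
  proof (rule LIMSEQ_unique)
    show "(\<lambda>n. D p (cis (v n)) * D q (cis (w n))) \<longlonglongrightarrow> D p (cis v0) * D q (cis w0)"
      using pX by (intro tendsto_intros tendsto_D xm cv) auto
    have "(\<lambda>n. D p (cis (w n)) * D q (cis (v n))) \<longlonglongrightarrow> D p (cis w0) * D q (cis v0)"
      using pX by (intro tendsto_intros tendsto_D xm cv) auto
    then show "(\<lambda>n. D p (cis (v n)) * D q (cis (w n))) \<longlonglongrightarrow> D p (cis w0) * D q (cis v0)"
      using hv(2) by (simp add: harm_def)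
  qed
  then have h2: "harm p q (cis v0) (cis w0)" using pX \<open>p \<noteq> q\<close> vw by (simp add: harm_def)
  \<comment> \<open>Limits preserve only weak inequalities; \<open>harm_distinct\<close> makes them
    strict, as \<open>common_perpendicular_unique\<close> requires.\<close>
  have "v0 \<noteq> s" "v0 \<noteq> t" "w0 \<noteq> t3" "w0 \<noteq> t4" using harm_distinct[OF h1] harm_distinct[OF h2] by (auto simp: defs p_def q_def)
  then have "v0 = r \<and> w0 = r'"
    using common_perpendicular_unique[of s t t3 t4 v0 r w0 r'] ord t3 t4 bd h1 h2 h0' pq
    by (simp add: defs p_def q_def)
  then have v0: "cis v0 = z0" "cis w0 = u0" by (auto simp: defs)
  note cv = cv[unfolded v0]
  define l where "l = (\<lambda>n. line_dist z0 u0 x0 p + line_dist p q z0 (cis (v n))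
     + line_dist (cis (v n)) (cis (w n)) p (x (m n)) + line_dist (x (m n)) (y (m n)) (cis (v n)) (z (m n)))"
  have "l \<longlonglongrightarrow> line_dist z0 u0 x0 p + line_dist p q z0 z0 + line_dist z0 u0 p x0 + line_dist x0 y0 z0 z0"
    unfolding l_def using X pX ne harm_distinct[OF pq]
    by (intro tendsto_add tendsto_const tendsto_line_dist xm cv) auto
  moreover have "line_dist p q z0 z0 = 0" "line_dist x0 y0 z0 z0 = 0" by (simp_all add: line_dist_def)
  ultimately have "l \<longlonglongrightarrow> e / 2" using eta by simp
  then have "\<forall>\<^sub>F n in sequentially. l n < e" by (rule order_tendstoD(2)) (use e in simp)
  then obtain n where n: "l n < e" by (auto simp: eventually_sequentially)
  have "reach (quad x0 y0 z0 u0) (l n) (quad (x (m n)) (y (m n)) (z (m n)) (u (m n)))"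
    unfolding l_def
    by (rule reach_trans[OF reach_trans[OF reach_trans[OF reach_line'[OF h0' pq] reach_line[OF pq hv(2)]]
      reach_line'[OF hv(2,1)]] reach_line[OF hv(1) h]])
  with n show ?thesis unfolding defs[symmetric] by blast
qed

lemma reach_small:
  assumes lim: "x \<longlonglongrightarrow> x0" "y \<longlonglongrightarrow> y0" "z \<longlonglongrightarrow> z0" "u \<longlonglongrightarrow> u0"
    and h: "\<And>n. harm (x n) (y n) (z n) (u n)" and h0: "harm x0 y0 z0 u0" and e: "0 < e"
  shows "\<exists>n l. l < e \<and> reach (quad x0 y0 z0 u0) l (quad (x n) (y n) (z n) (u n))"
proof -
  have "x0 \<in> X" "y0 \<in> X" "x0 \<noteq> y0" using h0 by (auto simp: harm_def)
  then obtain s t where st: "s < t" "t < s + 2 * pi" "x0 = cis s" "y0 = cis t" by (rule two_points)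
  obtain r r' where r: "s < r" "r < t" "t < r'" "r' < s + 2 * pi" 
    "(z0, u0) = (cis r, cis r') \<or> (z0, u0) = (cis r', cis r)"
    using harm_arcs[OF h0[unfolded st] st(1,2)] .
  from r(5) show ?thesis
  proof
    assume "(z0, u0) = (cis r, cis r')"
    then show ?thesis using reach_small_aux[OF _ _ _ _ r(1-4) h _ e] lim h0 st by simp
  next
    assume "(z0, u0) = (cis r', cis r)"
    then show ?thesis using reach_small_aux[OF _ _ _ _ r(1-4) harm_swap(2)[OF h] _ e] lim harm_swap(2)[OF h0] st
      by (simp add: insert_commute)
  qed
qed

end

section \<open>The zig-zag distance\<close>

text \<open>These two facts are the whole link between \<open>M\<close> and \<open>D\<close>: the
  zig-zag distance is determined by the harmonic tuples and the segment lengths.\<close>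

locale zigzag_circle = moebius_circle +
  fixes M :: "(complex \<Rightarrow> complex \<Rightarrow> ennreal) set"
  assumes harmonic_tuples_eq: "harmonic_tuples X M = {(x, y, z, u). harm x y z u}"
    and segment_length_eq: "\<lbrakk>harm x y z u; harm x y z' u'\<rbrakk> \<Longrightarrow>
      segment_length M {x, y} (quad x y z u) (quad x y z' u') = line_dist x y z z'"
begin

abbreviation H where "H \<equiv> Hm X M"
abbreviation \<delta> where "\<delta> \<equiv> zz_dist X M"

lemma unordered_eq: "unordered (x, y, z, u) = quad x y z u"
  by (simp add: unordered_def)

lemma Hm_iff: "q \<in> H \<longleftrightarrow> (\<exists>x y z u. harm x y z u \<and> q = quad x y z u)"
proof
  assume "q \<in> H"
  then obtain t where t: "t \<in> harmonic_tuples X M" "q = unordered t" unfolding Hm_def by (rule imageE)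
  obtain x y z u where "t = (x, y, z, u)" by (cases t)
  with t have "harm x y z u \<and> q = quad x y z u" by (simp add: harmonic_tuples_eq unordered_eq)
  then show "\<exists>x y z u. harm x y z u \<and> q = quad x y z u" by blast
next
  assume "\<exists>x y z u. harm x y z u \<and> q = quad x y z u"
  then obtain x y z u where h: "harm x y z u" "q = quad x y z u" by blast
  then have "unordered (x, y, z, u) \<in> H" unfolding Hm_def harmonic_tuples_eq by (intro imageI) simp
  with h show "q \<in> H" by (simp add: unordered_eq)
qed

lemma Hm_I: "harm x y z u \<Longrightarrow> quad x y z u \<in> H"
  by (auto simp: Hm_iff)

lemma line_iff: "p \<in> line X M a \<longleftrightarrow> (\<exists>x y z u. harm x y z u \<and> a = {x, y} \<and> p = quad x y z u)"
proof
  assume "p \<in> line X M a"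
  then obtain x y z u where h: "harm x y z u" "p = quad x y z u" "a = {x, y} \<or> a = {z, u}"
    by (auto simp: line_def Hm_iff)
  from h(3) show "\<exists>x y z u. harm x y z u \<and> a = {x, y} \<and> p = quad x y z u"
  proof
    assume "a = {z, u}"
    with harm_swap(3)[OF h(1)] h(2) show ?thesis
      by (intro exI[of _ z] exI[of _ u] exI[of _ x] exI[of _ y]) (simp add: insert_commute)
  qed (use h in blast)
qed (auto simp: line_def Hm_iff)

lemma side_cases:
  assumes "p \<in> line X M a" "p' \<in> line X M a"
  obtains x y z u z' u' where "harm x y z u" "harm x y z' u'" "a = {x, y}" "p = quad x y z u" "p' = quad x y z' u'"
proof -
  obtain x y z u where 1: "harm x y z u" "a = {x, y}" "p = quad x y z u" using assms(1) line_iff by auto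
  obtain x' y' z' u' where 2: "harm x' y' z' u'" "a = {x', y'}" "p' = quad x' y' z' u'" using assms(2) line_iff by auto
  have "harm x y z' u'" using 2(1) harm_swap(1)[OF 2(1)] 1(2) 2(2) by (auto simp: doubleton_eq_iff)
  with that 1 2 show ?thesis by metis
qed

lemma zz_path_imp_reach: "zz_path X M q S q' \<Longrightarrow> reach q (zz_length M S) q'"
proof (induction S arbitrary: q)
  case Nil
  then show ?case by (auto simp: zz_length_def Hm_iff intro: reach.stay)
next
  case (Cons side S)
  obtain a p p' where s: "side = (a, p, p')" by (cases side)
  with Cons.prems have p: "p = q" "p \<in> line X M a" "p' \<in> line X M a" "zz_path X M p' S q'" by auto
  obtain x y z u z' u' where h: "harm x y z u" "harm x y z' u'" "a = {x, y}" "p = quad x y z u" "p' = quad x y z' u'"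
    using side_cases[OF p(2,3)] .
  have "reach (quad x y z u) (line_dist x y z z' + zz_length M S) q'"
    using reach.move[OF h(1,2)] Cons.IH[OF p(4)] h(5) by simp
  moreover have "zz_length M (side # S) = line_dist x y z z' + zz_length M S"
    using segment_length_eq[OF h(1,2)] by (simp add: zz_length_def s h)
  ultimately show ?case using p(1) h(4) by simp
qed

text \<open>If the path already starts on the line of the new side, a degenerate side on the other axis of
  the junction separates the two.\<close>

lemma zz_path_prepend:
  assumes h: "harm x y z u" "harm x y z' u'" and S: "zz_path X M (quad x y z' u') S q'"
  shows "\<exists>S'. zz_path X M (quad x y z u) S' q' \<and> zz_length M S' = line_dist x y z z' + zz_length M S"
proof -
  define a where "a = {x, y}"
  define p p' where "p = quad x y z u" and "p' = quad x y z' u'"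
  have p: "p \<in> line X M a" "p' \<in> line X M a" using h by (auto simp: line_iff a_def p_def p'_def)
  have sl: "segment_length M a p p' = line_dist x y z z'"
    unfolding a_def p_def p'_def by (rule segment_length_eq[OF h])
  have S': "zz_path X M p' S q'" using S by (simp add: p'_def)
  have "\<exists>S'. zz_path X M p S' q' \<and> zz_length M S' = line_dist x y z z' + zz_length M S"
  proof (cases S)
    case Nil
    then show ?thesis using p S' sl by (intro exI[of _ "[(a, p, p')]"]) (auto simp: zz_length_def)
  next
    case (Cons side S0)
    obtain a2 p2 p2' where side: "side = (a2, p2, p2')" by (cases side)
    then have "p' \<in> line X M a2" using S' Cons by auto
    then have "a2 = {x, y} \<or> a2 = {z', u'}" by (auto simp: line_def p'_def)
    then show ?thesis
    proof
      assume "a2 = {z', u'}"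
      then have "p' = {a, a2}" by (simp add: p'_def a_def)
      then show ?thesis using p S' sl Cons side
        by (intro exI[of _ "(a, p, p') # S"]) (auto simp: zz_length_def)
    next
      assume a2: "a2 = {x, y}"
      define b where "b = {z', u'}"
      have h': "harm z' u' x y" using harm_swap(3)[OF h(2)] .
      have "p' = quad z' u' x y" by (simp add: p'_def insert_commute)
      with h' segment_length_eq[OF h' h'] have b: "p' \<in> line X M b" "segment_length M b p' p' = 0"
        by (auto simp: line_iff b_def line_dist_def)
      have "p' = {a, b}" "p' = {b, a2}" by (auto simp: p'_def a_def b_def a2)
      then show ?thesis using p S' sl b Cons side
        by (intro exI[of _ "(a, p, p') # (b, p', p') # S"]) (auto simp: zz_length_def)
    qed
  qed
  then show ?thesis by (simp add: p_def)
qed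

lemma reach_iff_zz_path: "reach q l q' \<longleftrightarrow> (\<exists>S. zz_path X M q S q' \<and> zz_length M S = l)"
proof
  assume "reach q l q'"
  then show "\<exists>S. zz_path X M q S q' \<and> zz_length M S = l"
  proof (induction rule: reach.induct)
    case (stay x y z u)
    then show ?case by (intro exI[of _ "[]"]) (auto simp: zz_length_def Hm_iff)
  next
    case (move x y z u z' u' l q')
    then show ?case using zz_path_prepend[OF move.hyps(1,2)] by metis
  qed
qed (auto intro: zz_path_imp_reach)

lemma reach_Hm: "reach q l q' \<Longrightarrow> q \<in> H \<and> q' \<in> H"
  by (induction rule: reach.induct) (auto intro: Hm_I)

section \<open>The pseudometric \<open>\<delta>\<close> as an infimum of path lengths\<close>

lemma zz_dist_eq: "q \<in> H \<Longrightarrow> q' \<in> H \<Longrightarrow> \<delta> q q' = Inf {l. reach q l q'}"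
  unfolding zz_dist_def reach_iff_zz_path by (auto intro!: arg_cong[of _ _ Inf])

lemma reach_imp_dist_le: "reach q l q' \<Longrightarrow> \<delta> q q' \<le> l"
  using reach_Hm[of q l q'] by (auto simp: zz_dist_eq intro!: cInf_lower bdd_belowI[of _ 0] reach_nonneg)

lemma Hm_reach_ex: "q \<in> H \<Longrightarrow> q' \<in> H \<Longrightarrow> \<exists>l. reach q l q'"
  by (auto simp: Hm_iff reach_ex)

lemma dist_less_imp_reach:
  assumes "q \<in> H" "q' \<in> H" "\<delta> q q' < e"
  obtains l where "reach q l q'" "l < e" "0 \<le> l"
  using cInf_lessD[of "{l. reach q l q'}" e] assms Hm_reach_ex[OF assms(1,2)] reach_nonneg
  by (auto simp: zz_dist_eq)

lemma dist_nonneg: "0 \<le> \<delta> q q'"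
proof (cases "q \<in> H \<and> q' \<in> H")
  case True
  then show ?thesis using Hm_reach_ex[of q q'] reach_nonneg
    by (auto simp: zz_dist_eq intro!: cInf_greatest)
qed (auto simp: zz_dist_def)

lemma dist_sym: "\<delta> q q' = \<delta> q' q"
proof (cases "q \<in> H \<and> q' \<in> H")
  case True
  moreover have "{l. reach q l q'} = {l. reach q' l q}" using reach_sym by blast
  ultimately show ?thesis by (simp add: zz_dist_eq)
qed (auto simp: zz_dist_def)

lemma dist_triangle_Hm:
  assumes "p \<in> H" "q \<in> H" "r \<in> H"
  shows "\<delta> p r \<le> \<delta> p q + \<delta> q r"
proof (rule field_le_epsilon)
  fix e :: real assume "0 < e"
  obtain l where l: "reach p l q" "l < \<delta> p q + e / 2"
    using dist_less_imp_reach[of p q "\<delta> p q + e / 2"] assms \<open>0 < e\<close> by auto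
  obtain l' where l': "reach q l' r" "l' < \<delta> q r + e / 2"
    using dist_less_imp_reach[of q r "\<delta> q r + e / 2"] assms \<open>0 < e\<close> by auto
  from reach_imp_dist_le[OF reach_trans[OF l(1) l'(1)]] l l' show "\<delta> p r \<le> \<delta> p q + \<delta> q r + e" by linarith
qed

section \<open>Nondegeneracy and the induced topology\<close>

text \<open>For a fixed tuple the displacement bound is continuous in the length and vanishes at
  0.\<close>

lemma dist_imp_near:
  assumes h: "harm x y z u" and e: "0 < e"
  obtains r where "0 < r" "\<And>q'. q' \<in> H \<Longrightarrow> \<delta> (quad x y z u) q' < r \<Longrightarrow>
    \<exists>x' y' z' u'. harm x' y' z' u' \<and> q' = quad x' y' z' u' \<and> D x x' < e \<and> D y y' < e \<and> D z z' < e \<and> D u u' < e"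
proof -
  define F where "F = height x y z u"
  define b where "b = (\<lambda>l. displacement_bound l F)"
  have "isCont b 0" unfolding b_def displacement_bound_def by (intro continuous_intros)
  moreover have "b 0 = 0" by (simp add: b_def displacement_bound_def)
  ultimately obtain r where r: "0 < r" "\<And>l. \<bar>l\<bar> < r \<Longrightarrow> \<bar>b l\<bar> < e"
    using e unfolding continuous_at_eps_delta by (auto simp: dist_real_def)
  show ?thesis
  proof (rule that[OF r(1)])
    fix q' assume q': "q' \<in> H" "\<delta> (quad x y z u) q' < r"
    obtain l where l: "reach (quad x y z u) l q'" "l < r" "0 \<le> l"
      using dist_less_imp_reach[OF Hm_I[OF h] q'] .
    have "b l < e" using r(2)[of l] l by simp
    moreover obtain x' y' z' u' where "harm x' y' z' u'" "q' = quad x' y' z' u'"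
      "D x x' \<le> b l" "D y y' \<le> b l" "D z z' \<le> b l" "D u u' \<le> b l"
      using reach_near[OF l(1)] h unfolding near_def b_def F_def by blast
    ultimately show "\<exists>x' y' z' u'. harm x' y' z' u' \<and> q' = quad x' y' z' u' \<and> D x x' < e \<and> D y y' < e \<and> D z z' < e \<and> D u u' < e"
      by (intro exI[of _ x'] exI[of _ y'] exI[of _ z'] exI[of _ u'] conjI) (assumption | erule (1) le_less_trans)+
  qed
qed

lemma dist_eq_0_iff:
  assumes "q \<in> H" "q' \<in> H"
  shows "\<delta> q q' = 0 \<longleftrightarrow> q = q'"
proof
  assume "q = q'"
  then have "reach q 0 q'" using assms by (auto simp: Hm_iff intro: reach.stay)
  then show "\<delta> q q' = 0" using reach_imp_dist_le dist_nonneg by (metis order_antisym)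
next
  assume d: "\<delta> q q' = 0"
  obtain x y z u where h: "harm x y z u" "q = quad x y z u" using assms(1) Hm_iff by auto
  obtain a b c d where q': "q' = quad a b c d" using assms(2) Hm_iff by auto
  define P where "P = {x, y, z, u, a, b, c, d}"
  \<comment> \<open>At most the least distance between distinct points of the two harmonic pairs, so
    a displacement below \<open>e\<close> forces equality.\<close>
  define e where "e = Min (insert 1 ((\<lambda>(v, w). D v w) ` {(v, w) \<in> P \<times> P. v \<noteq> w}))"
  have fin: "finite P" by (simp add: P_def)
  have "finite {(v, w) \<in> P \<times> P. v \<noteq> w}" by (rule finite_subset[of _ "P \<times> P"]) (use fin in auto)
  then have e: "0 < e" "\<And>v w. v \<in> P \<Longrightarrow> w \<in> P \<Longrightarrow> v \<noteq> w \<Longrightarrow> e \<le> D v w"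
    by (auto simp: e_def intro!: Min_le)
  obtain r where r: "0 < r" "\<And>q'. q' \<in> H \<Longrightarrow> \<delta> (quad x y z u) q' < r \<Longrightarrow>
    \<exists>x' y' z' u'. harm x' y' z' u' \<and> q' = quad x' y' z' u' \<and> D x x' < e \<and> D y y' < e \<and> D z z' < e \<and> D u u' < e"
    using dist_imp_near[OF h(1) e(1)] by metis
  obtain x' y' z' u' where *: "q' = quad x' y' z' u'" "D x x' < e" "D y y' < e" "D z z' < e" "D u u' < e"
    using r(2)[OF assms(2)] d r(1) h(2) by auto
  \<comment> \<open>The tuple supplied by \<open>dist_imp_near\<close> need not be
    \<open>(a, b, c, d)\<close>, but it has the same points, namely the union of the two
    axes.\<close>
  have un: "\<Union> (quad v w v' w') = {v, w, v', w'}" for v w v' w' :: complex by auto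
  have "{x', y', z', u'} = {a, b, c, d}" unfolding un[symmetric] *(1)[symmetric] q'[symmetric] ..
  then have "{x', y', z', u'} \<subseteq> P" by (auto simp: P_def)
  then have "x' \<in> P" "y' \<in> P" "z' \<in> P" "u' \<in> P" by auto
  moreover have "x \<in> P" "y \<in> P" "z \<in> P" "u \<in> P" by (auto simp: P_def)
  ultimately have "x = x'" "y = y'" "z = z'" "u = u'" using e(2) * by (meson not_less)+
  then show "q = q'" using h * by simp
qed

sublocale Hm: Metric_space H \<delta>
  by unfold_locales (auto simp: dist_nonneg dist_eq_0_iff intro: dist_sym dist_triangle_Hm)

text \<open>One inclusion is \<open>dist_imp_near\<close> followed by \<open>D_near\<close>. The
  other is sequential: a tuple without a suitable neighbourhood is a limit of tuples mapped outside
  \<open>U\<close>, and \<open>reach_small\<close> joins it to one of them by a short path.\<close>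

lemma mtopology_eq: "Hm.mtopology = Hm_topology X M"
  unfolding topology_eq
proof
  fix U
  let ?pre = "{t \<in> harmonic_tuples X M. unordered t \<in> U}"
  show "openin Hm.mtopology U \<longleftrightarrow> openin (Hm_topology X M) U"
  proof (cases "U \<subseteq> H")
    case False
    then show ?thesis by (auto simp: Hm.openin_mtopology openin_Hm_topology)
  next
    case True
    show ?thesis
    proof
      assume "openin (Hm_topology X M) U"
      then have op: "openin (top_of_set (harmonic_tuples X M)) ?pre" by (simp add: openin_Hm_topology)
      have "\<exists>r>0. Hm.mball q r \<subseteq> U" if q: "q \<in> U" for q
      proof -
        have "q \<in> H" using q True by blast
        then obtain x y z u where h: "harm x y z u" "q = quad x y z u" unfolding Hm_iff by blast
        have X: "x \<in> X" "y \<in> X" "z \<in> X" "u \<in> X" using h by (auto simp: harm_def)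
        have "(x, y, z, u) \<in> ?pre" using h q by (simp add: harmonic_tuples_eq unordered_eq)
        then obtain e where e: "0 < e" "\<And>t. t \<in> harmonic_tuples X M \<Longrightarrow> dist t (x, y, z, u) < e \<Longrightarrow> t \<in> ?pre"
          using op unfolding openin_euclidean_subtopology_iff by meson
        have e4: "0 < e / 4" using e by simp
        obtain r1 where r1: "0 < r1" "\<And>y. y \<in> X \<Longrightarrow> D x y < r1 \<Longrightarrow> dist x y < e / 4" using D_near[OF X(1) e4] by metis
        obtain r2 where r2: "0 < r2" "\<And>x. x \<in> X \<Longrightarrow> D y x < r2 \<Longrightarrow> dist y x < e / 4" using D_near[OF X(2) e4] by metis
        obtain r3 where r3: "0 < r3" "\<And>y. y \<in> X \<Longrightarrow> D z y < r3 \<Longrightarrow> dist z y < e / 4" using D_near[OF X(3) e4] by metis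
        obtain r4 where r4: "0 < r4" "\<And>y. y \<in> X \<Longrightarrow> D u y < r4 \<Longrightarrow> dist u y < e / 4" using D_near[OF X(4) e4] by metis
        define \<rho> where "\<rho> = min (min r1 r2) (min r3 r4)"
        have "0 < \<rho>" using r1 r2 r3 r4 by (simp add: \<rho>_def)
        then obtain r where r: "0 < r" "\<And>q'. q' \<in> H \<Longrightarrow> \<delta> q q' < r \<Longrightarrow>
          \<exists>x' y' z' u'. harm x' y' z' u' \<and> q' = quad x' y' z' u' \<and> D x x' < \<rho> \<and> D y y' < \<rho> \<and> D z z' < \<rho> \<and> D u u' < \<rho>"
          using dist_imp_near[OF h(1)] h(2) by metis
        have "q' \<in> U" if q': "q' \<in> Hm.mball q r" for q'
        proof -
          obtain x' y' z' u' where *: "harm x' y' z' u'" "q' = quad x' y' z' u'" "D x x' < \<rho>" "D y y' < \<rho>" "D z z' < \<rho>" "D u u' < \<rho>"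
            using r(2)[of q'] q' by auto
          have "dist x x' < e / 4" "dist y y' < e / 4" "dist z z' < e / 4" "dist u u' < e / 4"
            using * r1 r2 r3 r4 by (auto simp: harm_def \<rho>_def)
          then have "dist (x', y', z', u') (x, y, z, u) < e"
            using dist_quadruple_le[of x y z u x' y' z' u'] by (simp add: dist_commute)
          then show ?thesis using e(2)[of "(x', y', z', u')"] * by (simp add: harmonic_tuples_eq unordered_eq)
        qed
        with r(1) show ?thesis by blast
      qed
      then show "openin Hm.mtopology U" using True by (simp add: Hm.openin_mtopology)
    next
      assume op: "openin Hm.mtopology U"
      have "\<exists>e>0. \<forall>t'\<in>harmonic_tuples X M. dist t' t < e \<longrightarrow> t' \<in> ?pre" if t: "t \<in> ?pre" for t
      proof (rule ccontr)
        obtain x y z u where xyzu: "t = (x, y, z, u)" by (cases t)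
        have h: "harm x y z u" "quad x y z u \<in> U" using t by (auto simp: xyzu harmonic_tuples_eq unordered_eq)
        obtain r where r: "0 < r" "Hm.mball (quad x y z u) r \<subseteq> U"
          using op h(2) by (auto simp: Hm.openin_mtopology)
        assume "\<not> (\<exists>e>0. \<forall>t'\<in>harmonic_tuples X M. dist t' t < e \<longrightarrow> t' \<in> ?pre)"
        then have "\<forall>e>0. \<exists>t'\<in>harmonic_tuples X M. dist t' t < e \<and> unordered t' \<notin> U" by blast
        then have "\<forall>n. \<exists>t'\<in>harmonic_tuples X M. dist t' t < 1 / real (Suc n) \<and> unordered t' \<notin> U" by simp
        then obtain t' where t': "\<And>n. t' n \<in> harmonic_tuples X M" "\<And>n. dist (t' n) t < 1 / real (Suc n)"
          "\<And>n. unordered (t' n) \<notin> U" by metis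
        have "(\<lambda>n. dist (t' n) t) \<longlonglongrightarrow> 0"
          by (rule Lim_null_comparison[OF _ LIMSEQ_Suc[OF lim_1_over_n]]) (use t'(2)[THEN less_imp_le] in simp)
        then have lim: "t' \<longlonglongrightarrow> t" by (rule tendsto_dist_iff[THEN iffD2])
        define x' y' z' u' where "x' = (\<lambda>n. fst (t' n))" and "y' = (\<lambda>n. fst (snd (t' n)))"
          and "z' = (\<lambda>n. fst (snd (snd (t' n))))" and "u' = (\<lambda>n. snd (snd (snd (t' n))))"
        have t'_eq: "t' n = (x' n, y' n, z' n, u' n)" for n by (simp add: x'_def y'_def z'_def u'_def)
        have lims: "x' \<longlonglongrightarrow> x" "y' \<longlonglongrightarrow> y" "z' \<longlonglongrightarrow> z" "u' \<longlonglongrightarrow> u"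
          using tendsto_fst[OF lim] tendsto_fst[OF tendsto_snd[OF lim]] tendsto_fst[OF tendsto_snd[OF tendsto_snd[OF lim]]]
            tendsto_snd[OF tendsto_snd[OF tendsto_snd[OF lim]]]
          by (simp_all add: xyzu x'_def y'_def z'_def u'_def)
        have h': "harm (x' n) (y' n) (z' n) (u' n)" for n using t'(1)[of n] by (simp add: t'_eq harmonic_tuples_eq)
        obtain n l where nl: "l < r" "reach (quad x y z u) l (quad (x' n) (y' n) (z' n) (u' n))"
          using reach_small[OF lims h' h(1) r(1)] by blast
        then have "quad (x' n) (y' n) (z' n) (u' n) \<in> Hm.mball (quad x y z u) r"
          using reach_imp_dist_le[OF nl(2)] reach_Hm[OF nl(2)] by (auto simp: Hm.in_mball)
        with r(2) t'(3)[of n] show False by (auto simp: t'_eq unordered_eq)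
      qed
      then show "openin (Hm_topology X M) U"
        unfolding openin_Hm_topology openin_euclidean_subtopology_iff using True by auto
    qed
  qed
qed

section \<open>Compact balls and geodesics\<close>

text \<open>The lower bound \<open>c\<close> keeps the axes from collapsing, so that harmonicity
  becomes a closed condition on the compact fourth power of \<open>X\<close>.\<close>

lemma compact_harm_tuples:
  assumes "0 < c"
  shows "compact {(x, y, z, u). harm x y z u \<and> c \<le> D x y \<and> c \<le> D z u}"
proof -
  define Y where "Y = X \<times> X \<times> X \<times> X"
  define f1 f2 f3 where "f1 = (\<lambda>t::complex \<times> complex \<times> complex \<times> complex. D (fst t) (fst (snd t)))" and "f2 = (\<lambda>t::complex \<times> complex \<times> complex \<times> complex. D (fst (snd (snd t))) (snd (snd (snd t))))"
    and "f3 = (\<lambda>t::complex \<times> complex \<times> complex \<times> complex. D (fst t) (fst (snd (snd t))) * D (fst (snd t)) (snd (snd (snd t))) -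
      D (fst t) (snd (snd (snd t))) * D (fst (snd t)) (fst (snd (snd t))))"
  have Y: "compact Y" unfolding Y_def by (intro compact_Times) auto
  have "continuous_on Y f1" "continuous_on Y f2" "continuous_on Y f3"
    unfolding f1_def f2_def f3_def Y_def by (intro continuous_intros continuous_on_D; force)+
  then have cl: "closed (Y \<inter> f1 -` {c..})" "closed (Y \<inter> f2 -` {c..})" "closed (Y \<inter> f3 -` {0})"
    using compact_imp_closed[OF Y] by (auto intro!: continuous_closed_preimage)
  have "compact (Y \<inter> ((Y \<inter> f1 -` {c..}) \<inter> (Y \<inter> f2 -` {c..}) \<inter> (Y \<inter> f3 -` {0})))"
    by (intro compact_Int_closed[OF Y] closed_Int[OF closed_Int[OF cl(1,2)] cl(3)])
  also have "Y \<inter> ((Y \<inter> f1 -` {c..}) \<inter> (Y \<inter> f2 -` {c..}) \<inter> (Y \<inter> f3 -` {0}))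
    = {(x, y, z, u). harm x y z u \<and> c \<le> D x y \<and> c \<le> D z u}"
    using assms by (auto simp: Y_def f1_def f2_def f3_def harm_def)
  finally show ?thesis .
qed

lemma proper_Hm: "proper_metric H \<delta>"
  unfolding proper_metric_def
proof (intro ballI allI)
  fix p r assume p: "p \<in> H"
  obtain x y z u where h: "harm x y z u" "p = quad x y z u" using p Hm_iff by auto
  \<comment> \<open>A distance of at most \<open>r\<close> is an infimum and only yields a path
    shorter than \<open>r + 1\<close>, hence the shift by 1.\<close>
  define C where "C = exp (16 / \<alpha> * \<bar>r + 1\<bar>) * height x y z u"
  have C: "0 < C" using height_pos[OF h(1)] by (simp add: C_def)
  define K where "K = {(x, y, z, u). harm x y z u \<and> 1 / C \<le> D x y \<and> 1 / C \<le> D z u}"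
  have "compactin (top_of_set (harmonic_tuples X M)) K"
    using compact_harm_tuples[of "1 / C"] C
    by (auto simp: compactin_subtopology K_def harmonic_tuples_eq)
  moreover have "continuous_map (top_of_set (harmonic_tuples X M)) (Hm_topology X M) unordered"
  proof -
    have "openin (Hm_topology X M) H"
    proof -
      have "{t \<in> harmonic_tuples X M. unordered t \<in> H} = harmonic_tuples X M" by (auto simp: Hm_def)
      then show ?thesis unfolding openin_Hm_topology by simp
    qed
    then have "topspace (Hm_topology X M) = H"
      by (metis openin_Hm_topology openin_subset openin_topspace subset_antisym)
    then show ?thesis
      unfolding continuous_map_def by (auto simp: Hm_def openin_Hm_topology)
  qed
  ultimately have "compactin (Hm_topology X M) (unordered ` K)" by (rule image_compactin)
  then have "compactin Hm.mtopology (unordered ` K)" by (simp add: mtopology_eq)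
  moreover have "Hm.mcball p r \<subseteq> unordered ` K"
  proof
    fix q assume "q \<in> Hm.mcball p r"
    then have q: "q \<in> H" "\<delta> p q < r + 1" by (auto simp: Hm.in_mcball)
    obtain l where l: "reach p l q" "l < r + 1" "0 \<le> l" using dist_less_imp_reach[OF p q] .
    obtain x' y' z' u' where q': "harm x' y' z' u'" "q = quad x' y' z' u'" "height x' y' z' u' \<le> exp (16 / \<alpha> * l) * height x y z u"
      using reach_near[OF l(1)] h unfolding near_def by blast
    have "exp (16 / \<alpha> * l) * height x y z u \<le> C"
      unfolding C_def using l height_pos[OF h(1)] \<alpha>_pos
      by (intro mult_right_mono) (auto intro!: divide_right_mono)
    with q'(3) have "height x' y' z' u' \<le> C" by linarith
    moreover have pos: "0 < D x' y'" "0 < D z' u'" using q'(1) by (auto simp: harm_def)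
    then have "0 < 1 / D x' y'" "0 < 1 / D z' u'" by auto
    ultimately have "1 / D x' y' \<le> C" "1 / D z' u' \<le> C" unfolding height_def by linarith+
    then have "1 / C \<le> D x' y'" "1 / C \<le> D z' u'" using pos C by (auto simp: field_simps)
    then have "(x', y', z', u') \<in> K" using q'(1) by (simp add: K_def)
    then show "q \<in> unordered ` K" using q'(2) by (force simp: unordered_eq)
  qed
  ultimately show "compactin Hm.mtopology (Hm.mcball p r)"
    by (rule closed_compactin) simp
qed

lemma geodesic_Hm: "geodesic_metric H \<delta>"
proof (rule Hm.complete_intermediate_imp_geodesic[OF Hm.proper_metric_imp_mcomplete[OF proper_Hm]])
  fix p q t assume pq: "p \<in> H" "q \<in> H" and t: "0 \<le> t" "t \<le> \<delta> p q"
  have "\<exists>m\<in>H. \<delta> p m \<le> t \<and> \<delta> m q \<le> \<delta> p q - t + e" if e: "0 < e" for e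
  proof -
    obtain l where l: "reach p l q" "l < \<delta> p q + e"
      using dist_less_imp_reach[OF pq, of "\<delta> p q + e"] e by auto
    have "t \<le> l" using t reach_imp_dist_le[OF l(1)] by linarith
    with reach_split[OF l(1) t(1)] obtain m where m: "reach p t m" "reach m (l - t) q" by blast
    with reach_imp_dist_le[OF m(1)] reach_imp_dist_le[OF m(2)] reach_Hm[OF m(1)] l(2) show ?thesis by force
  qed
  then show "\<exists>m\<in>H. \<delta> p m = t \<and> \<delta> m q = \<delta> p q - t"
    using Hm.proper_metric_intermediate_point[OF proper_Hm pq t] by metis
qed

end

section \<open>Transfer from the Moebius structure to the bounded metric\<close>

theorem theorem1p1:
  fixes X :: "complex set"
    and M :: "(complex \<Rightarrow> complex \<Rightarrow> ennreal) set"
    and \<alpha> :: real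
  assumes X: "X = sphere 0 1"
    and M: "moebius_structure X M"
    and P: "axiom_P X M"
    and \<alpha>: "0 < \<alpha>" "\<alpha> < 1"
    and M\<alpha>: "axiom_M \<alpha> X M"
    and T: "axiom_T X M"
  shows "(\<forall>q\<in>Hm X M. \<forall>q'\<in>Hm X M. zz_dist X M q q' \<noteq> 0 \<longleftrightarrow> q \<noteq> q') \<and>
    Metric_space (Hm X M) (zz_dist X M) \<and>
    Metric_space.mtopology (Hm X M) (zz_dist X M) = Hm_topology X M \<and>
    Metric_space.mcomplete (Hm X M) (zz_dist X M) \<and>
    proper_metric (Hm X M) (zz_dist X M) \<and>
    geodesic_metric (Hm X M) (zz_dist X M)"
proof -
  have two: "1 \<in> X" "-1 \<in> X" "(1::complex) \<noteq> -1" by (auto simp: X)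
  obtain D :: "complex \<Rightarrow> complex \<Rightarrow> real" where D': "(\<forall>x y. D x y = D y x) \<and> (\<forall>x y. D x y = 0 \<longleftrightarrow> x = y) \<and>
    (\<forall>x y z. D x z \<le> D x y + D y z) \<and> (\<forall>x y. D x y \<le> 1) \<and> (\<lambda>x y. ennreal (D x y)) \<in> M"
    using ptolemaic_bounded_metric[OF M P two] by (rule exE)
  then have D: "D x y = D y x" "D x y = 0 \<longleftrightarrow> x = y" "D x z \<le> D x y + D y z" "D x y \<le> 1" for x y z
    by blast+
  have DM: "(\<lambda>x y. ennreal (D x y)) \<in> M" using D' by blast
  have nonneg: "0 \<le> D x y" for x y
    using D(3)[of x x y] D(1)[of x y] D(2)[of x x] by simp
  have fac: "factor (\<lambda>x y. ennreal (D x y)) x y = D x y" for x y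
    using nonneg by (rule factor_ennreal)
  interpret moebius_circle D \<alpha>
  proof
    show "D x y = D y x" "D x z \<le> D x y + D y z" "D x y \<le> 1" "D x y = 0 \<longleftrightarrow> x = y" for x y z
      by (rule D)+
    show "0 < \<alpha>" "\<alpha> < 1" by (rule \<alpha>)+
  next
    fix t1 t2 t3 t4 :: real assume t: "t1 < t2" "t2 < t3" "t3 < t4" "t4 < t1 + 2 * pi"
    have "separate X (cis t1) (cis t3) (cis t2) (cis t4)" unfolding X using t by (rule separate_cis)
    moreover have "cis s \<in> X" for s by (simp add: X)
    ultimately have "D (cis t1) (cis t2) * D (cis t3) (cis t4) + \<alpha> * (D (cis t1) (cis t4) * D (cis t3) (cis t2))
        \<le> D (cis t1) (cis t3) * D (cis t2) (cis t4)"
      using M\<alpha> DM unfolding axiom_M_def by (fastforce simp: fac)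
    then show "D (cis t1) (cis t2) * D (cis t3) (cis t4) + \<alpha> * (D (cis t1) (cis t4) * D (cis t2) (cis t3))
        \<le> D (cis t1) (cis t3) * D (cis t2) (cis t4)" using D(1)[of "cis t3" "cis t2"] by simp
  next
    fix x :: complex and e :: real assume "x \<in> sphere 0 1" "0 < e"
    \<comment> \<open>The antipode serves as the point \<open>\<omega>\<close> at which
      \<open>axiom_T_ball_nhd\<close> inverts.\<close>
    moreover from this have "- x \<in> X" "- x \<noteq> x" by (auto simp: X)
    ultimately show "\<exists>r>0. \<forall>y\<in>sphere 0 1. dist x y < r \<longrightarrow> D x y < e"
      using axiom_T_ball_nhd[OF M T DM D(1,2) nonneg D(4), of x "- x" e] by (simp add: X)
  qed
  have M_D: "semimetric X d \<and> moebius_equivalent X d (\<lambda>x y. ennreal (D x y))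
      \<and> moebius_equivalent X (\<lambda>x y. ennreal (D x y)) d" if "d \<in> M" for d
    using M DM that unfolding moebius_structure_def
    by (blast intro: moebius_equivalent_sym moebius_equivalent_trans)
  have D_semi: "semimetric X (\<lambda>x y. ennreal (D x y))" using M_D[OF DM] by blast
  have harm_iff: "(x, y, z, u) \<in> harmonic_tuples X M \<longleftrightarrow> harm x y z u" for x y z u
  proof
    assume "(x, y, z, u) \<in> harmonic_tuples X M"
    then obtain d where d: "d \<in> M" "x \<in> X" "y \<in> X" "z \<in> X" "u \<in> X" "x \<noteq> y" "z \<noteq> u"
      "factor d x z * factor d y u = factor d x u * factor d y z" by (auto simp: harmonic_tuples_def)
    then have "D x z * D y u = D x u * D y z"
      using harmonic_iff_of_equivalent[of X d "\<lambda>x y. ennreal (D x y)" x y z u] M_D D_semi by (simp add: fac)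
    with d show "harm x y z u" by (simp add: harm_def X)
  next
    assume "harm x y z u"
    then show "(x, y, z, u) \<in> harmonic_tuples X M" using DM
      unfolding harmonic_tuples_def harm_def X by (auto simp: fac intro!: bexI[of _ "\<lambda>x y. ennreal (D x y)"])
  qed
  interpret zigzag_circle D \<alpha> M
  proof
    show "harmonic_tuples (sphere 0 1) M = {(x, y, z, u). harm x y z u}"
      using harm_iff by (auto simp: X)
  next
    fix x y z u z' u' assume h: "harm x y z u" "harm x y z' u'"
    have dist: "{x, y} \<noteq> {z, u}" "{x, y} \<noteq> {z', u'}"
      using harm_distinct[OF h(1)] harm_distinct[OF h(2)] by (auto simp: doubleton_eq_iff)
    \<comment> \<open>Every semi-metric in \<open>M\<close> and every choice of representatives give
      the same value, which is what the description operator in \<open>segment_length\<close>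
      needs.\<close>
    have *: "\<bar>ln ((factor d x1 z1' * factor d y1 z1) / (factor d x1 z1 * factor d y1 z1'))\<bar> = line_dist x y z z'"
      if d: "d \<in> M" and a: "{x, y} = {x1, y1}" and q: "quad x y z u = {{x, y}, {z1, u1}}"
        and q': "quad x y z' u' = {{x, y}, {z1', u1'}}" for d x1 y1 z1 u1 z1' u1'
    proof -
      have e: "{z, u} = {z1, u1}" "{z', u'} = {z1', u1'}" using q q' dist by (auto simp: doubleton_eq_iff[of "{x, y}"])
      have sub: "x1 \<in> {x, y}" "y1 \<in> {x, y}" "z1 \<in> {z, u}" "z1' \<in> {z', u'}" using a e by auto
      have "x1 \<noteq> y1" using h(1) a by (auto simp: harm_def doubleton_eq_iff)
      moreover have "x1 \<in> X" "y1 \<in> X" "z1 \<in> X" "z1' \<in> X" using sub h by (auto simp: harm_def X)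
      moreover have "x1 \<noteq> z1" "x1 \<noteq> z1'" "y1 \<noteq> z1" "y1 \<noteq> z1'"
        using sub harm_distinct[OF h(1)] harm_distinct[OF h(2)] by auto
      ultimately have "factor d x1 z1' * factor d y1 z1 / (factor d x1 z1 * factor d y1 z1')
        = D x1 z1' * D y1 z1 / (D x1 z1 * D y1 z1')"
        using factor_cross_ratio_eq[of X d "\<lambda>x y. ennreal (D x y)" x1 y1 z1 z1'] M_D[OF d] D_semi by (simp add: fac)
      then show ?thesis using line_dist_doubleton[OF h a e] by (simp add: line_dist_def)
    qed
    show "segment_length M {x, y} (quad x y z u) (quad x y z' u') = line_dist x y z z'"
      unfolding segment_length_def
    proof (rule the_equality)
      show "\<exists>d\<in>M. \<exists>x1 y1 z1 u1 z1' u1'. {x, y} = {x1, y1} \<and> quad x y z u = {{x, y}, {z1, u1}} \<and>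
          quad x y z' u' = {{x, y}, {z1', u1'}} \<and>
          line_dist x y z z' = \<bar>ln ((factor d x1 z1' * factor d y1 z1) / (factor d x1 z1 * factor d y1 z1'))\<bar>"
        using DM *[OF DM refl refl refl, symmetric] by blast
    next
      fix l assume "\<exists>d\<in>M. \<exists>x1 y1 z1 u1 z1' u1'. {x, y} = {x1, y1} \<and> quad x y z u = {{x, y}, {z1, u1}} \<and>
          quad x y z' u' = {{x, y}, {z1', u1'}} \<and>
          l = \<bar>ln ((factor d x1 z1' * factor d y1 z1) / (factor d x1 z1 * factor d y1 z1'))\<bar>"
      then show "l = line_dist x y z z'"
      proof (elim bexE exE conjE)
        fix d x1 y1 z1 u1 z1' u1'
        assume "d \<in> M" "{x, y} = {x1, y1}" "quad x y z u = {{x, y}, {z1, u1}}" "quad x y z' u' = {{x, y}, {z1', u1'}}"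
          and l: "l = \<bar>ln ((factor d x1 z1' * factor d y1 z1) / (factor d x1 z1 * factor d y1 z1'))\<bar>"
        then show ?thesis unfolding l by (intro * )
      qed
    qed
  qed
  show ?thesis
    unfolding X
    using dist_eq_0_iff Hm.Metric_space_axioms mtopology_eq proper_Hm geodesic_Hm
      Hm.proper_metric_imp_mcomplete[OF proper_Hm] by blast
qed

end
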